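(* Let $n,d\ge 1$ be integers, let $\alpha>0$, $1\leq p\leq\infty$, and let $W$ be a $d\times d$ matrix weight on $\mathbb{C}^n$. The following conditions are equivalent: (a) the Fock projection $P_{\alpha}$ is bounded on $L^p_{\alpha,W}(\mathbb{C}^n;\mathbb{C}^d)$; (b) the matrix weighted maximal Fock projection $P^+_{\alpha,W}:L^p_{\alpha}(\mathbb{C}^n;\mathbb{C}^d)\to L^p_{\alpha}(\mathbb{C}^n;\mathbb{C})$ is bounded; (c) $W$ is an $\mathcal{A}_{p,r}$-weight for any $r>0$; (d) $W$ is an $\mathcal{A}_{p,r}$-weight for some $r>0$. Moreover, for any fixed $r>0$, there exists a constant $c=c(\alpha,p,r,n)>0$, depending only on $\alpha,p,r,n$, such that, whenever these equivalent conditions hold, $$\left(\frac{\alpha r^2}{\pi}\right)^ne^{-n\alpha r^2}[W]_{\mathcal{A}_{p,r}}^{1/2}\leq\|P_{\alpha}\|\leq\left\|P^+_{\alpha,W}\right\|\leq c\,d^{c_p}[W]_{\mathcal{A}_{p,r}}^{c(1+\log[W]_{\mathcal{A}_{p,r}})},$$ where $c_p=7/2$ for $1<p<\infty$, and $c_1=c_{\infty}=9/2$. Here $\|P_\alpha\|$ is the operator norm on $L^p_{\alpha,W}(\mathbb{C}^n;\mathbb{C}^d)$ and $\|P^+_{\alpha,W}\|$ is the norm of $P^+_{\alpha,W}$ from $L^p_{\alpha}(\mathbb{C}^n;\mathbb{C}^d)$ to $L^p_{\alpha}(\mathbb{C}^n;\mathbb{C})$.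
   Context: Matrix weights. A $d\times d$ matrix-valued function $W$ on $\mathbb{C}^n$ is a matrix weight if $W(z)$ is a positive and invertible operator on $\mathbb{C}^d$ (i.e. positive definite) for almost every $z\in\mathbb{C}^n$, and both $W$ and $W^{-1}$ are locally integrable on $\mathbb{C}^n$. Spaces. $dv$ is Lebesgue measure on $\mathbb{C}^n$; $|\cdot|$ is the Hilbert space norm on $\mathbb{C}^d$ or $\mathbb{C}^n$. For $1\le p<\infty$, $L^p_{\alpha,W}(\mathbb{C}^n;\mathbb{C}^d)$ consists of the $\mathbb{C}^d$-valued measurable functions $f$ on $\mathbb{C}^n$ with $\|f\|^p_{L^p_{\alpha,W}(\mathbb{C}^n;\mathbb{C}^d)}:=\int_{\mathbb{C}^n}|W(z)f(z)|^pe^{-\frac{p\alpha}{2}|z|^2}dv(z)<\infty$; for $p=\infty$ the norm is $\|f\|_{L^\infty_{\alpha,W}(\mathbb{C}^n;\mathbb{C}^d)}:=\mathrm{ess\,sup}_{z\in\mathbb{C}^n}|W(z)f(z)|e^{-\frac{\alpha}{2}|z|^2}$. When $W$ is identically the identity matrix one writes $L^p_\alpha(\mathbb{C}^n;\mathbb{C}^d)$ (and $L^p_\alpha(\mathbb{C}^n;\mathbb{C})$ for $d=1$). Operators. Let $K^\alpha_z(u)=e^{\alpha\langle u,z\rangle}$, where $\langle\cdot,\cdot\rangle$ is the standard Hermitian inner product (linear in the first variable), and $d\lambda_\alpha(u)=\left(\frac{\alpha}{\pi}\right)^ne^{-\alpha|u|^2}dv(u)$. The Fock projection is $P_\alpha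 f(z)=\int_{\mathbb{C}^n}f(u)\overline{K^\alpha_z(u)}\,d\lambda_\alpha(u)$, and $P^+_{\alpha,W}(f)(z)=\int_{\mathbb{C}^n}|W(z)W^{-1}(u)f(u)|\,|K^\alpha_z(u)|\,d\lambda_\alpha(u)$, $z\in\mathbb{C}^n$. "$P_\alpha$ is bounded on $L^p_{\alpha,W}(\mathbb{C}^n;\mathbb{C}^d)$" means: for every $f$ in this space the integral defining $P_\alpha f(z)$ converges absolutely for almost every $z$, and there is a constant $C$ with $\|P_\alpha f\|\le C\|f\|$ for all such $f$; the least such $C$ is $\|P_\alpha\|$. Similarly, $\|P^+_{\alpha,W}\|$ is the least $C$ with $\|P^+_{\alpha,W}(f)\|_{L^p_\alpha(\mathbb{C}^n;\mathbb{C})}\le C\|f\|_{L^p_\alpha(\mathbb{C}^n;\mathbb{C}^d)}$ for all $f$. $\mathcal{A}_{p,r}$-weights. $p'$ is the conjugate exponent, $\frac1p+\frac1{p'}=1$, with $1'=\infty$, $\infty'=1$. Cubes $Q\subset\mathbb{C}^n\cong\mathbb{R}^{2n}$ have sides parallel to the coordinate axes and side length $l(Q)$. Given a norm-valued function $z\mapsto\rho_z$ (each $\rho_z$ a norm on $\mathbb{C}^d$, defined for almost every $z$, with $z\mapsto\rho_z(\mathbf{x})$ measurable for each $\mathbf{x}\in\mathbb{C}^d$), the dual of a norm $\sigma$ on $\mathbb{C}^d$ is $\sigma^*(\mathbf{x})=\sup_{\mathbf{y}\in\mathbb{C}^d\setminus\{0\}}\frac{|\langle\mathbf{x},\mathbf{y}\rangle|}{\sigma(\mathbf{y})}$,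 and $\rho^*$ is defined pointwise by $\rho^*_z=(\rho_z)^*$. For a cube $Q$ put $\rho_{p,Q}(\mathbf{x})=\left(\frac1{v(Q)}\int_Q\rho_z(\mathbf{x})^pdv(z)\right)^{1/p}$ for $1\le p<\infty$ and $\rho_{\infty,Q}(\mathbf{x})=\mathrm{ess\,sup}_{z\in Q}\rho_z(\mathbf{x})$; $\rho^*_{p',Q}$ is defined in the same way from $\rho^*$ with exponent $p'$. (If $\rho_{p,Q}(\mathbf y)=\infty$, the corresponding quotient in $(\rho_{p,Q})^*$ is $0$.) For $r>0$, $\rho$ is an $\mathcal{A}_{p,r}$-metric if there is $C>0$ with $\rho^*_{p',Q}(\mathbf{x})\le C(\rho_{p,Q})^*(\mathbf{x})$ for all $\mathbf{x}\in\mathbb{C}^d$ and all cubes $Q$ with $l(Q)=r$; the least such $C$ is $[\rho]_{\mathcal{A}_{p,r}}$. The matrix weight $W$ is an $\mathcal{A}_{p,r}$-weight if $\rho_z(\mathbf{x})=|W(z)\mathbf{x}|$ is an $\mathcal{A}_{p,r}$-metric, and $[W]_{\mathcal{A}_{p,r}}:=[\rho]_{\mathcal{A}_{p,r}}$. *)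

theory Defs
  imports
    "HOL-Probability.Essential_Supremum"
    "Jordan_Normal_Form.Gauss_Jordan_Elimination"
begin

text \<open>
  The domain of the functions is the type \<open>complex ^ 'n\<close>, with \<open>n = CARD('n)\<close>.  The values lie in
  \<open>carrier_vec d\<close> and the weights in \<open>carrier_mat d d\<close> with \<open>d :: nat\<close>: the constant in the main
  estimate must not depend on \<open>d\<close>, so \<open>d\<close> has to be quantified inside the formula and
  cannot be a type.
\<close>

unbundle no vec_syntax

text \<open>Used only for exponents \<open>s > 0\<close>.\<close>

definition ennpow :: "ennreal \<Rightarrow> real \<Rightarrow> ennreal" where
  "ennpow x s = (if x = \<infinity> then \<infinity> else ennreal (enn2real x powr s))"

text \<open>\<open>inverse 0 = \<infinity>\<close> and \<open>inverse \<infinity> = 0\<close> on \<open>ennreal\<close>, so \<open>1\<close> and \<open>\<infinity>\<close> are swapped.\<close>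

definition conj_exponent :: "ennreal \<Rightarrow> ennreal" where
  "conj_exponent p = inverse (1 - inverse p)"

lemma conj_exponent:
  assumes "1 \<le> p"
  shows "inverse p + inverse (conj_exponent p) = 1"
proof -
  have "inverse p \<le> 1"
    using assms by (cases p) (auto simp: inverse_ennreal field_simps simp flip: ennreal_1)
  moreover have "inverse (inverse x) = x" for x :: ennreal
    by (cases x; cases "x = 0") (auto simp: inverse_ennreal less_le ennreal_neg)
  ultimately show ?thesis
    by (simp add: conj_exponent_def)
qed


subsection \<open>Matrix weights\<close>

definition vnorm :: "complex Matrix.vec \<Rightarrow> real" where
  "vnorm x = sqrt (Re (x \<bullet>c x))"

text \<open>The value is unspecified if \<open>A\<close> is not invertible; for a matrix weight
  this concerns only a null set.\<close>

definition inv_mat :: "complex Matrix.mat \<Rightarrow> complex Matrix.mat" where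
  "inv_mat A = the (mat_inverse A)"

definition positive_mat :: "nat \<Rightarrow> complex Matrix.mat \<Rightarrow> bool" where
  "positive_mat d A \<longleftrightarrow>
     A \<in> carrier_mat d d \<and> (\<forall>x\<in>carrier_vec d. (A *\<^sub>v x) \<bullet>c x \<in> \<real>\<^sub>\<ge>\<^sub>0)"

definition locally_integrable_mat :: "nat \<Rightarrow> (complex ^ 'n \<Rightarrow> complex Matrix.mat) \<Rightarrow> bool" where
  "locally_integrable_mat d W \<longleftrightarrow>
     (\<forall>i<d. \<forall>j<d. \<forall>S. compact S \<longrightarrow> set_integrable lebesgue S (\<lambda>z. W z $$ (i, j)))"

definition matrix_weight :: "nat \<Rightarrow> (complex ^ 'n \<Rightarrow> complex Matrix.mat) \<Rightarrow> bool" where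
  "matrix_weight d W \<longleftrightarrow>
     (\<forall>z. W z \<in> carrier_mat d d) \<and>
     (AE z in lebesgue. positive_mat d (W z) \<and> invertible_mat (W z)) \<and>
     locally_integrable_mat d W \<and>
     locally_integrable_mat d (\<lambda>z. inv_mat (W z))"


subsection \<open>Weighted spaces\<close>

text \<open>The norm of \<open>L\<^sup>p\<^sub>\<alpha>\<close> for scalar functions with values in \<open>[0, \<infinity>]\<close>; the vector-valued weighted
  norm is obtained from it through \<open>z \<mapsto> |W(z) f(z)|\<close>.\<close>

definition gauss_norm :: "real \<Rightarrow> ennreal \<Rightarrow> (complex ^ 'n \<Rightarrow> ennreal) \<Rightarrow> ennreal" where
  "gauss_norm \<alpha> p g =
     (if p = \<infinity>
      then esssup lebesgue (\<lambda>z. g z * ennreal (exp (- (\<alpha> / 2) * (norm z)\<^sup>2)))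
      else ennpow
             (\<integral>\<^sup>+ z. ennpow (g z) (enn2real p)
                     * ennreal (exp (- (enn2real p * \<alpha> / 2) * (norm z)\<^sup>2)) \<partial>lebesgue)
             (1 / enn2real p))"

definition weighted_norm ::
  "real \<Rightarrow> ennreal \<Rightarrow> (complex ^ 'n \<Rightarrow> complex Matrix.mat) \<Rightarrow> (complex ^ 'n \<Rightarrow> complex Matrix.vec) \<Rightarrow> ennreal"
  where
  "weighted_norm \<alpha> p W f = gauss_norm \<alpha> p (\<lambda>z. ennreal (vnorm (W z *\<^sub>v f z)))"

definition weighted_space ::
  "real \<Rightarrow> ennreal \<Rightarrow> nat \<Rightarrow> (complex ^ 'n \<Rightarrow> complex Matrix.mat) \<Rightarrow> (complex ^ 'n \<Rightarrow> complex Matrix.vec) set"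
  where
  "weighted_space \<alpha> p d W =
     {f. (\<forall>z. f z \<in> carrier_vec d) \<and>
         (\<forall>i<d. (\<lambda>z. f z $ i) \<in> borel_measurable lebesgue) \<and>
         weighted_norm \<alpha> p W f < \<infinity>}"


subsection \<open>The Fock projection and the maximal Fock projection\<close>

definition herm :: "complex ^ 'n \<Rightarrow> complex ^ 'n \<Rightarrow> complex" where
  "herm u z = (\<Sum>i\<in>UNIV. vec_nth u i * cnj (vec_nth z i))"

definition fock_kernel :: "real \<Rightarrow> complex ^ 'n \<Rightarrow> complex ^ 'n \<Rightarrow> complex" where
  "fock_kernel \<alpha> z u = exp (complex_of_real \<alpha> * herm u z)"

definition gauss_measure :: "real \<Rightarrow> (complex ^ 'n) measure" where
  "gauss_measure \<alpha> =
     density lebesgue (\<lambda>u. ennreal ((\<alpha> / pi) ^ CARD('n) * exp (- \<alpha> * (norm u)\<^sup>2)))"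

definition fock_converges ::
  "real \<Rightarrow> nat \<Rightarrow> (complex ^ 'n \<Rightarrow> complex Matrix.vec) \<Rightarrow> complex ^ 'n \<Rightarrow> bool" where
  "fock_converges \<alpha> d f z \<longleftrightarrow>
     (\<forall>i<d. integrable (gauss_measure \<alpha>) (\<lambda>u. f u $ i * cnj (fock_kernel \<alpha> z u)))"

definition fock_proj ::
  "real \<Rightarrow> nat \<Rightarrow> (complex ^ 'n \<Rightarrow> complex Matrix.vec) \<Rightarrow> complex ^ 'n \<Rightarrow> complex Matrix.vec" where
  "fock_proj \<alpha> d f z =
     Matrix.vec d (\<lambda>i. LINT u|gauss_measure \<alpha>. f u $ i * cnj (fock_kernel \<alpha> z u))"

definition max_fock_proj ::
  "real \<Rightarrow> (complex ^ 'n \<Rightarrow> complex Matrix.mat) \<Rightarrow> (complex ^ 'n \<Rightarrow> complex Matrix.vec) \<Rightarrow>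
   complex ^ 'n \<Rightarrow> ennreal" where
  "max_fock_proj \<alpha> W f z =
     (\<integral>\<^sup>+ u. ennreal (vnorm (W z *\<^sub>v (inv_mat (W u) *\<^sub>v f u)) * cmod (fock_kernel \<alpha> z u))
        \<partial>gauss_measure \<alpha>)"

definition fock_proj_bound ::
  "real \<Rightarrow> ennreal \<Rightarrow> nat \<Rightarrow> (complex ^ 'n \<Rightarrow> complex Matrix.mat) \<Rightarrow> real \<Rightarrow> bool" where
  "fock_proj_bound \<alpha> p d W C \<longleftrightarrow>
     0 \<le> C \<and>
     (\<forall>f\<in>weighted_space \<alpha> p d W.
        (AE z in lebesgue. fock_converges \<alpha> d f z) \<and>
        weighted_norm \<alpha> p W (fock_proj \<alpha> d f) \<le> ennreal C * weighted_norm \<alpha> p W f)"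

definition fock_proj_bounded ::
  "real \<Rightarrow> ennreal \<Rightarrow> nat \<Rightarrow> (complex ^ 'n \<Rightarrow> complex Matrix.mat) \<Rightarrow> bool" where
  "fock_proj_bounded \<alpha> p d W \<longleftrightarrow> (\<exists>C. fock_proj_bound \<alpha> p d W C)"

definition fock_proj_norm ::
  "real \<Rightarrow> ennreal \<Rightarrow> nat \<Rightarrow> (complex ^ 'n \<Rightarrow> complex Matrix.mat) \<Rightarrow> real" where
  "fock_proj_norm \<alpha> p d W = Inf {C. fock_proj_bound \<alpha> p d W C}"

definition max_fock_proj_bound ::
  "real \<Rightarrow> ennreal \<Rightarrow> nat \<Rightarrow> (complex ^ 'n \<Rightarrow> complex Matrix.mat) \<Rightarrow> real \<Rightarrow> bool" where
  "max_fock_proj_bound \<alpha> p d W C \<longleftrightarrow>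
     0 \<le> C \<and>
     (\<forall>f\<in>weighted_space \<alpha> p d (\<lambda>_. 1\<^sub>m d).
        gauss_norm \<alpha> p (max_fock_proj \<alpha> W f) \<le> ennreal C * weighted_norm \<alpha> p (\<lambda>_. 1\<^sub>m d) f)"

definition max_fock_proj_bounded ::
  "real \<Rightarrow> ennreal \<Rightarrow> nat \<Rightarrow> (complex ^ 'n \<Rightarrow> complex Matrix.mat) \<Rightarrow> bool" where
  "max_fock_proj_bounded \<alpha> p d W \<longleftrightarrow> (\<exists>C. max_fock_proj_bound \<alpha> p d W C)"

definition max_fock_proj_norm ::
  "real \<Rightarrow> ennreal \<Rightarrow> nat \<Rightarrow> (complex ^ 'n \<Rightarrow> complex Matrix.mat) \<Rightarrow> real" where
  "max_fock_proj_norm \<alpha> p d W = Inf {C. max_fock_proj_bound \<alpha> p d W C}"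


subsection \<open>The class \<open>\<A>\<^sub>p\<^sub>,\<^sub>r\<close>\<close>

text \<open>Norms on \<open>carrier_vec d\<close> take values in \<open>ennreal\<close>, because an average may be infinite.
  Since \<open>a / \<infinity> = 0\<close> on \<open>ennreal\<close>, such directions contribute \<open>0\<close> to the dual.\<close>

definition dual_norm ::
  "nat \<Rightarrow> (complex Matrix.vec \<Rightarrow> ennreal) \<Rightarrow> complex Matrix.vec \<Rightarrow> ennreal" where
  "dual_norm d \<sigma> x = (SUP y\<in>carrier_vec d - {0\<^sub>v d}. ennreal (cmod (x \<bullet>c y)) / \<sigma> y)"

text \<open>\<open>complex ^ 'n\<close> is here regarded as \<open>\<real>\<^sup>2\<^sup>n\<close>: its \<open>Basis\<close> consists of the
  vectors \<open>axis i 1\<close> and \<open>axis i \<i>\<close>.\<close>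

definition cubes :: "real \<Rightarrow> (complex ^ 'n) set set" where
  "cubes r = {Q. \<exists>a. Q = cbox a (a + r *\<^sub>R (\<Sum>b\<in>Basis. b))}"

definition avg_norm ::
  "ennreal \<Rightarrow> (complex ^ 'n) set \<Rightarrow> (complex ^ 'n \<Rightarrow> complex Matrix.vec \<Rightarrow> ennreal) \<Rightarrow>
   complex Matrix.vec \<Rightarrow> ennreal" where
  "avg_norm p Q \<rho> x =
     (if p = \<infinity>
      then esssup (restrict_space lebesgue Q) (\<lambda>z. \<rho> z x)
      else ennpow ((\<integral>\<^sup>+ z\<in>Q. ennpow (\<rho> z x) (enn2real p) \<partial>lebesgue) / emeasure lebesgue Q)
             (1 / enn2real p))"

definition A_metric_bound ::
  "ennreal \<Rightarrow> real \<Rightarrow> nat \<Rightarrow> (complex ^ 'n \<Rightarrow> complex Matrix.vec \<Rightarrow> ennreal) \<Rightarrow> real \<Rightarrow> bool" where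
  "A_metric_bound p r d \<rho> C \<longleftrightarrow>
     0 < C \<and>
     (\<forall>x\<in>carrier_vec d. \<forall>Q\<in>cubes r.
        avg_norm (conj_exponent p) Q (\<lambda>z. dual_norm d (\<rho> z)) x
          \<le> ennreal C * dual_norm d (avg_norm p Q \<rho>) x)"

definition A_metric ::
  "ennreal \<Rightarrow> real \<Rightarrow> nat \<Rightarrow> (complex ^ 'n \<Rightarrow> complex Matrix.vec \<Rightarrow> ennreal) \<Rightarrow> bool" where
  "A_metric p r d \<rho> \<longleftrightarrow> (\<exists>C. A_metric_bound p r d \<rho> C)"

definition A_metric_const ::
  "ennreal \<Rightarrow> real \<Rightarrow> nat \<Rightarrow> (complex ^ 'n \<Rightarrow> complex Matrix.vec \<Rightarrow> ennreal) \<Rightarrow> real" where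
  "A_metric_const p r d \<rho> = Inf {C. A_metric_bound p r d \<rho> C}"

definition A_weight ::
  "ennreal \<Rightarrow> real \<Rightarrow> nat \<Rightarrow> (complex ^ 'n \<Rightarrow> complex Matrix.mat) \<Rightarrow> bool" where
  "A_weight p r d W \<longleftrightarrow> A_metric p r d (\<lambda>z x. ennreal (vnorm (W z *\<^sub>v x)))"

definition A_weight_const ::
  "ennreal \<Rightarrow> real \<Rightarrow> nat \<Rightarrow> (complex ^ 'n \<Rightarrow> complex Matrix.mat) \<Rightarrow> real" where
  "A_weight_const p r d W = A_metric_const p r d (\<lambda>z x. ennreal (vnorm (W z *\<^sub>v x)))"

end

theory Submission
  imports
    Defs
    "HOL-Probability.Distributions"
    "Jordan_Normal_Form.Determinant"
begin

text \<open>The equivalence is proved along the cycle (b) \<open>\<Longrightarrow>\<close> (a) \<open>\<Longrightarrow>\<close> (c) \<open>\<Longrightarrow>\<close> (d) \<open>\<Longrightarrow>\<close> (b), with explicit constants.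
Throughout \<open>n = CARD('n)\<close>, and \<open>[W]\<close> is the \<open>\<A>\<^sub>p\<^sub>,\<^sub>r\<close> constant of \<open>W\<close>.

(b) \<open>\<Longrightarrow>\<close> (a), lemma \<open>fock_proj_bound_of_max_fock_proj_bound\<close>. For \<open>f\<close> in the weighted space, \<open>W f\<close> lies in
the unweighted one, and pulling the norm inside the integral gives
\<open>\<bar>W P f\<bar> \<le> P\<^sup>+(W f)\<close> pointwise almost everywhere. Hence \<open>\<parallel>P\<parallel> \<le> \<parallel>P\<^sup>+\<parallel>\<close>.

(a) \<open>\<Longrightarrow>\<close> (c), lemmas \<open>fock_proj_dominates_averaging\<close> and \<open>A_metric_bound_of_fock_proj_bound\<close>. Let
\<open>c\<close> be the centre of a cube \<open>Q\<close> of side \<open>r\<close>. The integral of \<open>f\<close> over \<open>Q\<close> has the constant kernel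
\<open>1 = exp (\<alpha> \<langle>z - c, u - c\<rangle>) \<cdot> exp (- \<alpha> \<langle>z - c, u - c\<rangle>)\<close>. The first factor is the Fock kernel up to a
function of \<open>z\<close> times a function of \<open>u\<close>. The second one is expanded in its power series, whose terms
are products of a monomial in \<open>z - c\<close> and a conjugate monomial in \<open>u - c\<close>. So averaging over \<open>Q\<close>
is an infinite combination of operators \<open>M P M'\<close> with bounded scalar multipliers \<open>M\<close> and \<open>M'\<close>. Since
\<open>\<bar>z\<^sub>j - c\<^sub>j\<bar>\<^sup>2 \<le> r\<^sup>2 / 2\<close> on \<open>Q\<close>, the coefficients and the bounds of the multipliers add up to exactly
\<open>(\<pi> / \<alpha>)\<^sup>n exp (n \<alpha> r\<^sup>2)\<close>. The norms of the averaging operators control \<open>[W]\<close> by \<open>L\<^sup>p\<close> duality, so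
\<open>(\<alpha> r\<^sup>2 / \<pi>)\<^sup>n exp (- n \<alpha> r\<^sup>2) [W] \<le> \<parallel>P\<parallel>\<close>. As \<open>[W] \<ge> 1\<close>, this implies the bound with the square root.

(d) \<open>\<Longrightarrow>\<close> (b), lemma \<open>max_fock_proj_bound_of_A_metric_bound\<close>. Let \<open>\<sigma>\<^sub>Q\<close> be the \<open>L\<^sup>p'\<close> average over \<open>Q\<close> of
the dual norms and \<open>\<tau>\<^sub>Q\<close> the dual of the \<open>L\<^sup>p\<close> average. Always \<open>\<tau>\<^sub>Q \<le> \<sigma>\<^sub>Q\<close>, and the \<open>\<A>\<^sub>p\<^sub>,\<^sub>r\<close> condition says
\<open>\<sigma>\<^sub>Q \<le> [W] \<tau>\<^sub>Q\<close>. By Hoelder's inequality on the overlap, \<open>\<sigma>\<^sub>Q \<le> 4\<^sup>n [W] \<sigma>\<^sub>Q'\<close> if the centres are at distance at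
most \<open>r / 2\<close>; a chain of such cubes compares \<open>\<sigma>\<close> on cubes at distance \<open>t\<close> with a factor
\<open>(4\<^sup>n [W])\<close> to the power \<open>2 t / r + 1\<close>. No power of \<open>d\<close> enters here, because norms and not matrices are
compared. On each cube there is a basis \<open>e\<^sub>i\<close> with dual basis \<open>e\<^sub>i\<^sup>*\<close> for which the \<open>L\<^sup>p\<close> average of
\<open>\<bar>W e\<^sub>i\<bar>\<close> is at most \<open>1\<close> and \<open>\<tau>\<^sub>Q (e\<^sub>i\<^sup>*) \<le> 2\<close> (lemmas \<open>near_Auerbach_basis\<close> and
\<open>A_weight_adapted_basis\<close>), and
\<open>\<bar>W(z) W\<^sup>-\<^sup>1(u) v\<bar> \<le> \<Sum>\<^sub>i \<bar>W(z) e\<^sub>i\<bar> \<bar>W\<^sup>-\<^sup>1(u) e\<^sub>i\<^sup>*\<bar> \<bar>v\<bar>\<close>. So the part of \<open>P\<^sup>+\<close> that maps from one cube of a grid to another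
one is bounded by \<open>d\<close> times the chain factor times the Gaussian decay of the kernel. The Gaussian wins,
and completing the square in an exponent of the form \<open>a t log [W] - b t\<^sup>2\<close> produces \<open>[W]\<close> to a power \<open>c (1 + log [W])\<close>.
The dimension enters only through the first power of \<open>d\<close>, which is below the exponents \<open>7/2\<close> and
\<open>9/2\<close>.\<close>

text \<open>\<open>top\<close> is the greatest element of an order, and \<open>$\<close> is the index operation of \<open>Matrix.vec\<close>.\<close>

hide_const (open) Order.top
unbundle no vec_syntax

section \<open>The norm of \<open>L\<^sup>p\<close> for functions with values in \<open>[0, \<infinity>]\<close>\<close>

lemma ennpow_ennreal: "0 \<le> x \<Longrightarrow> ennpow (ennreal x) s = ennreal (x powr s)"
  by (simp add: ennpow_def)

lemma ennpow_top [simp]: "ennpow top s = top"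
  by (simp add: ennpow_def)

lemma ennpow_0 [simp]: "ennpow 0 s = 0"
  by (simp add: ennpow_def)

lemma ennpow_1 [simp]: "ennpow 1 s = 1"
  by (simp add: ennpow_def)

lemma ennpow_exponent_1 [simp]: "ennpow x 1 = x"
  by (cases x) (simp_all add: ennpow_ennreal)

lemma ennpow_mono: "x \<le> y \<Longrightarrow> 0 \<le> s \<Longrightarrow> ennpow x s \<le> ennpow y s"
  by (cases x; cases y) (auto simp: ennpow_ennreal powr_mono2 top_unique)

lemma ennpow_mult: "ennpow (x * y) s = ennpow x s * ennpow y s"
proof -
  consider a b where "x = ennreal a" "y = ennreal b" "0 \<le> a" "0 \<le> b" | "x = top" | "y = top"
    by (cases x; cases y) auto
  then show ?thesis
  proof cases
    case 1
    then show ?thesis by (simp add: ennpow_ennreal powr_mult flip: ennreal_mult)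
  next
    case 2
    then show ?thesis
      by (cases y; cases "y = 0") (auto simp: ennpow_ennreal ennreal_top_mult)
  next
    case 3
    then show ?thesis
      by (cases x; cases "x = 0") (auto simp: ennpow_ennreal ennreal_mult_top)
  qed
qed

lemma ennpow_ennpow: "ennpow (ennpow x s) t = ennpow x (s * t)"
  by (cases x) (auto simp: ennpow_ennreal powr_powr)

lemma ennpow_add: "0 \<le> s \<Longrightarrow> 0 \<le> t \<Longrightarrow> x \<noteq> top \<Longrightarrow> ennpow x (s + t) = ennpow x s * ennpow x t"
  by (cases x) (auto simp: ennpow_ennreal powr_add ennreal_mult)

lemma ennpow_eq_0_iff [simp]: "ennpow x s = 0 \<longleftrightarrow> x = 0"
  by (cases x) (auto simp: ennpow_ennreal ennreal_eq_0_iff powr_def)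

lemma ennpow_eq_top_iff [simp]: "ennpow x s = top \<longleftrightarrow> x = top"
  by (auto simp: ennpow_def)

lemma measurable_ennpow [measurable]:
  assumes [measurable]: "f \<in> borel_measurable M"
  shows "(\<lambda>x. ennpow (f x) s) \<in> borel_measurable M"
  unfolding ennpow_def by measurable

lemma ennpow_indicator: "ennpow (indicator A x) s = indicator A x"
  by (simp add: indicator_def)

text \<open>Every norm of the theorem becomes an instance: the Gaussian weight and the indicator of a
cube are absorbed into \<open>g\<close>. Thus all cases \<open>1 \<le> p \<le> \<infinity>\<close> can be treated at once with Hoelder's
inequality and the domination lemma for weighted sums.\<close>

definition Lp_norm :: "ennreal \<Rightarrow> 'a measure \<Rightarrow> ('a \<Rightarrow> ennreal) \<Rightarrow> ennreal" where
  "Lp_norm p M g =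
     (if p = \<infinity> then esssup M g
      else ennpow (\<integral>\<^sup>+ x. ennpow (g x) (enn2real p) \<partial>M) (1 / enn2real p))"

lemma Lp_norm_top: "Lp_norm top M g = esssup M g"
  by (simp add: Lp_norm_def)

lemma Lp_norm_real:
  "0 \<le> q \<Longrightarrow> Lp_norm (ennreal q) M g = ennpow (\<integral>\<^sup>+ x. ennpow (g x) q \<partial>M) (1 / q)"
  by (simp add: Lp_norm_def)

lemma Lp_norm_1: "Lp_norm 1 M g = (\<integral>\<^sup>+ x. g x \<partial>M)"
  using Lp_norm_real[of 1 M g] by simp

lemma exponent_cases:
  assumes "1 \<le> (p::ennreal)"
  obtains (one) "p = 1" "conj_exponent p = top"
    | (mid) q where "p = ennreal q" "1 < q" "conj_exponent p = ennreal (q / (q - 1))"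
    | (top) "p = top" "conj_exponent p = 1"
proof (cases p)
  case top
  then have "conj_exponent p = 1" by (simp add: conj_exponent_def)
  with top that(3) show ?thesis by simp
next
  case (real q)
  with assms have q: "1 \<le> q" by (simp flip: ennreal_1)
  show ?thesis
  proof (cases "q = 1")
    case True
    with real have "p = 1" by simp
    moreover from this have "conj_exponent p = top" by (simp add: conj_exponent_def)
    ultimately show ?thesis using that(1) by simp
  next
    case False
    with q have q1: "1 < q" by simp
    have "inverse p = ennreal (1 / q)"
      using real q1 by (simp add: inverse_ennreal inverse_eq_divide)
    then have "1 - inverse p = ennreal (1 - 1 / q)"
      using q1 by (simp add: ennreal_minus flip: ennreal_1)
    then have "conj_exponent p = inverse (ennreal ((q - 1) / q))"
      using q1 by (simp add: conj_exponent_def field_simps)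
    also have "\<dots> = ennreal (q / (q - 1))"
      using q1 by (subst inverse_ennreal) auto
    finally show ?thesis using that(2)[of q] real q1 by simp
  qed
qed

lemma conj_exponent_ge_1:
  assumes "1 \<le> p" shows "1 \<le> conj_exponent p"
  using assms by (cases rule: exponent_cases) (auto simp flip: ennreal_1)

text \<open>The number \<open>1 / p\<close>, which is \<open>0\<close> for \<open>p = \<infinity>\<close>.\<close>

definition exponent_inv :: "ennreal \<Rightarrow> real" where
  "exponent_inv p = enn2real (inverse p)"

lemma exponent_inv_conj:
  assumes "1 \<le> p" shows "exponent_inv p + exponent_inv (conj_exponent p) = 1"
  using assms
proof (cases rule: exponent_cases)
  case (mid q)
  then show ?thesis by (simp add: exponent_inv_def inverse_ennreal field_simps)
qed (simp_all add: exponent_inv_def)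

lemma Lp_norm_mono_AE:
  assumes "f \<in> borel_measurable M" "AE x in M. f x \<le> g x"
  shows "Lp_norm p M f \<le> Lp_norm p M g"
proof (cases "p = \<infinity>")
  case True
  then show ?thesis using esssup_AE_mono[OF assms] by (simp add: Lp_norm_def)
next
  case False
  have "AE x in M. ennpow (f x) (enn2real p) \<le> ennpow (g x) (enn2real p)"
    using assms(2) by eventually_elim (rule ennpow_mono, auto)
  then show ?thesis using False
    by (auto simp: Lp_norm_def intro!: ennpow_mono nn_integral_mono_AE)
qed

lemma Lp_norm_mono:
  assumes "f \<in> borel_measurable M" "\<And>x. f x \<le> g x"
  shows "Lp_norm p M f \<le> Lp_norm p M g"
  using assms by (intro Lp_norm_mono_AE) auto

lemma Lp_norm_cong_AE:
  assumes "f \<in> borel_measurable M" "g \<in> borel_measurable M" "AE x in M. f x = g x"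
  shows "Lp_norm p M f = Lp_norm p M g"
  by (rule antisym; rule Lp_norm_mono_AE) (use assms in auto)

lemma Lp_norm_cmult_le:
  assumes p: "1 \<le> p" and f[measurable]: "f \<in> borel_measurable M"
  shows "Lp_norm p M (\<lambda>x. c * f x) \<le> c * Lp_norm p M f"
proof (cases p)
  case top
  have "AE x in M. c * f x \<le> c * esssup M f"
    using esssup_AE[of f M] by eventually_elim (rule mult_left_mono, auto)
  then show ?thesis unfolding top Lp_norm_top by (intro esssup_I) auto
next
  case (real q)
  with p have q: "1 \<le> q" by (simp flip: ennreal_1)
  have "Lp_norm p M (\<lambda>x. c * f x) = ennpow (ennpow c q * (\<integral>\<^sup>+ x. ennpow (f x) q \<partial>M)) (1 / q)"
    using q real by (simp add: Lp_norm_real ennpow_mult nn_integral_cmult)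
  also have "\<dots> = c * Lp_norm p M f"
    using q real by (simp add: Lp_norm_real ennpow_mult ennpow_ennpow)
  finally show ?thesis by simp
qed

lemma Lp_norm_cmult:
  assumes p: "1 \<le> p" and f[measurable]: "f \<in> borel_measurable M" and c: "0 < c"
  shows "Lp_norm p M (\<lambda>x. ennreal c * f x) = ennreal c * Lp_norm p M f"
proof (rule antisym)
  have "Lp_norm p M f = Lp_norm p M (\<lambda>x. ennreal (1 / c) * (ennreal c * f x))"
    using c by (simp add: mult.assoc[symmetric] ennreal_mult[symmetric])
  also have "\<dots> \<le> ennreal (1 / c) * Lp_norm p M (\<lambda>x. ennreal c * f x)"
    by (rule Lp_norm_cmult_le[OF p]) simp
  finally have "ennreal c * Lp_norm p M f
      \<le> ennreal c * (ennreal (1 / c) * Lp_norm p M (\<lambda>x. ennreal c * f x))"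
    by (rule mult_left_mono) simp
  then show "ennreal c * Lp_norm p M f \<le> Lp_norm p M (\<lambda>x. ennreal c * f x)"
    using c by (simp add: mult.assoc[symmetric] ennreal_mult[symmetric])
qed (rule Lp_norm_cmult_le[OF p f])

text \<open>With \<open>a\<close> and \<open>b\<close> the norms of two functions, the right-hand side integrates to
\<open>a b (1/q + 1/q') = a b\<close>: this is Young's inequality in the normalisation that yields Hoelder's.\<close>

lemma Young_ennpow:
  fixes f g :: ennreal
  assumes q: "1 < q" and ab: "0 < a" "0 < b"
  shows "f * g \<le> ennreal (a * b * (a powr (-q) / q)) * ennpow f q
       + ennreal (a * b * (b powr (- (q / (q - 1))) / (q / (q - 1)))) * ennpow g (q / (q - 1))"
proof -
  let ?r = "q / (q - 1)"
  have r: "1 < ?r" using q by (simp add: field_simps)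
  consider x y where "f = ennreal x" "g = ennreal y" "0 \<le> x" "0 \<le> y" | "f = top" | "g = top"
    by (cases f; cases g) auto
  then show ?thesis
  proof cases
    case 1
    have "(x / a) * (y / b) \<le> (x / a) powr q / q + (y / b) powr ?r / ?r"
      by (rule Youngs_inequality) (use q r ab 1 in \<open>auto simp: field_simps\<close>)
    then have "a * b * ((x / a) * (y / b)) \<le> a * b * ((x / a) powr q / q + (y / b) powr ?r / ?r)"
      using ab by (intro mult_left_mono) auto
    moreover have "a * b * ((x / a) * (y / b)) = x * y" using ab by simp
    moreover have "(x / a) powr q = x powr q * a powr (-q)" "(y / b) powr ?r = y powr ?r * b powr (- ?r)"
      using ab 1 by (simp_all add: powr_divide powr_minus_divide)
    ultimately have "x * y \<le> a * b * (a powr (-q) / q) * x powr q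
        + a * b * (b powr (- ?r) / ?r) * y powr ?r"
      by (simp only: distrib_left) (simp add: mult_ac)
    then show ?thesis using 1 ab q r
      by (simp add: ennpow_ennreal ennreal_mult[symmetric] ennreal_plus[symmetric] ennreal_leI del: ennreal_plus)
  next
    case 2
    then have "ennreal (a * b * (a powr (-q) / q)) * ennpow f q = top"
      using ab q by (auto simp: ennreal_mult_top)
    then show ?thesis by simp
  next
    case 3
    have "0 < a * b * (b powr (- ?r) / ?r)" using ab q by simp
    then have "ennreal (a * b * (b powr (- ?r) / ?r)) \<noteq> 0"
      by (metis ennreal_eq_0_iff not_less)
    then have "ennreal (a * b * (b powr (- ?r) / ?r)) * ennpow g ?r = top"
      using 3 by (simp only: ennreal_mult_top ennpow_top if_False)
    then show ?thesis by simp
  qed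
qed

lemma Hoelder_1_top:
  assumes [measurable]: "f \<in> borel_measurable M"
  shows "(\<integral>\<^sup>+ x. f x * g x \<partial>M) \<le> (\<integral>\<^sup>+ x. f x \<partial>M) * esssup M g"
proof -
  have "(\<integral>\<^sup>+ x. f x * g x \<partial>M) \<le> (\<integral>\<^sup>+ x. f x * esssup M g \<partial>M)"
    using esssup_AE[of g M] by (intro nn_integral_mono_AE, eventually_elim) (rule mult_left_mono, auto)
  then show ?thesis by (simp add: nn_integral_multc)
qed

lemma Hoelder_inequality:
  assumes p: "1 \<le> p" and [measurable]: "f \<in> borel_measurable M" "g \<in> borel_measurable M"
  shows "(\<integral>\<^sup>+ x. f x * g x \<partial>M) \<le> Lp_norm p M f * Lp_norm (conj_exponent p) M g"
  using p
proof (cases rule: exponent_cases)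
  case one
  then show ?thesis using Hoelder_1_top[of f M g] by (simp add: Lp_norm_1 Lp_norm_top)
next
  case top
  then show ?thesis using Hoelder_1_top[of g M f] by (simp add: Lp_norm_1 Lp_norm_top mult.commute)
next
  case (mid q)
  define r where "r = q / (q - 1)"
  have q: "1 < q" "0 < q" and r: "0 < r" using mid by (auto simp: r_def)
  define F where "F = (\<integral>\<^sup>+ x. ennpow (f x) q \<partial>M)"
  define G where "G = (\<integral>\<^sup>+ x. ennpow (g x) r \<partial>M)"
  have rhs: "Lp_norm p M f * Lp_norm (conj_exponent p) M g = ennpow F (1 / q) * ennpow G (1 / r)"
    using mid q r by (simp add: Lp_norm_real F_def G_def flip: r_def)
  consider "F = 0" | "G = 0" | "F \<noteq> 0" "G \<noteq> 0" "F = top \<or> G = top"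
    | u v where "F = ennreal u" "G = ennreal v" "0 < u" "0 < v"
    by (cases F; cases G) (auto simp: less_le)
  then show ?thesis
  proof cases
    case 1
    then have "AE x in M. f x = 0" by (simp add: F_def nn_integral_0_iff_AE)
    then have "AE x in M. f x * g x = 0" by eventually_elim simp
    then have "(\<integral>\<^sup>+ x. f x * g x \<partial>M) = 0" by (simp add: nn_integral_0_iff_AE)
    then show ?thesis by simp
  next
    case 2
    then have "AE x in M. g x = 0" by (simp add: G_def nn_integral_0_iff_AE)
    then have "AE x in M. f x * g x = 0" by eventually_elim simp
    then have "(\<integral>\<^sup>+ x. f x * g x \<partial>M) = 0" by (simp add: nn_integral_0_iff_AE)
    then show ?thesis by simp
  next
    case 3
    then have "ennpow F (1 / q) * ennpow G (1 / r) = top"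
      by (auto simp: ennreal_top_mult ennreal_mult_top)
    then show ?thesis by (simp add: rhs)
  next
    case 4
    define a where "a = u powr (1 / q)"
    define b where "b = v powr (1 / r)"
    have ab: "0 < a" "0 < b" using 4 by (auto simp: a_def b_def)
    have "(\<integral>\<^sup>+ x. f x * g x \<partial>M) \<le> (\<integral>\<^sup>+ x. ennreal (a * b * (a powr (-q) / q)) * ennpow (f x) q
       + ennreal (a * b * (b powr (-r) / r)) * ennpow (g x) r \<partial>M)"
      unfolding r_def by (intro nn_integral_mono Young_ennpow q ab)
    also have "\<dots> = ennreal (a * b * (a powr (-q) / q)) * F + ennreal (a * b * (b powr (-r) / r)) * G"
      by (simp add: nn_integral_add nn_integral_cmult F_def G_def)
    also have "\<dots> = ennreal (a * b * (a powr (-q) / q) * u + a * b * (b powr (-r) / r) * v)"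
      using 4 ab q r by (simp add: ennreal_mult[symmetric])
    also have "a powr (-q) = 1 / u" using 4 q by (simp add: a_def powr_powr powr_minus_divide)
    also have "b powr (-r) = 1 / v" using 4 r by (simp add: b_def powr_powr powr_minus_divide)
    also have "a * b * (1 / u / q) * u + a * b * (1 / v / r) * v = a * b * (1 / q + 1 / r)"
      using 4 by (simp add: field_simps)
    also have "1 / q + 1 / r = 1" using q by (simp add: r_def field_simps)
    also have "ennreal (a * b * 1) = ennpow F (1 / q) * ennpow G (1 / r)"
      using 4 ab by (simp add: ennpow_ennreal a_def b_def ennreal_mult)
    finally show ?thesis by (simp add: rhs)
  qed
qed

lemma borel_measurable_nn_integral_count_space:
  fixes f :: "'j \<Rightarrow> 'a \<Rightarrow> ennreal"
  assumes J: "countable J" and f: "\<And>j. j \<in> J \<Longrightarrow> f j \<in> borel_measurable M"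
  shows "(\<lambda>x. \<integral>\<^sup>+ j. f j x \<partial>count_space J) \<in> borel_measurable M"
proof (cases "finite J")
  case True
  then show ?thesis using f by (simp add: nn_integral_count_space_finite)
next
  case False
  then have "J \<noteq> {}" by auto
  then show ?thesis using False from_nat_into[of J] J f
    by (auto simp: nn_integral_count_space_nat
       nn_integral_bij_count_space[symmetric, OF bij_betw_from_nat_into[OF J]]
       intro!: borel_measurable_suminf_order)
qed

text \<open>A form of Minkowski's inequality for functions that share one bound \<open>B\<close>. By Jensen's inequality
for the weights \<open>h\<close> (Hoelder against the constant \<open>1\<close>) the \<open>p\<close>-th power of the sum is at most
\<open>(\<Sum>h)\<^sup>p\<^sup>-\<^sup>1\<close> times the weighted sum of the \<open>p\<close>-th powers, and the latter is integrated termwise.\<close>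

lemma Lp_norm_weighted_sum_le:
  fixes h :: "'j \<Rightarrow> ennreal" and \<Psi> :: "'j \<Rightarrow> 'a \<Rightarrow> ennreal"
  assumes p: "1 \<le> p" and J: "countable J"
    and \<Psi>[measurable]: "\<And>j. j \<in> J \<Longrightarrow> \<Psi> j \<in> borel_measurable M"
    and B: "\<And>j. j \<in> J \<Longrightarrow> Lp_norm p M (\<Psi> j) \<le> B"
    and H: "(\<integral>\<^sup>+ j. h j \<partial>count_space J) < top"
  shows "Lp_norm p M (\<lambda>x. \<integral>\<^sup>+ j. h j * \<Psi> j x \<partial>count_space J) \<le> (\<integral>\<^sup>+ j. h j \<partial>count_space J) * B"
proof -
  let ?N = "count_space J"
  define D where "D = density ?N h"
  define H where "H = (\<integral>\<^sup>+ j. h j \<partial>?N)"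
  have Htop: "H < top" using H by (simp add: H_def)
  have D: "(\<integral>\<^sup>+ j. f j \<partial>D) = (\<integral>\<^sup>+ j. h j * f j \<partial>?N)" for f :: "'j \<Rightarrow> ennreal"
    unfolding D_def by (subst nn_integral_density) auto
  have mS: "(\<lambda>x. \<integral>\<^sup>+ j. h j * \<Psi> j x \<partial>?N) \<in> borel_measurable M"
    by (rule borel_measurable_nn_integral_count_space[OF J]) measurable
  have AEB: "AE x in M. \<forall>j\<in>J. \<Psi> j x \<le> B" if "p = top"
  proof (subst AE_ball_countable[OF J], intro ballI)
    fix j assume "j \<in> J"
    with B[OF this] that have "esssup M (\<Psi> j) \<le> B" by (simp add: Lp_norm_top)
    then show "AE x in M. \<Psi> j x \<le> B"
      using esssup_AE[of "\<Psi> j" M] by (auto elim: eventually_mono)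
  qed
  show ?thesis
  proof (cases p)
    case top
    have "AE x in M. (\<integral>\<^sup>+ j. h j * \<Psi> j x \<partial>?N) \<le> H * B"
      using AEB[OF top]
    proof eventually_elim
      case (elim x)
      have "(\<integral>\<^sup>+ j. h j * \<Psi> j x \<partial>?N) \<le> (\<integral>\<^sup>+ j. h j * B \<partial>?N)"
        using elim by (intro nn_integral_mono mult_left_mono) auto
      then show ?case by (simp add: nn_integral_multc H_def)
    qed
    then show ?thesis
      using mS by (simp add: top Lp_norm_top H_def esssup_I)
  next
    case (real q)
    with p have q: "1 \<le> q" "0 < q" by (auto simp flip: ennreal_1)
    have *: "ennpow (\<integral>\<^sup>+ j. h j * \<Psi> j x \<partial>?N) q \<le> ennpow H (q - 1) * (\<integral>\<^sup>+ j. h j * ennpow (\<Psi> j x) q \<partial>?N)" for x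
    proof (cases "q = 1")
      case True
      show ?thesis
      proof (cases "H = 0")
        case H0: True
        then have "\<forall>j\<in>J. h j = 0" by (simp add: H_def nn_integral_0_iff_AE AE_count_space)
        then have "(\<integral>\<^sup>+ j. h j * \<Psi> j x \<partial>?N) = 0"
          by (simp add: nn_integral_0_iff_AE AE_count_space)
        then show ?thesis by simp
      next
        case False
        obtain H' where "H = ennreal H'" "0 \<le> H'" using Htop by (cases H) auto
        with False have "ennpow H 0 = 1" by (auto simp: ennpow_ennreal)
        with True show ?thesis by simp
      qed
    next
      case False
      with q have q1: "1 < q" by simp
      have ce: "conj_exponent p = ennreal (q / (q - 1))"
        using p by (cases rule: exponent_cases) (use q1 real in auto)
      have "(\<integral>\<^sup>+ j. \<Psi> j x * 1 \<partial>D) \<le> Lp_norm p D (\<lambda>j. \<Psi> j x) * Lp_norm (conj_exponent p) D (\<lambda>_. 1)"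
        by (rule Hoelder_inequality[OF p]) (auto simp: D_def)
      also have "Lp_norm (conj_exponent p) D (\<lambda>_. 1) = ennpow H ((q - 1) / q)"
        using q1 by (subst ce, subst Lp_norm_real) (simp_all add: D H_def del: nn_integral_const)
      also have "Lp_norm p D (\<lambda>j. \<Psi> j x) = ennpow (\<integral>\<^sup>+ j. h j * ennpow (\<Psi> j x) q \<partial>?N) (1 / q)"
        using q1 by (subst real, subst Lp_norm_real) (simp_all add: D)
      finally have "ennpow (\<integral>\<^sup>+ j. h j * \<Psi> j x \<partial>?N) q \<le>
          ennpow (ennpow (\<integral>\<^sup>+ j. h j * ennpow (\<Psi> j x) q \<partial>?N) (1 / q) * ennpow H ((q - 1) / q)) q"
        using q by (intro ennpow_mono) (simp_all add: D)
      also have "\<dots> = ennpow H (q - 1) * (\<integral>\<^sup>+ j. h j * ennpow (\<Psi> j x) q \<partial>?N)"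
        using q by (simp add: ennpow_mult ennpow_ennpow mult.commute)
      finally show ?thesis .
    qed
    have Bq: "(\<integral>\<^sup>+ x. ennpow (\<Psi> j x) q \<partial>M) \<le> ennpow B q" if "j \<in> J" for j
    proof -
      have "ennpow (\<integral>\<^sup>+ x. ennpow (\<Psi> j x) q \<partial>M) (1 / q) \<le> B"
        using B[OF that] q by (simp add: real Lp_norm_real)
      then have "ennpow (ennpow (\<integral>\<^sup>+ x. ennpow (\<Psi> j x) q \<partial>M) (1 / q)) q \<le> ennpow B q"
        using q by (intro ennpow_mono) auto
      then show ?thesis using q by (simp add: ennpow_ennpow)
    qed
    have mint: "(\<lambda>x. \<integral>\<^sup>+ j. h j * ennpow (\<Psi> j x) q \<partial>?N) \<in> borel_measurable M"
      by (rule borel_measurable_nn_integral_count_space[OF J]) measurable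
    have "(\<integral>\<^sup>+ x. ennpow (\<integral>\<^sup>+ j. h j * \<Psi> j x \<partial>?N) q \<partial>M)
        \<le> (\<integral>\<^sup>+ x. ennpow H (q - 1) * (\<integral>\<^sup>+ j. h j * ennpow (\<Psi> j x) q \<partial>?N) \<partial>M)"
      by (intro nn_integral_mono *)
    also have "\<dots> = ennpow H (q - 1) * (\<integral>\<^sup>+ x. (\<integral>\<^sup>+ j. h j * ennpow (\<Psi> j x) q \<partial>?N) \<partial>M)"
      by (rule nn_integral_cmult[OF mint])
    also have "\<dots> = ennpow H (q - 1) * (\<integral>\<^sup>+ j. h j * (\<integral>\<^sup>+ x. ennpow (\<Psi> j x) q \<partial>M) \<partial>?N)"
      by (subst nn_integral_count_space_nn_integral[OF J])
         (auto intro!: arg_cong2[of _ _ _ _ "(*)"] nn_integral_cong nn_integral_cmult)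
    also have "\<dots> \<le> ennpow H (q - 1) * (\<integral>\<^sup>+ j. h j * ennpow B q \<partial>?N)"
      using Bq by (intro mult_left_mono nn_integral_mono) auto
    also have "\<dots> = ennpow H (q - 1) * (H * ennpow B q)"
      by (simp add: nn_integral_multc H_def)
    also have "\<dots> = ennpow (H * B) q"
      using ennpow_add[of "q - 1" 1 H] q Htop by (simp add: ennpow_mult mult.assoc)
    finally have "ennpow (\<integral>\<^sup>+ x. ennpow (\<integral>\<^sup>+ j. h j * \<Psi> j x \<partial>?N) q \<partial>M) (1 / q) \<le> ennpow (ennpow (H * B) q) (1 / q)"
      using q by (intro ennpow_mono) auto
    then show ?thesis using q by (simp add: real Lp_norm_real ennpow_ennpow H_def)
  qed
qed

lemma Lp_norm_indicator_le_1:
  assumes "A \<in> sets M"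
  shows "Lp_norm top M (indicator A) \<le> 1"
  unfolding Lp_norm_top using assms by (intro esssup_I) (auto simp: indicator_def)

text \<open>The converse of Hoelder's inequality, with test functions that are bounded and supported in
one of the sets \<open>E m\<close>. For \<open>r = p' < \<infinity>\<close> the test function is \<open>g\<^sup>r\<^sup>-\<^sup>1\<close> on \<open>E m\<close>: both sides are then
powers of the same finite integral, and \<open>m\<close> tends to infinity. For \<open>p' = \<infinity>\<close> it is the indicator of
the part of \<open>E m\<close> where \<open>g > K\<close>, which must be a null set.\<close>

lemma Lp_norm_le_by_duality:
  fixes g :: "'a \<Rightarrow> real"
  assumes p: "1 \<le> p"
    and g[measurable]: "g \<in> borel_measurable M" and g0: "\<And>x. 0 \<le> g x"
    and E[measurable]: "\<And>m. E m \<in> sets M" and inc: "incseq E"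
    and fin: "\<And>m. emeasure M (E m) < top"
    and gE: "\<And>m x. x \<in> E m \<Longrightarrow> g x \<le> real m"
    and cover: "AE x in M. g x \<noteq> 0 \<longrightarrow> x \<in> (\<Union>m. E m)"
    and K: "0 \<le> K"
    and dual: "\<And>m h b. h \<in> borel_measurable M \<Longrightarrow> (\<And>x. 0 \<le> h x) \<Longrightarrow> (\<And>x. h x \<le> b)
       \<Longrightarrow> (\<And>x. x \<notin> E m \<Longrightarrow> h x = 0)
       \<Longrightarrow> (\<integral>\<^sup>+ x. ennreal (h x * g x) \<partial>M) \<le> ennreal K * Lp_norm p M (\<lambda>x. ennreal (h x))"
  shows "Lp_norm (conj_exponent p) M (\<lambda>x. ennreal (g x)) \<le> ennreal K"
proof -
  have finite_conj: "Lp_norm (ennreal r) M (\<lambda>x. ennreal (g x)) \<le> ennreal K"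
    if r: "1 \<le> r" and S: "\<And>m S. (\<integral>\<^sup>+ x. ennreal (indicator (E m) x * g x powr r) \<partial>M) = ennreal S
      \<Longrightarrow> 0 \<le> S \<Longrightarrow> S > 0 \<Longrightarrow> ennreal S \<le> ennreal K * Lp_norm p M (\<lambda>x. ennreal (indicator (E m) x * g x powr (r - 1)))
      \<Longrightarrow> S powr (1 / r) \<le> K" for r
  proof -
    have bound: "(\<integral>\<^sup>+ x. ennreal (indicator (E m) x * g x powr r) \<partial>M) \<le> ennreal (K powr r)" for m
    proof -
      have "(\<integral>\<^sup>+ x. ennreal (indicator (E m) x * g x powr r) \<partial>M) \<le> (\<integral>\<^sup>+ x. ennreal (real m powr r) * indicator (E m) x \<partial>M)"
        using gE[of _ m] g0 r by (intro nn_integral_mono) (auto simp: indicator_def powr_mono2)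
      also have "\<dots> < top"
        using fin[of m] by (simp add: nn_integral_cmult_indicator ennreal_mult_less_top)
      finally obtain S where S1: "(\<integral>\<^sup>+ x. ennreal (indicator (E m) x * g x powr r) \<partial>M) = ennreal S" "0 \<le> S"
        by (cases "\<integral>\<^sup>+ x. ennreal (indicator (E m) x * g x powr r) \<partial>M") auto
      show ?thesis
      proof (cases "S = 0")
        case False
        have eq: "g x powr (r - 1) * g x = g x powr r" for x
          using g0[of x] powr_add[of "g x" "r - 1" 1] by (cases "g x = 0") auto
        have "(\<integral>\<^sup>+ x. ennreal ((indicator (E m) x * g x powr (r - 1)) * g x) \<partial>M)
          \<le> ennreal K * Lp_norm p M (\<lambda>x. ennreal (indicator (E m) x * g x powr (r - 1)))"
          by (rule dual[where m = m and b = "real m powr (r - 1)"])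
             (use gE[of _ m] g0 r in \<open>auto simp: indicator_def powr_mono2\<close>)
        then have "S powr (1 / r) \<le> K"
          using S1 False by (intro S) (auto simp: mult.assoc eq)
        then have "(S powr (1 / r)) powr r \<le> K powr r"
          using r by (intro powr_mono2) auto
        then show ?thesis using S1 r K by (simp add: powr_powr ennreal_leI)
      qed (use S1 in simp)
    qed
    have "(\<integral>\<^sup>+ x. ennreal (g x powr r) \<partial>M) = (\<integral>\<^sup>+ x. (SUP m. ennreal (indicator (E m) x * g x powr r)) \<partial>M)"
      using cover
    proof (intro nn_integral_cong_AE, eventually_elim)
      case (elim x)
      show ?case
      proof (cases "g x = 0")
        case False
        then obtain m where "x \<in> E m" using elim by auto
        then have "ennreal (g x powr r) \<le> (SUP m. ennreal (indicator (E m) x * g x powr r))"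
          by (intro SUP_upper2[of m]) auto
        moreover have "(SUP m. ennreal (indicator (E m) x * g x powr r)) \<le> ennreal (g x powr r)"
          by (intro SUP_least) (auto simp: indicator_def)
        ultimately show ?thesis by (rule antisym)
      qed (simp add: image_constant_conv)
    qed
    also have "\<dots> = (SUP m. \<integral>\<^sup>+ x. ennreal (indicator (E m) x * g x powr r) \<partial>M)"
    proof (rule nn_integral_monotone_convergence_SUP)
      show "incseq (\<lambda>m x. ennreal (indicator (E m) x * g x powr r))"
        using inc by (auto simp: incseq_def le_fun_def indicator_def split: if_splits)
    qed measurable
    also have "\<dots> \<le> ennreal (K powr r)" by (intro SUP_least bound)
    finally have "ennpow (\<integral>\<^sup>+ x. ennreal (g x powr r) \<partial>M) (1 / r) \<le> ennpow (ennreal (K powr r)) (1 / r)"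
      using r by (intro ennpow_mono) auto
    then show ?thesis
      using r g0 K by (simp add: Lp_norm_real ennpow_ennreal powr_powr)
  qed
  show ?thesis using p
  proof (cases rule: exponent_cases)
    case one
    have "AE x in M. g x \<le> K"
    proof -
      have "AE x in M. \<forall>m. \<not> (x \<in> E m \<and> K < g x)"
      proof (subst AE_all_countable, intro allI)
        fix m
        define F where "F = {x \<in> space M. x \<in> E m \<and> K < g x}"
        have Em: "E m \<subseteq> space M" using E[of m] sets.sets_into_space by blast
        have F[measurable]: "F \<in> sets M" unfolding F_def by measurable
        have "emeasure M F \<le> emeasure M (E m)"
          by (intro emeasure_mono) (auto simp: F_def)
        then have Ffin: "emeasure M F < top" using fin[of m] by simp
        have "(\<integral>\<^sup>+ x. ennreal (indicator F x * g x) \<partial>M)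
           \<le> ennreal K * Lp_norm p M (\<lambda>x. ennreal (indicator F x))"
          by (rule dual[where m = m and b = 1]) (auto simp: indicator_def F_def)
        also have "\<dots> = (\<integral>\<^sup>+ x. ennreal K * indicator F x \<partial>M)"
          using one by (simp add: Lp_norm_1 nn_integral_cmult ennreal_indicator)
        finally have le: "(\<integral>\<^sup>+ x. ennreal (indicator F x * g x) \<partial>M) \<le> (\<integral>\<^sup>+ x. ennreal K * indicator F x \<partial>M)" .
        have "(\<integral>\<^sup>+ x. ennreal (indicator F x * (g x - K)) \<partial>M) + (\<integral>\<^sup>+ x. ennreal K * indicator F x \<partial>M)
            = (\<integral>\<^sup>+ x. ennreal (indicator F x * (g x - K)) + ennreal K * indicator F x \<partial>M)"
          by (rule nn_integral_add[symmetric]) auto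
        also have "\<dots> = (\<integral>\<^sup>+ x. ennreal (indicator F x * g x) \<partial>M)"
          using K by (intro nn_integral_cong) (auto simp: indicator_def F_def simp flip: ennreal_plus)
        finally have "(\<integral>\<^sup>+ x. ennreal (indicator F x * (g x - K)) \<partial>M) + (\<integral>\<^sup>+ x. ennreal K * indicator F x \<partial>M)
            \<le> 0 + (\<integral>\<^sup>+ x. ennreal K * indicator F x \<partial>M)"
          using le by simp
        moreover have "(\<integral>\<^sup>+ x. ennreal K * indicator F x \<partial>M) \<noteq> top"
          using Ffin by (simp add: nn_integral_cmult ennreal_mult_eq_top_iff)
        ultimately have "(\<integral>\<^sup>+ x. ennreal (indicator F x * (g x - K)) \<partial>M) = 0"
          using ennreal_add_left_cancel_le[of "\<integral>\<^sup>+ x. ennreal K * indicator F x \<partial>M" _ 0]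
          by (simp only: add.commute[of _ "\<integral>\<^sup>+ x. ennreal K * indicator F x \<partial>M"] infinity_ennreal_def le_zero_eq) blast
        then have "AE x in M. ennreal (indicator F x * (g x - K)) = 0"
          by (subst (asm) nn_integral_0_iff_AE) auto
        then show "AE x in M. \<not> (x \<in> E m \<and> K < g x)"
          using AE_space by eventually_elim (auto simp: F_def indicator_def split: if_splits)
      qed
      with cover show ?thesis
        by eventually_elim (use K in force)
    qed
    then have "AE x in M. ennreal (g x) \<le> ennreal K" by eventually_elim (rule ennreal_leI)
    then show ?thesis using one by (simp add: Lp_norm_top esssup_I)
  next
    case top
    have "Lp_norm (ennreal 1) M (\<lambda>x. ennreal (g x)) \<le> ennreal K"
    proof (rule finite_conj)
      fix m S
      assume S: "ennreal S \<le> ennreal K * Lp_norm p M (\<lambda>x. ennreal (indicator (E m) x * g x powr (1 - 1)))" "0 < S"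
      have "Lp_norm p M (\<lambda>x. ennreal (indicator (E m) x * g x powr (1 - 1))) \<le> 1"
        unfolding top Lp_norm_top by (rule esssup_I) (auto simp: indicator_def)
      then have "ennreal K * Lp_norm p M (\<lambda>x. ennreal (indicator (E m) x * g x powr (1 - 1))) \<le> ennreal K * 1"
        by (intro mult_left_mono) auto
      with S have "ennreal S \<le> ennreal K" by (auto intro: order_trans)
      with S K show "S powr (1 / 1) \<le> K" by (simp add: ennreal_le_iff)
    qed simp
    then show ?thesis using top by simp
  next
    case (mid q)
    let ?r = "q / (q - 1)"
    have r: "1 < ?r" using mid by (simp add: field_simps)
    have "Lp_norm (ennreal ?r) M (\<lambda>x. ennreal (g x)) \<le> ennreal K"
    proof (rule finite_conj)
      fix m S
      assume S: "(\<integral>\<^sup>+ x. ennreal (indicator (E m) x * g x powr ?r) \<partial>M) = ennreal S" "0 < S"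
        "ennreal S \<le> ennreal K * Lp_norm p M (\<lambda>x. ennreal (indicator (E m) x * g x powr (?r - 1)))"
      have "(?r - 1) * q = ?r" using mid by (simp add: field_simps)
      then have "ennpow (ennreal (indicator (E m) x * g x powr (?r - 1))) q = ennreal (indicator (E m) x * g x powr ?r)" for x
        by (auto simp: ennpow_ennreal indicator_def powr_powr)
      then have "Lp_norm p M (\<lambda>x. ennreal (indicator (E m) x * g x powr (?r - 1))) = ennpow (ennreal S) (1 / q)"
        using mid S by (simp add: Lp_norm_real)
      then have "S \<le> K * S powr (1 / q)"
        using S K by (simp add: ennpow_ennreal ennreal_mult[symmetric])
      then have "S / S powr (1 / q) \<le> K" using S by (simp add: field_simps)
      moreover have "S / S powr (1 / q) = S powr (1 / ?r)"
        using S mid powr_diff[of S 1 "1 / q"] by (simp add: diff_divide_distrib)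
      ultimately show "S powr (1 / ?r) \<le> K" by simp
    qed (use r in simp)
    then show ?thesis using mid by simp
  qed
qed

section \<open>Averages over cubes\<close>

lemma sigma_finite_lebesgue: "sigma_finite_measure (lebesgue :: 'a::euclidean_space measure)"
proof
  show "\<exists>A::'a set set. countable A \<and> A \<subseteq> sets lebesgue \<and> \<Union> A = space lebesgue
      \<and> (\<forall>a\<in>A. emeasure lebesgue a \<noteq> \<infinity>)"
  proof (intro exI[of _ "range (\<lambda>n::nat. cball 0 (real n))"] conjI ballI)
    show "\<Union> (range (\<lambda>n::nat. cball (0::'a) (real n))) = space lebesgue"
      using real_arch_simple by (fastforce simp: dist_norm)
    fix a assume "a \<in> range (\<lambda>n::nat. cball (0::'a) (real n))"
    then have "bounded a" "a \<in> sets borel" by auto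
    then show "emeasure lebesgue a \<noteq> \<infinity>"
      using emeasure_bounded_finite[of a] by (auto simp: less_top)
  qed auto
qed

lemma gauss_norm_eq_Lp_norm:
  fixes g :: "complex^'n \<Rightarrow> ennreal"
  assumes "1 \<le> p"
  shows "gauss_norm \<alpha> p g = Lp_norm p lebesgue (\<lambda>z. g z * ennreal (exp (- (\<alpha> / 2) * (norm z)\<^sup>2)))"
proof (cases p)
  case (real q)
  have "ennpow (ennreal (exp (- (\<alpha> / 2) * (norm z)\<^sup>2))) q = ennreal (exp (- (q * \<alpha> / 2) * (norm z)\<^sup>2))" for z :: "complex^'n"
    by (simp add: ennpow_ennreal powr_def)
  then show ?thesis using real by (simp add: gauss_norm_def Lp_norm_real ennpow_mult)
qed (simp add: gauss_norm_def Lp_norm_top)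

lemma cubesE:
  assumes "Q \<in> cubes r"
  obtains a where "Q = cbox a (a + r *\<^sub>R (\<Sum>b\<in>Basis. b))"
  using assms by (auto simp: cubes_def)

lemma inner_sum_Basis: "b \<in> Basis \<Longrightarrow> (\<Sum>b\<in>Basis. b) \<bullet> (b :: 'a::euclidean_space) = 1"
  by (simp add: inner_sum_left inner_Basis if_distrib sum.delta cong: if_cong)

lemma emeasure_cube:
  fixes Q :: "(complex^'n) set"
  assumes "Q \<in> cubes r" "0 < r"
  shows "emeasure lebesgue Q = ennreal (r ^ (2 * CARD('n)))"
proof -
  obtain a where Q: "Q = cbox a (a + r *\<^sub>R (\<Sum>b\<in>Basis. b))" using assms(1) by (rule cubesE)
  have "emeasure lborel Q = ennreal (\<Prod>b\<in>(Basis :: (complex^'n) set). r)"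
    unfolding Q using assms(2)
    by (subst emeasure_lborel_cbox) (auto simp: inner_add_left inner_sum_Basis)
  then show ?thesis by (simp add: Q mult.commute)
qed

lemma sets_cube: "Q \<in> cubes r \<Longrightarrow> Q \<in> sets lebesgue"
  by (auto elim!: cubesE)

lemma esssup_restrict_space:
  fixes g :: "'a \<Rightarrow> ennreal"
  assumes g[measurable]: "g \<in> borel_measurable M" and Q[measurable]: "Q \<in> sets M"
  shows "esssup (restrict_space M Q) g = esssup M (\<lambda>x. g x * indicator Q x)"
proof (rule antisym)
  have gr: "g \<in> borel_measurable (restrict_space M Q)"
    by (rule measurable_restrict_space1) fact
  have "AE x in M. x \<in> Q \<longrightarrow> g x \<le> esssup M (\<lambda>x. g x * indicator Q x)"
    using esssup_AE[of "\<lambda>x. g x * indicator Q x" M] by eventually_elim (auto simp: indicator_def split: if_splits)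
  then show "esssup (restrict_space M Q) g \<le> esssup M (\<lambda>x. g x * indicator Q x)"
    by (intro esssup_I gr) (auto simp: AE_restrict_space_iff)
  have "AE x in M. x \<in> Q \<longrightarrow> g x \<le> esssup (restrict_space M Q) g"
    using esssup_AE[of g "restrict_space M Q"] by (auto simp: AE_restrict_space_iff)
  then show "esssup M (\<lambda>x. g x * indicator Q x) \<le> esssup (restrict_space M Q) g"
    by (intro esssup_I, measurable, eventually_elim) (auto simp: indicator_def)
qed

text \<open>The unnormalised counterpart of \<open>avg_norm\<close>, as a norm over the whole space: inequalities that
involve two different cubes need a common measure.\<close>

definition local_norm :: "ennreal \<Rightarrow> 'a::euclidean_space set \<Rightarrow> ('a \<Rightarrow> ennreal) \<Rightarrow> ennreal" where
  "local_norm p Q g = Lp_norm p lebesgue (\<lambda>z. g z * indicator Q z)"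

lemma avg_norm_eq_local_norm:
  fixes Q :: "(complex^'n) set"
  assumes p: "1 \<le> p" and Q: "Q \<in> cubes r" and r: "0 < r"
    and g[measurable]: "(\<lambda>z. \<rho> z x) \<in> borel_measurable lebesgue"
  shows "avg_norm p Q \<rho> x
    = ennreal ((r ^ (2 * CARD('n))) powr - exponent_inv p) * local_norm p Q (\<lambda>z. \<rho> z x)"
proof (cases p)
  case (real q)
  then have q: "1 \<le> q" using p by (simp flip: ennreal_1)
  let ?V = "r ^ (2 * CARD('n))"
  have V: "0 < ?V" using r by simp
  have "exponent_inv p = 1 / q"
    using real q by (simp add: exponent_inv_def inverse_ennreal inverse_eq_divide)
  moreover have "ennpow (ennreal ?V) (- (1 / q)) = ennpow (inverse (ennreal ?V)) (1 / q)"
    using V by (simp add: inverse_ennreal ennpow_ennreal powr_minus_divide powr_divide inverse_eq_divide)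
  moreover have "ennpow (\<rho> z x * indicator Q z) q = ennpow (\<rho> z x) q * indicator Q z" for z
    by (simp add: indicator_def)
  ultimately show ?thesis
    using real q V emeasure_cube[OF Q r]
    by (simp add: avg_norm_def local_norm_def Lp_norm_real divide_ennreal_def ennpow_mult ennpow_ennreal mult.commute)
qed (use r esssup_restrict_space[OF g sets_cube[OF Q]] in
     \<open>simp add: avg_norm_def local_norm_def Lp_norm_top exponent_inv_def\<close>)

section \<open>Positive matrices and almost Auerbach bases\<close>

lemma cscalar_sum:
  fixes x y :: "complex Matrix.vec"
  assumes "y \<in> carrier_vec d"
  shows "x \<bullet>c y = (\<Sum>i<d. x $ i * cnj (y $ i))"
  using assms by (simp add: scalar_prod_def atLeast0LessThan)

lemma mult_mat_vec_index:
  assumes "A \<in> carrier_mat d d" "x \<in> carrier_vec d" "i < d"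
  shows "(A *\<^sub>v x) $ i = (\<Sum>j<d. A $$ (i, j) * x $ j)"
  using assms by (simp add: scalar_prod_def atLeast0LessThan)

lemma vnorm_L2_set: "vnorm v = L2_set (\<lambda>i. cmod (v $ i)) {..<dim_vec v}"
proof -
  have "v \<bullet>c v = (\<Sum>i<dim_vec v. v $ i * cnj (v $ i))"
    by (rule cscalar_sum) simp
  also have "\<dots> = complex_of_real (\<Sum>i<dim_vec v. (cmod (v $ i))\<^sup>2)"
    by (simp only: of_real_sum complex_norm_square)
  finally show ?thesis by (simp add: vnorm_def L2_set_def)
qed

lemma vnorm_nonneg [simp]: "0 \<le> vnorm v"
  by (simp add: vnorm_L2_set)

lemma cscalar_self: "v \<bullet>c v = complex_of_real ((vnorm v)\<^sup>2)"
proof -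
  have "v \<bullet>c v = (\<Sum>i<dim_vec v. v $ i * cnj (v $ i))"
    by (rule cscalar_sum) simp
  also have "\<dots> = complex_of_real (\<Sum>i<dim_vec v. (cmod (v $ i))\<^sup>2)"
    by (simp only: of_real_sum complex_norm_square)
  also have "(\<Sum>i<dim_vec v. (cmod (v $ i))\<^sup>2) = (vnorm v)\<^sup>2"
    by (simp add: vnorm_L2_set L2_set_def sum_nonneg)
  finally show ?thesis .
qed

lemma vnorm_eq_0_iff: "v \<in> carrier_vec d \<Longrightarrow> vnorm v = 0 \<longleftrightarrow> v = 0\<^sub>v d"
  using conjugate_square_eq_0_vec[of v d] cscalar_self[of v] by simp

lemma vnorm_smult: "vnorm (c \<cdot>\<^sub>v v) = cmod c * vnorm v"
  by (simp add: vnorm_L2_set L2_set_def norm_mult power_mult_distrib real_sqrt_mult flip: sum_distrib_left)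

lemma cmod_index_le_vnorm: "i < dim_vec v \<Longrightarrow> cmod (v $ i) \<le> vnorm v"
  unfolding vnorm_L2_set by (rule member_le_L2_set) auto

lemma vnorm_le_sum: "v \<in> carrier_vec d \<Longrightarrow> vnorm v \<le> (\<Sum>i<d. cmod (v $ i))"
  unfolding vnorm_L2_set by (rule order.trans[OF L2_set_le_sum]) auto

lemma cscalar_Cauchy_Schwarz:
  assumes "x \<in> carrier_vec d" "y \<in> carrier_vec d"
  shows "cmod (x \<bullet>c y) \<le> vnorm x * vnorm y"
proof -
  have "cmod (x \<bullet>c y) \<le> (\<Sum>i<d. \<bar>cmod (x $ i)\<bar> * \<bar>cmod (y $ i)\<bar>)"
    unfolding cscalar_sum[OF assms(2)] by (rule order.trans[OF norm_sum]) (simp add: norm_mult)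
  also have "\<dots> \<le> vnorm x * vnorm y"
    using assms unfolding vnorm_L2_set by (metis L2_set_mult_ineq carrier_vecD)
  finally show ?thesis .
qed

text \<open>The triangle inequality, obtained by pairing the sum with itself.\<close>

lemma vnorm_lincomb_le:
  assumes v: "\<And>j. j \<in> I \<Longrightarrow> v j \<in> carrier_vec d"
  shows "vnorm (Matrix.vec d (\<lambda>i. \<Sum>j\<in>I. c j * v j $ i)) \<le> (\<Sum>j\<in>I. cmod (c j) * vnorm (v j))"
proof -
  define w where "w = Matrix.vec d (\<lambda>i. \<Sum>j\<in>I. c j * v j $ i)"
  have w: "w \<in> carrier_vec d" by (simp add: w_def)
  have "complex_of_real ((vnorm w)\<^sup>2) = (\<Sum>i<d. (\<Sum>j\<in>I. c j * v j $ i) * cnj (w $ i))"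
    unfolding cscalar_self[symmetric] cscalar_sum[OF w] by (intro sum.cong) (simp_all add: w_def)
  also have "\<dots> = (\<Sum>j\<in>I. \<Sum>i<d. c j * v j $ i * cnj (w $ i))"
    unfolding sum_distrib_right by (rule sum.swap)
  also have "\<dots> = (\<Sum>j\<in>I. c j * (v j \<bullet>c w))"
    by (simp add: cscalar_sum[OF w] sum_distrib_left mult_ac)
  finally have "cmod (complex_of_real ((vnorm w)\<^sup>2)) = cmod (\<Sum>j\<in>I. c j * (v j \<bullet>c w))" by simp
  also have "\<dots> \<le> (\<Sum>j\<in>I. cmod (c j) * (vnorm (v j) * vnorm w))"
    by (intro order.trans[OF norm_sum] sum_mono)
      (auto simp: norm_mult intro!: mult_left_mono cscalar_Cauchy_Schwarz[OF v w])
  also have "\<dots> = (\<Sum>j\<in>I. cmod (c j) * vnorm (v j)) * vnorm w"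
    by (simp add: sum_distrib_right mult.assoc)
  finally have "vnorm w * vnorm w \<le> (\<Sum>j\<in>I. cmod (c j) * vnorm (v j)) * vnorm w"
    by (simp add: norm_mult power2_eq_square)
  moreover have "0 \<le> (\<Sum>j\<in>I. cmod (c j) * vnorm (v j))" by (intro sum_nonneg) auto
  ultimately show ?thesis
    by (cases "vnorm w = 0") (auto simp: w_def mult_le_cancel_right less_le)
qed

lemma cscalar_commute:
  fixes x y :: "complex Matrix.vec"
  assumes "x \<in> carrier_vec d" "y \<in> carrier_vec d"
  shows "y \<bullet>c x = cnj (x \<bullet>c y)"
  using assms by (simp add: cscalar_sum mult.commute)

lemma mult_mat_zero_vec: "A \<in> carrier_mat m d \<Longrightarrow> A *\<^sub>v 0\<^sub>v d = 0\<^sub>v m"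
  for A :: "complex mat"
  by (intro eq_vecI) auto

definition good_mat :: "nat \<Rightarrow> complex Matrix.mat \<Rightarrow> bool" where
  "good_mat d A \<longleftrightarrow> positive_mat d A \<and> invertible_mat A"

text \<open>Polarisation: the sesquilinear form of \<open>A\<close> is real on the diagonal, in particular at \<open>x + y\<close> and at
\<open>x + \<i> y\<close>.\<close>

lemma positive_mat_hermitian:
  assumes A: "positive_mat d A" and x: "x \<in> carrier_vec d" and y: "y \<in> carrier_vec d"
  shows "(A *\<^sub>v x) \<bullet>c y = x \<bullet>c (A *\<^sub>v y)"
proof -
  have Ac: "A \<in> carrier_mat d d" using A by (simp add: positive_mat_def)
  define s where "s u v = (A *\<^sub>v u) \<bullet>c v" for u v
  have real: "Im (s u u) = 0" if "u \<in> carrier_vec d" for u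
    using A that by (auto simp: positive_mat_def s_def complex_nonneg_Reals_iff)
  have s: "s u v = (\<Sum>i<d. \<Sum>j<d. A $$ (i, j) * u $ j * cnj (v $ i))"
    if "u \<in> carrier_vec d" "v \<in> carrier_vec d" for u v
    using that Ac by (simp add: s_def cscalar_sum[of v d] mult_mat_vec_index sum_distrib_right del: index_mult_mat_vec)
  have add: "s (u + c \<cdot>\<^sub>v v) (u + c \<cdot>\<^sub>v v) = s u u + cnj c * s u v + c * s v u + c * cnj c * s v v"
    if "u \<in> carrier_vec d" "v \<in> carrier_vec d" for u v c
    using that by (simp add: s algebra_simps sum.distrib sum_distrib_left)
  have 1: "Im (s x y + s y x) = 0"
    using add[OF x y, of 1] real[of "x + 1 \<cdot>\<^sub>v y"] real[OF x] real[OF y] x y by simp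
  have 2: "Im (- \<i> * s x y + \<i> * s y x) = 0"
    using add[OF x y, of \<i>] real[of "x + \<i> \<cdot>\<^sub>v y"] real[OF x] real[OF y] x y by simp
  from 1 2 have "s x y = cnj (s y x)" by (simp add: complex_eq_iff)
  then show ?thesis
    using cscalar_commute[of "A *\<^sub>v y" d x] x y Ac by (simp add: s_def)
qed

lemma inv_mat:
  assumes "A \<in> carrier_mat d d" "invertible_mat A"
  shows "inv_mat A \<in> carrier_mat d d" "A * inv_mat A = 1\<^sub>m d" "inv_mat A * A = 1\<^sub>m d"
proof -
  obtain B where B: "inverts_mat A B" "inverts_mat B A"
    using assms(2) by (auto simp: invertible_mat_def)
  have AB: "A * B = 1\<^sub>m d" using B(1) assms(1) by (simp add: inverts_mat_def)
  have BA: "B * A = 1\<^sub>m (dim_row B)" using B(2) by (simp add: inverts_mat_def)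
  have "dim_row B = d" using arg_cong[OF BA, of dim_col] assms(1) by simp
  moreover have "dim_col B = d" using arg_cong[OF AB, of dim_col] by simp
  ultimately have Bc: "B \<in> carrier_mat d d" by auto
  have "A \<in> Units (ring_mat TYPE(complex) d ())"
    using assms(1) Bc AB BA \<open>dim_row B = d\<close> by (auto simp: Units_def ring_mat_def)
  then obtain C where "mat_inverse A = Some C"
    using mat_inverse(1)[OF assms(1), where b = "()"] by (cases "mat_inverse A") auto
  then show "inv_mat A \<in> carrier_mat d d" "A * inv_mat A = 1\<^sub>m d" "inv_mat A * A = 1\<^sub>m d"
    using mat_inverse(2)[OF assms(1)] by (auto simp: inv_mat_def)
qed

lemma good_mat_inverse:
  assumes "good_mat d A"
  shows "A \<in> carrier_mat d d" "inv_mat A \<in> carrier_mat d d"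
    and "\<And>x. x \<in> carrier_vec d \<Longrightarrow> A *\<^sub>v (inv_mat A *\<^sub>v x) = x"
    and "\<And>x. x \<in> carrier_vec d \<Longrightarrow> inv_mat A *\<^sub>v (A *\<^sub>v x) = x"
    and "\<And>x y. x \<in> carrier_vec d \<Longrightarrow> y \<in> carrier_vec d \<Longrightarrow> (inv_mat A *\<^sub>v x) \<bullet>c y = x \<bullet>c (inv_mat A *\<^sub>v y)"
proof -
  show Ac: "A \<in> carrier_mat d d" using assms by (simp add: good_mat_def positive_mat_def)
  note B = inv_mat[OF Ac] 
  have inv: "invertible_mat A" using assms by (simp add: good_mat_def)
  show Bc: "inv_mat A \<in> carrier_mat d d" using B inv by simp
  show 1: "A *\<^sub>v (inv_mat A *\<^sub>v x) = x" if "x \<in> carrier_vec d" for x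
    using B(2)[OF inv] assoc_mult_mat_vec[OF Ac Bc that] that by simp
  show 2: "inv_mat A *\<^sub>v (A *\<^sub>v x) = x" if "x \<in> carrier_vec d" for x
    using B(3)[OF inv] assoc_mult_mat_vec[OF Bc Ac that] that by simp
  fix x y :: "complex Matrix.vec" assume x: "x \<in> carrier_vec d" and y: "y \<in> carrier_vec d"
  have "(inv_mat A *\<^sub>v x) \<bullet>c (A *\<^sub>v (inv_mat A *\<^sub>v y)) = (A *\<^sub>v (inv_mat A *\<^sub>v x)) \<bullet>c (inv_mat A *\<^sub>v y)"
    by (rule positive_mat_hermitian[symmetric]) (use assms x y Bc in \<open>auto simp: good_mat_def\<close>)
  then show "(inv_mat A *\<^sub>v x) \<bullet>c y = x \<bullet>c (inv_mat A *\<^sub>v y)"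
    by (simp only: 1[OF x] 1[OF y])
qed

text \<open>The supremum is attained at \<open>y = A\<^sup>-\<^sup>2 x\<close>; the upper bound is the Cauchy-Schwarz inequality for
\<open>\<langle>x, y\<rangle> = \<langle>A\<^sup>-\<^sup>1 x, A y\<rangle>\<close>.\<close>

lemma dual_norm_good_mat:
  assumes A: "good_mat d A" and x: "x \<in> carrier_vec d"
  shows "dual_norm d (\<lambda>y. ennreal (vnorm (A *\<^sub>v y))) x = ennreal (vnorm (inv_mat A *\<^sub>v x))"
proof (rule antisym)
  note inv = good_mat_inverse[OF A]
  let ?B = "inv_mat A"
  show "dual_norm d (\<lambda>y. ennreal (vnorm (A *\<^sub>v y))) x \<le> ennreal (vnorm (?B *\<^sub>v x))"
    unfolding dual_norm_def
  proof (rule SUP_least)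
    fix y :: "complex Matrix.vec" assume y: "y \<in> carrier_vec d - {0\<^sub>v d}"
    have Ay: "A *\<^sub>v y \<in> carrier_vec d" using inv y by simp
    have "A *\<^sub>v y \<noteq> 0\<^sub>v d"
    proof
      assume "A *\<^sub>v y = 0\<^sub>v d"
      moreover have "?B *\<^sub>v 0\<^sub>v d = 0\<^sub>v d" by (rule mult_mat_zero_vec[OF inv(2)])
      ultimately show False using inv(4)[of y] y by simp
    qed
    then have pos: "0 < vnorm (A *\<^sub>v y)" using vnorm_eq_0_iff[OF Ay] by (simp add: less_le)
    have "x \<bullet>c y = (?B *\<^sub>v x) \<bullet>c (A *\<^sub>v y)"
      using inv(5)[of x "A *\<^sub>v y"] inv(4)[of y] x y Ay by simp
    then have "cmod (x \<bullet>c y) \<le> vnorm (?B *\<^sub>v x) * vnorm (A *\<^sub>v y)"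
      using cscalar_Cauchy_Schwarz[of "?B *\<^sub>v x" d "A *\<^sub>v y"] inv x Ay by simp
    then show "ennreal (cmod (x \<bullet>c y)) / ennreal (vnorm (A *\<^sub>v y)) \<le> ennreal (vnorm (?B *\<^sub>v x))"
      using pos by (simp add: divide_ennreal field_simps ennreal_leI)
  qed
  show "ennreal (vnorm (?B *\<^sub>v x)) \<le> dual_norm d (\<lambda>y. ennreal (vnorm (A *\<^sub>v y))) x"
  proof (cases "?B *\<^sub>v x = 0\<^sub>v d")
    case True
    then show ?thesis using vnorm_eq_0_iff[of "?B *\<^sub>v x" d] by simp
  next
    case False
    have Bx: "?B *\<^sub>v x \<in> carrier_vec d" using inv x by simp
    define y where "y = ?B *\<^sub>v (?B *\<^sub>v x)"
    have yc: "y \<in> carrier_vec d" using inv x by (simp add: y_def)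
    have Ay: "A *\<^sub>v y = ?B *\<^sub>v x" using inv(3)[OF Bx] by (simp add: y_def)
    have "y \<noteq> 0\<^sub>v d" using Ay False mult_mat_zero_vec[OF inv(1)] by auto
    moreover have "x \<bullet>c y = complex_of_real ((vnorm (?B *\<^sub>v x))\<^sup>2)"
      using inv(5)[OF x Bx] by (simp add: y_def cscalar_self)
    moreover have "0 < vnorm (?B *\<^sub>v x)" using vnorm_eq_0_iff[OF Bx] False by (simp add: less_le)
    ultimately show ?thesis unfolding dual_norm_def
      by (intro SUP_upper2[of y])
         (auto simp: yc Ay divide_ennreal norm_mult power2_eq_square)
  qed
qed

lemma col_replace_col:
  assumes "A \<in> carrier_mat n n" "v \<in> carrier_vec n" "k < n" "i < n"
  shows "col (replace_col A v k) i = (if i = k then v else col A i)"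
  using assms by (intro eq_vecI) (auto simp: replace_col_def)

text \<open>An Auerbach basis maximises the determinant over the unit ball of \<open>\<rho>\<close>. A choice whose determinant
exceeds half of the supremum needs no compactness and costs only the factor \<open>2\<close>: by Cramer's rule
the \<open>i\<close>-th coordinate of \<open>y\<close> is the determinant with \<open>y\<close> in column \<open>i\<close>, divided by that of \<open>E\<close>.
The function \<open>\<rho>\<close> may be infinite in some directions; \<open>sep\<close> says that the vectors on which it is finite
are not contained in a hyperplane, and \<open>low\<close> bounds the determinants.\<close>

lemma near_Auerbach_basis:
  fixes \<rho> :: "complex Matrix.vec \<Rightarrow> ennreal"
  assumes hom: "\<And>x c. x \<in> carrier_vec d \<Longrightarrow> \<rho> (c \<cdot>\<^sub>v x) = ennreal (cmod c) * \<rho> x"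
    and low: "\<And>x i. x \<in> carrier_vec d \<Longrightarrow> i < d \<Longrightarrow> ennreal (cmod (x $ i)) \<le> ennreal K * \<rho> x"
    and sep: "\<And>x. x \<in> carrier_vec d \<Longrightarrow> x \<noteq> 0\<^sub>v d \<Longrightarrow> \<exists>y\<in>carrier_vec d. y \<bullet>c x \<noteq> 0 \<and> \<rho> y < top"
    and K: "0 \<le> K"
  obtains E F where "E \<in> carrier_mat d d" "F \<in> carrier_mat d d" "E * F = 1\<^sub>m d" "F * E = 1\<^sub>m d"
    "\<And>i. i < d \<Longrightarrow> \<rho> (col E i) \<le> 1"
    "\<And>y i. y \<in> carrier_vec d \<Longrightarrow> i < d \<Longrightarrow> ennreal (cmod ((F *\<^sub>v y) $ i)) \<le> 2 * \<rho> y"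
proof -
  have inverse: "\<exists>F\<in>carrier_mat d d. E * F = 1\<^sub>m d \<and> F * E = 1\<^sub>m d"
    if "E \<in> carrier_mat d d" "Determinant.det E \<noteq> 0" for E :: "complex mat"
    using det_non_zero_imp_unit[OF that, of "()"] that by (auto simp: Units_def ring_mat_def)
  have cramer: "Determinant.det (replace_col E y k) = (F *\<^sub>v y) $ k * Determinant.det E"
    if "E \<in> carrier_mat d d" "F \<in> carrier_mat d d" "E * F = 1\<^sub>m d" "y \<in> carrier_vec d" "k < d"
    for E F :: "complex mat" and y k
    using cramer_lemma_mat[of E d "F *\<^sub>v y" k] assoc_mult_mat_vec[of E d d F d y] that by simp
  \<comment> \<open>Exchange argument: starting from the identity matrix, the columns are replaced one after the other by vectors on which \<open>\<rho>\<close> is finite.\<close>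
  have "\<exists>E. E \<in> carrier_mat d d \<and> Determinant.det E \<noteq> 0 \<and> (\<forall>i<k. \<rho> (col E i) < top)" if "k \<le> d" for k
    using that
  proof (induction k)
    case 0
    show ?case by (rule exI[of _ "1\<^sub>m d"]) simp
  next
    case (Suc k)
    then obtain E where E: "E \<in> carrier_mat d d" "Determinant.det E \<noteq> 0" "\<forall>i<k. \<rho> (col E i) < top"
      by auto
    obtain F where F: "F \<in> carrier_mat d d" "E * F = 1\<^sub>m d" "F * E = 1\<^sub>m d"
      using inverse[OF E(1,2)] by auto
    define x where "x = conjugate (Matrix.row F k)"
    have k: "k < d" using Suc by simp
    have xc: "x \<in> carrier_vec d" using F by (auto simp: x_def)
    have "Matrix.row F k \<bullet> col E k = 1"
      using index_mult_mat(1)[of k F k E] F(1) E(1) k by (simp add: F(3))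
    then have "Matrix.row F k \<noteq> 0\<^sub>v d" using E by auto
    then have "x \<noteq> 0\<^sub>v d" using F by (auto simp: x_def)
    then obtain y where y: "y \<in> carrier_vec d" "y \<bullet>c x \<noteq> 0" "\<rho> y < top"
      using sep[OF xc] by auto
    have "y \<bullet>c x = (F *\<^sub>v y) $ k"
      using F k y comm_scalar_prod[of y d "Matrix.row F k"] by (simp add: x_def)
    then have "Determinant.det (replace_col E y k) \<noteq> 0"
      using cramer[OF E(1) F(1,2) y(1) k] E y by simp
    moreover have "replace_col E y k \<in> carrier_mat d d" using E by (auto simp: replace_col_def)
    moreover have "\<rho> (col (replace_col E y k) i) < top" if "i < Suc k" for i
      using that E y k by (auto simp: col_replace_col less_Suc_eq)
    ultimately show ?case by blast
  qed
  from this[of d] obtain E0 where E0: "E0 \<in> carrier_mat d d" "Determinant.det E0 \<noteq> 0" "\<And>i. i < d \<Longrightarrow> \<rho> (col E0 i) < top"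
    by auto
  define admissible where "admissible E \<longleftrightarrow> E \<in> carrier_mat d d \<and> (\<forall>i<d. \<rho> (col E i) \<le> 1)" for E
  define t where "t = 1 / (1 + (\<Sum>i<d. enn2real (\<rho> (col E0 i))))"
  have S0: "0 \<le> (\<Sum>i<d. enn2real (\<rho> (col E0 i)))" by (intro sum_nonneg) auto
  then have t: "0 < t" by (simp add: t_def)
  define E1 where "E1 = complex_of_real t \<cdot>\<^sub>m E0"
  have adm1: "admissible E1"
    unfolding admissible_def
  proof (intro conjI allI impI)
    show "E1 \<in> carrier_mat d d" using E0 by (simp add: E1_def)
    fix i assume i: "i < d"
    have "col E1 i = complex_of_real t \<cdot>\<^sub>v col E0 i"
      using E0 i by (intro eq_vecI) (auto simp: E1_def)
    then have "\<rho> (col E1 i) = ennreal t * \<rho> (col E0 i)"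
      using hom[of "col E0 i" "complex_of_real t"] E0(1) t carrier_vecI[of "col E0 i" d] by simp
    also have "\<dots> = ennreal (t * enn2real (\<rho> (col E0 i)))"
      using E0(3)[OF i] t by (cases "\<rho> (col E0 i)") (auto simp: ennreal_mult)
    also have "t * enn2real (\<rho> (col E0 i)) \<le> 1"
    proof -
      have "enn2real (\<rho> (col E0 i)) \<le> (\<Sum>i<d. enn2real (\<rho> (col E0 i)))"
        using i by (intro member_le_sum) auto
      then show ?thesis using S0 by (simp add: t_def divide_le_eq)
    qed
    then have "ennreal (t * enn2real (\<rho> (col E0 i))) \<le> 1" by (simp flip: ennreal_1 add: ennreal_leI)
    finally show "\<rho> (col E1 i) \<le> 1" .
  qed
  define S where "S = (\<lambda>E. cmod (Determinant.det E)) ` {E. admissible E}"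
  have bdd: "bdd_above S"
  proof (rule bdd_aboveI)
    fix s assume "s \<in> S"
    then obtain E where E: "admissible E" "s = cmod (Determinant.det E)" by (auto simp: S_def)
    have Ec: "E \<in> carrier_mat d d" using E by (simp add: admissible_def)
    have entry: "cmod (E $$ (i, j)) \<le> K" if ij: "i < d" "j < d" for i j
    proof -
      have "ennreal (cmod (E $$ (i, j))) = ennreal (cmod (col E j $ i))" using ij Ec by simp
      also have "\<dots> \<le> ennreal K * \<rho> (col E j)" using low[of "col E j" i] ij Ec by auto
      also have "\<dots> \<le> ennreal K * 1" using E ij by (intro mult_left_mono) (auto simp: admissible_def)
      finally show ?thesis using K by (simp add: ennreal_le_iff)
    qed
    have "s \<le> (\<Sum>p | p permutes {0..<d}. cmod (signof p * (\<Prod>i = 0..<d. E $$ (i, p i))))"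
      unfolding E(2) det_def'[OF Ec] by (rule norm_sum)
    also have "\<dots> \<le> (\<Sum>p | p permutes {0..<d}. K ^ d)"
    proof (rule sum_mono)
      fix p assume p: "p \<in> {p. p permutes {0..<d}}"
      have "cmod (signof p * (\<Prod>i = 0..<d. E $$ (i, p i))) = (\<Prod>i = 0..<d. cmod (E $$ (i, p i)))"
        by (simp add: norm_mult sign_def flip: prod_norm)
      also have "\<dots> \<le> (\<Prod>i = 0..<d. K)"
        using p by (intro prod_mono) (auto intro!: entry simp: permutes_in_image[of p "{0..<d}", simplified])
      finally show "cmod (signof p * (\<Prod>i = 0..<d. E $$ (i, p i))) \<le> K ^ d" by simp
    qed
    finally show "s \<le> (\<Sum>p | p permutes {0..<d}. K ^ d)" .
  qed
  have le_Sup: "cmod (Determinant.det E) \<le> Sup S" if "admissible E" for E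
    using that by (intro cSup_upper bdd) (auto simp: S_def)
  have "Determinant.det E1 \<noteq> 0" using E0 t by (simp add: E1_def)
  then have Sup0: "0 < Sup S" using le_Sup[OF adm1] by (smt (verit) zero_less_norm_iff)
  have "\<exists>s\<in>S. Sup S / 2 < s"
    using Sup0 adm1 by (subst less_cSup_iff[symmetric]) (auto simp: S_def intro!: bdd[unfolded S_def])
  then obtain E where E: "admissible E" "Sup S / 2 < cmod (Determinant.det E)" by (auto simp: S_def)
  have Ec: "E \<in> carrier_mat d d" using E by (simp add: admissible_def)
  have detE: "0 < cmod (Determinant.det E)" using E Sup0 by linarith
  obtain F where F: "F \<in> carrier_mat d d" "E * F = 1\<^sub>m d" "F * E = 1\<^sub>m d"
    using inverse[OF Ec] detE by auto
  \<comment> \<open>The matrix with \<open>y\<close> in column \<open>i\<close> competes in the supremum.\<close>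
  have unit: "cmod ((F *\<^sub>v y) $ i) \<le> 2" if "y \<in> carrier_vec d" "i < d" "\<rho> y \<le> 1" for y i
  proof -
    have "admissible (replace_col E y i)"
      using that E Ec by (auto simp: admissible_def col_replace_col) (auto simp: replace_col_def)
    then have "cmod ((F *\<^sub>v y) $ i) * cmod (Determinant.det E) \<le> 2 * cmod (Determinant.det E)"
      using le_Sup[of "replace_col E y i"] cramer[OF Ec F(1,2) that(1,2)] E(2) by (simp add: norm_mult)
    then show ?thesis using detE by simp
  qed
  show thesis
  proof (rule that[OF Ec F])
    show "\<rho> (col E i) \<le> 1" if "i < d" for i using E that by (simp add: admissible_def)
    fix y :: "complex Matrix.vec" and i assume y: "y \<in> carrier_vec d" and i: "i < d"
    consider "\<rho> y = top" | "\<rho> y = 0" | r where "\<rho> y = ennreal r" "0 < r"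
      by (cases "\<rho> y") (auto simp: less_le)
    then show "ennreal (cmod ((F *\<^sub>v y) $ i)) \<le> 2 * \<rho> y"
    proof cases
      case 1
      then show ?thesis by (simp add: ennreal_mult_top)
    next
      case 2
      have "y = 0\<^sub>v d" using low[OF y] y 2 by (intro eq_vecI) (auto simp: ennreal_eq_0_iff)
      then have "F *\<^sub>v y = 0\<^sub>v d" using F by auto
      then show ?thesis using i by simp
    next
      case 3
      define y' where "y' = complex_of_real (1 / r) \<cdot>\<^sub>v y"
      have "\<rho> y' = ennreal (1 / r) * ennreal r"
        using hom[OF y, of "complex_of_real (1 / r)"] 3 by (simp add: y'_def norm_divide)
      also have "\<dots> = 1" using 3 by (simp flip: ennreal_mult)
      finally have "cmod ((F *\<^sub>v y') $ i) \<le> 2" using unit[of y' i] y i by (simp add: y'_def)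
      moreover have "F *\<^sub>v y' = complex_of_real (1 / r) \<cdot>\<^sub>v (F *\<^sub>v y)"
        using F y by (simp add: y'_def mult_mat_vec)
      ultimately have "cmod ((F *\<^sub>v y) $ i) \<le> 2 * r"
        using i F 3 by (simp add: norm_mult norm_divide field_simps del: index_mult_mat_vec)
      then have "ennreal (cmod ((F *\<^sub>v y) $ i)) \<le> ennreal (2 * r)" by (rule ennreal_leI)
      then show ?thesis using 3 by (simp add: ennreal_mult)
    qed
  qed
qed

section \<open>Matrix weights and their averages\<close>

lemma borel_measurable_lebesgue_if_borel: "f \<in> borel_measurable borel \<Longrightarrow> f \<in> borel_measurable (lebesgue :: 'a::euclidean_space measure)"
  by (intro measurable_completion) simp

interpretation lebesgue: sigma_finite_measure "lebesgue :: 'a::euclidean_space measure"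
  by (rule sigma_finite_lebesgue)

lemma borel_measurable_lebesgue_AE_cong:
  fixes f g :: "'a::euclidean_space \<Rightarrow> 'b::topological_space"
  assumes f: "f \<in> borel_measurable lebesgue" and AE: "AE x in lebesgue. f x = g x"
  shows "g \<in> borel_measurable lebesgue"
proof (rule borel_measurableI)
  fix S :: "'b set" assume S: "open S"
  have "AE x in lebesgue. x \<in> f -` S \<inter> space lebesgue \<longleftrightarrow> x \<in> g -` S \<inter> space lebesgue"
    using AE by eventually_elim simp
  moreover have "f -` S \<inter> space lebesgue \<in> sets lebesgue"
    using f S by (intro measurable_sets) auto
  ultimately show "g -` S \<inter> space lebesgue \<in> sets lebesgue"
    by (rule completion.in_sets_AE) auto
qed

definition vec_measurable :: "nat \<Rightarrow> 'a measure \<Rightarrow> ('a \<Rightarrow> complex Matrix.vec) \<Rightarrow> bool" where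
  "vec_measurable d M f \<longleftrightarrow>
     (\<forall>z. f z \<in> carrier_vec d) \<and> (\<forall>i<d. (\<lambda>z. f z $ i) \<in> borel_measurable M)"

definition mat_measurable :: "nat \<Rightarrow> 'a measure \<Rightarrow> ('a \<Rightarrow> complex Matrix.mat) \<Rightarrow> bool" where
  "mat_measurable d M A \<longleftrightarrow>
     (\<forall>z. A z \<in> carrier_mat d d) \<and> (\<forall>i<d. \<forall>j<d. (\<lambda>z. A z $$ (i, j)) \<in> borel_measurable M)"

lemma vec_measurable_const [simp]: "x \<in> carrier_vec d \<Longrightarrow> vec_measurable d M (\<lambda>_. x)"
  by (simp add: vec_measurable_def)

lemma vec_measurable_mult:
  assumes "mat_measurable d M A" "vec_measurable d M f"
  shows "vec_measurable d M (\<lambda>z. A z *\<^sub>v f z)"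
  unfolding vec_measurable_def
proof (intro conjI allI impI)
  fix z show "A z *\<^sub>v f z \<in> carrier_vec d"
    using assms mult_mat_vec_carrier[of "A z" d d "f z"] by (auto simp: vec_measurable_def mat_measurable_def)
next
  fix i assume i: "i < d"
  have "(\<lambda>z. (A z *\<^sub>v f z) $ i) = (\<lambda>z. \<Sum>j<d. A z $$ (i, j) * f z $ j)"
    using assms i by (auto simp: vec_measurable_def mat_measurable_def mult_mat_vec_index
        simp del: index_mult_mat_vec)
  also have "\<dots> \<in> borel_measurable M"
    using assms i by (intro borel_measurable_sum borel_measurable_times)
      (auto simp: vec_measurable_def mat_measurable_def)
  finally show "(\<lambda>z. (A z *\<^sub>v f z) $ i) \<in> borel_measurable M" .
qed

lemma vec_measurable_vnorm:
  assumes "vec_measurable d M f"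
  shows "(\<lambda>z. vnorm (f z)) \<in> borel_measurable M"
proof -
  have "dim_vec (f z) = d" for z using assms by (simp add: vec_measurable_def)
  then have "(\<lambda>z. vnorm (f z)) = (\<lambda>z. sqrt (\<Sum>i<d. (cmod (f z $ i))\<^sup>2))"
    by (simp add: vnorm_L2_set L2_set_def)
  also have "\<dots> \<in> borel_measurable M"
  proof -
    have "(\<lambda>z. \<Sum>i<d. (cmod (f z $ i))\<^sup>2) \<in> borel_measurable M"
      using assms by (intro borel_measurable_sum borel_measurable_power borel_measurable_norm measurable_compose[OF _ borel_measurable_norm])
        (auto simp: vec_measurable_def)
    then show ?thesis by measurable
  qed
  finally show ?thesis .
qed

lemma vec_measurable_compose:
  "vec_measurable d M f \<Longrightarrow> g \<in> N \<rightarrow>\<^sub>M M \<Longrightarrow> vec_measurable d N (\<lambda>z. f (g z))"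
  by (auto simp: vec_measurable_def intro: measurable_compose)

lemma mat_measurable_compose:
  "mat_measurable d M A \<Longrightarrow> g \<in> N \<rightarrow>\<^sub>M M \<Longrightarrow> mat_measurable d N (\<lambda>z. A (g z))"
  by (auto simp: mat_measurable_def intro: measurable_compose)

lemma borel_measurable_if_locally_integrable:
  fixes f :: "'a::euclidean_space \<Rightarrow> complex"
  assumes "\<And>S. compact S \<Longrightarrow> set_integrable lebesgue S f"
  shows "f \<in> borel_measurable lebesgue"
proof (rule borel_measurable_LIMSEQ_metric)
  fix n :: nat
  show "(\<lambda>x. indicator (cball 0 (real n)) x *\<^sub>R f x) \<in> borel_measurable lebesgue"
    using assms[of "cball 0 (real n)"] by (auto simp: set_integrable_def dest: borel_measurable_integrable)
next
  fix x :: 'a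
  obtain N :: nat where "norm x \<le> real N" using real_arch_simple by blast
  then have "eventually (\<lambda>n. indicator (cball 0 (real n)) x *\<^sub>R f x = f x) sequentially"
    by (intro eventually_sequentiallyI[of N]) (auto simp: indicator_def)
  then show "(\<lambda>n. indicator (cball 0 (real n)) x *\<^sub>R f x) \<longlonglongrightarrow> f x"
    by (rule tendsto_eventually)
qed

text \<open>The pointwise inverse of the weight, made total on the exceptional null set so that it is
measurable with values in the \<open>d \<times> d\<close> matrices.\<close>

definition weight_inv :: "nat \<Rightarrow> ('a \<Rightarrow> complex Matrix.mat) \<Rightarrow> 'a \<Rightarrow> complex Matrix.mat" where
  "weight_inv d W z = (if good_mat d (W z) then inv_mat (W z) else 0\<^sub>m d d)"

lemma weight_inv_carrier [simp]: "weight_inv d W z \<in> carrier_mat d d"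
  by (simp add: weight_inv_def good_mat_inverse(2))

lemma matrix_weight_AE_good: "matrix_weight d W \<Longrightarrow> AE z in lebesgue. good_mat d (W z)"
  by (simp add: matrix_weight_def good_mat_def)

lemma good_set_measurable:
  fixes W :: "complex^'n \<Rightarrow> complex Matrix.mat"
  assumes "matrix_weight d W" shows "{z. good_mat d (W z)} \<in> sets lebesgue"
proof (rule completion.in_sets_AE)
  show "AE z in lebesgue. z \<in> UNIV \<longleftrightarrow> z \<in> {z. good_mat d (W z)}"
    using matrix_weight_AE_good[OF assms] by eventually_elim simp
qed auto

lemma matrix_weight_measurable:
  assumes "matrix_weight d W"
  shows "mat_measurable d lebesgue W"
  using assms by (auto simp: matrix_weight_def mat_measurable_def locally_integrable_mat_def
      intro!: borel_measurable_if_locally_integrable)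

lemma weight_inv_measurable:
  fixes W :: "complex^'n \<Rightarrow> complex Matrix.mat"
  assumes W: "matrix_weight d W"
  shows "mat_measurable d lebesgue (weight_inv d W)"
  unfolding mat_measurable_def
proof (intro conjI allI impI)
  fix i j assume ij: "i < d" "j < d"
  have "(\<lambda>z. inv_mat (W z) $$ (i, j)) \<in> borel_measurable lebesgue"
    using W ij by (auto simp: matrix_weight_def locally_integrable_mat_def
      intro!: borel_measurable_if_locally_integrable)
  moreover have "AE z in lebesgue. inv_mat (W z) $$ (i, j) = weight_inv d W z $$ (i, j)"
    using matrix_weight_AE_good[OF W] by eventually_elim (simp add: weight_inv_def)
  ultimately show "(\<lambda>z. weight_inv d W z $$ (i, j)) \<in> borel_measurable lebesgue"
    by (rule borel_measurable_lebesgue_AE_cong)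
qed simp

lemma Lp_norm_zero: "Lp_norm p M (\<lambda>_. 0) = 0"
proof -
  have "esssup M (\<lambda>_. 0::ennreal) \<le> 0" by (rule esssup_I) auto
  then show ?thesis by (simp add: Lp_norm_def)
qed

lemma Lp_norm_indicator_finite:
  assumes p: "1 \<le> p" and A[measurable]: "A \<in> sets M" and fin: "emeasure M A < top"
  shows "Lp_norm p M (indicator A) < top"
proof (cases p)
  case top
  then show ?thesis using Lp_norm_indicator_le_1[OF A] by (auto intro: le_less_trans)
next
  case (real q)
  with p have "1 \<le> q" by (simp flip: ennreal_1)
  then show ?thesis using fin by (simp add: real Lp_norm_real ennpow_indicator less_top[symmetric])
qed

lemma ennreal_divide_le_if_le_mult:
  fixes a b c :: ennreal
  assumes "a \<le> b * c" shows "a / c \<le> b"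
proof -
  consider "c = 0" | "c = top" | r where "c = ennreal r" "0 < r"
    by (cases c) (auto simp: less_le)
  then show ?thesis
  proof cases
    case 1 then show ?thesis using assms by simp
  next
    case 2 then show ?thesis by simp
  next
    case 3
    have "a / c \<le> (b * c) / c" using assms by (rule divide_right_mono_ennreal)
    also have "\<dots> = b" using 3 by (simp add: ennreal_times_divide[symmetric] divide_ennreal)
    finally show ?thesis .
  qed
qed

text \<open>The average \<open>\<rho>\<^sub>p\<^sub>,\<^sub>Q\<close> of the metric \<open>\<bar>W(z) x\<bar>\<close>.\<close>

definition weight_avg :: "ennreal \<Rightarrow> (complex^'n \<Rightarrow> complex Matrix.mat) \<Rightarrow> (complex^'n) set \<Rightarrow> complex Matrix.vec \<Rightarrow> ennreal" where
  "weight_avg p W Q = avg_norm p Q (\<lambda>z x. ennreal (vnorm (W z *\<^sub>v x)))"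

text \<open>The average \<open>\<rho>\<^sup>*\<^sub>p\<^sub>'\<^sub>,\<^sub>Q\<close> of the dual metric, denoted \<open>\<sigma>\<^sub>Q\<close> above; \<open>dual_norm d (weight_avg p W Q)\<close> is \<open>\<tau>\<^sub>Q\<close>.\<close>

definition dual_avg :: "nat \<Rightarrow> ennreal \<Rightarrow> (complex^'n \<Rightarrow> complex Matrix.mat) \<Rightarrow> (complex^'n) set \<Rightarrow> complex Matrix.vec \<Rightarrow> ennreal" where
  "dual_avg d p W Q = avg_norm (conj_exponent p) Q (\<lambda>z. dual_norm d (\<lambda>x. ennreal (vnorm (W z *\<^sub>v x))))"

lemma A_metric_bound_weight_iff:
  "A_metric_bound p r d (\<lambda>z x. ennreal (vnorm (W z *\<^sub>v x))) C \<longleftrightarrow>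
     0 < C \<and> (\<forall>x\<in>carrier_vec d. \<forall>Q\<in>cubes r. dual_avg d p W Q x \<le> ennreal C * dual_norm d (weight_avg p W Q) x)"
  by (simp add: A_metric_bound_def dual_avg_def weight_avg_def)

lemma weight_vnorm_measurable:
  assumes "matrix_weight d W" "x \<in> carrier_vec d"
  shows "(\<lambda>z. ennreal (vnorm (W z *\<^sub>v x))) \<in> borel_measurable lebesgue"
  using vec_measurable_vnorm[OF vec_measurable_mult[OF matrix_weight_measurable[OF assms(1)] vec_measurable_const[OF assms(2)]]]
  by simp

lemma weight_inv_vnorm_measurable:
  assumes "matrix_weight d W" "x \<in> carrier_vec d"
  shows "(\<lambda>z. ennreal (vnorm (weight_inv d W z *\<^sub>v x))) \<in> borel_measurable lebesgue"
  using vec_measurable_vnorm[OF vec_measurable_mult[OF weight_inv_measurable[OF assms(1)] vec_measurable_const[OF assms(2)]]]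
  by simp

lemma dual_norm_weight_AE:
  assumes "matrix_weight d W" "x \<in> carrier_vec d"
  shows "AE z in lebesgue. ennreal (vnorm (weight_inv d W z *\<^sub>v x)) = dual_norm d (\<lambda>x. ennreal (vnorm (W z *\<^sub>v x))) x"
  using matrix_weight_AE_good[OF assms(1)]
  by eventually_elim (simp add: weight_inv_def dual_norm_good_mat assms(2))

lemma weight_avg_eq:
  fixes W :: "complex^'n \<Rightarrow> complex Matrix.mat"
  assumes "1 \<le> p" "Q \<in> cubes r" "0 < r" "matrix_weight d W" "x \<in> carrier_vec d"
  shows "weight_avg p W Q x = ennreal ((r ^ (2 * CARD('n))) powr - exponent_inv p)
     * local_norm p Q (\<lambda>z. ennreal (vnorm (W z *\<^sub>v x)))"
  unfolding weight_avg_def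
  by (rule avg_norm_eq_local_norm[OF assms(1-3)]) (rule weight_vnorm_measurable[OF assms(4,5)])

lemma dual_avg_eq:
  fixes W :: "complex^'n \<Rightarrow> complex Matrix.mat"
  assumes p: "1 \<le> p" and Q: "Q \<in> cubes r" "0 < r" and W: "matrix_weight d W" and x: "x \<in> carrier_vec d"
  shows "dual_avg d p W Q x = ennreal ((r ^ (2 * CARD('n))) powr - exponent_inv (conj_exponent p))
     * local_norm (conj_exponent p) Q (\<lambda>z. ennreal (vnorm (weight_inv d W z *\<^sub>v x)))"
proof -
  let ?D = "\<lambda>z. dual_norm d (\<lambda>x. ennreal (vnorm (W z *\<^sub>v x))) x"
  note m = weight_inv_vnorm_measurable[OF W x]
  note [measurable] = sets_cube[OF Q(1)]
  note AE = dual_norm_weight_AE[OF W x]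
  have D[measurable]: "?D \<in> borel_measurable lebesgue"
    by (rule borel_measurable_lebesgue_AE_cong[OF m AE])
  have "local_norm (conj_exponent p) Q ?D
      = local_norm (conj_exponent p) Q (\<lambda>z. ennreal (vnorm (weight_inv d W z *\<^sub>v x)))"
    unfolding local_norm_def
    using AE m D Q by (intro Lp_norm_cong_AE) auto
  then show ?thesis
    unfolding dual_avg_def
    by (subst avg_norm_eq_local_norm[OF conj_exponent_ge_1[OF p] Q,
        where \<rho> = "\<lambda>z. dual_norm d (\<lambda>x. ennreal (vnorm (W z *\<^sub>v x)))", OF D]) simp
qed

lemma cscalar_weight_le:
  assumes "good_mat d (W z)" "x \<in> carrier_vec d" "y \<in> carrier_vec d"
  shows "cmod (x \<bullet>c y) \<le> vnorm (weight_inv d W z *\<^sub>v x) * vnorm (W z *\<^sub>v y)"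
proof -
  note inv = good_mat_inverse[OF assms(1)]
  have "x \<bullet>c y = (inv_mat (W z) *\<^sub>v x) \<bullet>c (W z *\<^sub>v y)"
    using inv(5)[of x "W z *\<^sub>v y"] inv(4)[of y] assms inv(1) by simp
  then show ?thesis
    using cscalar_Cauchy_Schwarz[of "inv_mat (W z) *\<^sub>v x" d "W z *\<^sub>v y"] inv assms by (simp add: weight_inv_def)
qed

text \<open>Hoelder's inequality for \<open>\<bar>\<langle>x, y\<rangle>\<bar> \<le> \<bar>W\<^sup>-\<^sup>1(z) x\<bar> \<bar>W(z) y\<bar>\<close>, integrated over the overlap only. It is the
source of all comparisons between averages on different cubes.\<close>

lemma local_pairing:
  fixes W :: "complex^'n \<Rightarrow> complex Matrix.mat"
  assumes p: "1 \<le> p" and W: "matrix_weight d W"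
    and Q[measurable]: "Q \<in> sets lebesgue" "Q' \<in> sets lebesgue"
    and x: "x \<in> carrier_vec d" and y: "y \<in> carrier_vec d"
  shows "emeasure lebesgue (Q \<inter> Q') * ennreal (cmod (x \<bullet>c y))
    \<le> local_norm p Q (\<lambda>z. ennreal (vnorm (W z *\<^sub>v y)))
      * local_norm (conj_exponent p) Q' (\<lambda>z. ennreal (vnorm (weight_inv d W z *\<^sub>v x)))"
proof -
  note [measurable] = weight_vnorm_measurable[OF W y] weight_inv_vnorm_measurable[OF W x]
  have "emeasure lebesgue (Q \<inter> Q') * ennreal (cmod (x \<bullet>c y))
     = (\<integral>\<^sup>+ z. ennreal (cmod (x \<bullet>c y)) * indicator (Q \<inter> Q') z \<partial>lebesgue)"
    by (subst nn_integral_cmult_indicator) (auto simp: mult.commute)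
  also have "\<dots> \<le> (\<integral>\<^sup>+ z. (ennreal (vnorm (W z *\<^sub>v y)) * indicator Q z)
       * (ennreal (vnorm (weight_inv d W z *\<^sub>v x)) * indicator Q' z) \<partial>lebesgue)"
    using matrix_weight_AE_good[OF W]
  proof (intro nn_integral_mono_AE, eventually_elim)
    case (elim z)
    show ?case using cscalar_weight_le[where W = W and z = z, OF elim(2) x y]
      by (auto simp: indicator_def mult.commute ennreal_mult[symmetric] ennreal_leI)
  qed
  also have "\<dots> \<le> local_norm p Q (\<lambda>z. ennreal (vnorm (W z *\<^sub>v y)))
      * local_norm (conj_exponent p) Q' (\<lambda>z. ennreal (vnorm (weight_inv d W z *\<^sub>v x)))"
    unfolding local_norm_def by (intro Hoelder_inequality[OF p]) measurable
  finally show ?thesis .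
qed

lemma powr_exponent_inv_conj:
  assumes "1 \<le> p" "0 < V"
  shows "ennreal (V powr - exponent_inv p) * ennreal (V powr - exponent_inv (conj_exponent p)) = ennreal (1 / V)"
proof -
  have "V powr - exponent_inv p * V powr - exponent_inv (conj_exponent p)
      = V powr (- (exponent_inv p + exponent_inv (conj_exponent p)))"
    by (simp add: powr_add[symmetric])
  also have "\<dots> = 1 / V"
    unfolding exponent_inv_conj[OF assms(1)] using assms(2) by (simp add: powr_minus_divide)
  finally show ?thesis by (simp flip: ennreal_mult)
qed

lemma cube_pairing:
  fixes W :: "complex^'n \<Rightarrow> complex Matrix.mat"
  assumes p: "1 \<le> p" and W: "matrix_weight d W" and r: "0 < r"
    and Q: "Q \<in> cubes r" "Q' \<in> cubes r" and \<theta>: "0 < \<theta>"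
    and overlap: "ennreal (\<theta> * r ^ (2 * CARD('n))) \<le> emeasure lebesgue (Q \<inter> Q')"
    and x: "x \<in> carrier_vec d" and y: "y \<in> carrier_vec d"
  shows "ennreal (cmod (x \<bullet>c y)) \<le> ennreal (1 / \<theta>) * dual_avg d p W Q' x * weight_avg p W Q y"
proof -
  define V where "V = r ^ (2 * CARD('n))"
  have V: "0 < V" using r by (simp add: V_def)
  let ?l = "local_norm p Q (\<lambda>z. ennreal (vnorm (W z *\<^sub>v y)))"
  let ?m = "local_norm (conj_exponent p) Q' (\<lambda>z. ennreal (vnorm (weight_inv d W z *\<^sub>v x)))"
  have "ennreal (cmod (x \<bullet>c y)) = ennreal (1 / (\<theta> * V)) * (ennreal (\<theta> * V) * ennreal (cmod (x \<bullet>c y)))"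
    using V \<theta> by (simp add: mult.assoc[symmetric] ennreal_mult[symmetric])
  also have "\<dots> \<le> ennreal (1 / (\<theta> * V)) * (emeasure lebesgue (Q \<inter> Q') * ennreal (cmod (x \<bullet>c y)))"
    using overlap by (intro mult_left_mono mult_right_mono) (auto simp: V_def)
  also have "\<dots> \<le> ennreal (1 / (\<theta> * V)) * (?l * ?m)"
    using Q by (intro mult_left_mono local_pairing[OF p W _ _ x y] sets_cube) auto
  also have "ennreal (1 / (\<theta> * V)) = ennreal (1 / \<theta>) * ennreal (1 / V)"
    using V \<theta> by (simp flip: ennreal_mult)
  also have "ennreal (1 / V) = ennreal (V powr - exponent_inv p) * ennreal (V powr - exponent_inv (conj_exponent p))"
    by (rule powr_exponent_inv_conj[OF p V, symmetric])
  finally show ?thesis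
    by (simp add: weight_avg_eq[OF p Q(1) r W y] dual_avg_eq[OF p Q(2) r W x] V_def mult_ac)
qed

lemma dual_weight_avg_le:
  fixes W :: "complex^'n \<Rightarrow> complex Matrix.mat"
  assumes p: "1 \<le> p" and W: "matrix_weight d W" and r: "0 < r"
    and Q: "Q \<in> cubes r" "Q' \<in> cubes r" and \<theta>: "0 < \<theta>"
    and overlap: "ennreal (\<theta> * r ^ (2 * CARD('n))) \<le> emeasure lebesgue (Q \<inter> Q')"
    and x: "x \<in> carrier_vec d"
  shows "dual_norm d (weight_avg p W Q) x \<le> ennreal (1 / \<theta>) * dual_avg d p W Q' x"
  unfolding dual_norm_def
  by (intro SUP_least ennreal_divide_le_if_le_mult cube_pairing[OF p W r Q \<theta> overlap x]) auto

text \<open>At this point \<open>\<sigma>\<^sub>Q(x)\<close> may still be infinite, so Hoelder's inequality is applied on a set of positive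
measure where \<open>\<bar>W\<^sup>-\<^sup>1 x\<bar>\<close> is bounded. The \<open>\<A>\<^sub>p\<^sub>,\<^sub>r\<close> condition then makes \<open>\<sigma>\<^sub>Q(x)\<close> finite as well.\<close>

lemma dual_weight_avg_finite:
  fixes W :: "complex^'n \<Rightarrow> complex Matrix.mat"
  assumes p: "1 \<le> p" and W: "matrix_weight d W" and r: "0 < r"
    and Q: "Q \<in> cubes r" and x: "x \<in> carrier_vec d"
  shows "dual_norm d (weight_avg p W Q) x < top"
proof -
  define V where "V = r ^ (2 * CARD('n))"
  have V: "0 < V" using r by (simp add: V_def)
  define E where "E m = {z \<in> space lebesgue. z \<in> Q \<and> vnorm (weight_inv d W z *\<^sub>v x) \<le> real m}" for m :: nat
  note [measurable] = sets_cube[OF Q]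
  note [measurable] = vec_measurable_vnorm[OF vec_measurable_mult[OF weight_inv_measurable[OF W] vec_measurable_const[OF x]]]
  have E[measurable]: "E m \<in> sets lebesgue" for m
    unfolding E_def by measurable
  have EQ: "E m \<subseteq> Q" for m by (auto simp: E_def)
  have UE: "(\<Union>m. E m) = Q" using real_arch_simple by (auto simp: E_def)
  have "incseq E" by (auto simp: incseq_def E_def)
  then have "(\<lambda>m. emeasure lebesgue (E m)) \<longlonglongrightarrow> emeasure lebesgue Q"
    using Lim_emeasure_incseq[of E lebesgue] E unfolding UE by (simp add: image_subset_iff del: emeasure_completion)
  moreover have "0 < emeasure lebesgue Q" using emeasure_cube[OF Q r] V by (simp add: V_def)
  ultimately have "eventually (\<lambda>m. 0 < emeasure lebesgue (E m)) sequentially"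
    by (rule order_tendstoD)
  then obtain m where m: "0 < emeasure lebesgue (E m)" by (auto simp: eventually_sequentially)
  have Efin: "emeasure lebesgue (E m) < top"
    using emeasure_mono[OF EQ[of m] sets_cube[OF Q]] emeasure_cube[OF Q r] by (auto intro: le_less_trans)
  obtain e where e: "emeasure lebesgue (E m) = ennreal e" "0 < e"
    using m Efin by (cases "emeasure lebesgue (E m)") auto
  define I where "I = Lp_norm (conj_exponent p) lebesgue (indicator (E m) :: complex^'n \<Rightarrow> ennreal)"
  have I: "I < top"
    unfolding I_def using Efin by (intro Lp_norm_indicator_finite conj_exponent_ge_1 p) auto
  define c where "c = ennreal (1 / e) * (ennreal (real m) * I) * ennreal (V powr exponent_inv p)"
  have "dual_norm d (weight_avg p W Q) x \<le> c"
    unfolding dual_norm_def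
  proof (intro SUP_least ennreal_divide_le_if_le_mult)
    fix y :: "complex Matrix.vec" assume "y \<in> carrier_vec d - {0\<^sub>v d}"
    then have y: "y \<in> carrier_vec d" by simp
    note [measurable] = weight_vnorm_measurable[OF W y]
    let ?l = "local_norm p Q (\<lambda>z. ennreal (vnorm (W z *\<^sub>v y)))"
    have "ennreal e * ennreal (cmod (x \<bullet>c y)) = (\<integral>\<^sup>+ z. ennreal (cmod (x \<bullet>c y)) * indicator (E m) z \<partial>lebesgue)"
      using e by (subst nn_integral_cmult_indicator) (auto simp: mult.commute)
    also have "\<dots> \<le> (\<integral>\<^sup>+ z. (ennreal (vnorm (W z *\<^sub>v y)) * indicator Q z)
         * (ennreal (real m) * indicator (E m) z) \<partial>lebesgue)"
      using matrix_weight_AE_good[OF W]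
    proof (intro nn_integral_mono_AE, eventually_elim)
      case (elim z)
      show ?case
      proof (cases "z \<in> E m")
        case True
        have "cmod (x \<bullet>c y) \<le> vnorm (weight_inv d W z *\<^sub>v x) * vnorm (W z *\<^sub>v y)"
          by (rule cscalar_weight_le[where W = W and z = z, OF elim(2) x y])
        also have "\<dots> \<le> real m * vnorm (W z *\<^sub>v y)"
          using True by (intro mult_right_mono) (auto simp: E_def)
        finally show ?thesis using True EQ[of m]
          by (auto simp: ennreal_mult[symmetric] mult.commute ennreal_leI)
      qed simp
    qed
    also have "\<dots> \<le> ?l * Lp_norm (conj_exponent p) lebesgue (\<lambda>z. ennreal (real m) * indicator (E m) z)"
      unfolding local_norm_def by (intro Hoelder_inequality[OF p]) measurable
    also have "\<dots> \<le> ?l * (ennreal (real m) * I)"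
      unfolding I_def by (intro mult_left_mono Lp_norm_cmult_le conj_exponent_ge_1 p) auto
    finally have *: "ennreal e * ennreal (cmod (x \<bullet>c y)) \<le> ?l * (ennreal (real m) * I)" .
    have "ennreal (cmod (x \<bullet>c y)) = ennreal (1 / e) * (ennreal e * ennreal (cmod (x \<bullet>c y)))"
      using e by (simp add: mult.assoc[symmetric] ennreal_mult[symmetric])
    also have "\<dots> \<le> ennreal (1 / e) * (?l * (ennreal (real m) * I))"
      using * by (intro mult_left_mono) auto
    also have "?l = ennreal (V powr exponent_inv p) * weight_avg p W Q y"
      using V by (simp add: weight_avg_eq[OF p Q r W y] V_def[symmetric] mult.assoc[symmetric]
          ennreal_mult[symmetric] powr_add[symmetric])
    finally show "ennreal (cmod (x \<bullet>c y)) \<le> c * weight_avg p W Q y"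
      by (simp add: c_def mult_ac)
  qed
  also have "c < top" using I by (simp add: c_def ennreal_mult_less_top)
  finally show ?thesis .
qed

lemma weight_avg_smult:
  fixes W :: "complex^'n \<Rightarrow> complex Matrix.mat"
  assumes p: "1 \<le> p" and W: "matrix_weight d W" and r: "0 < r"
    and Q: "Q \<in> cubes r" and x: "x \<in> carrier_vec d"
  shows "weight_avg p W Q (c \<cdot>\<^sub>v x) = ennreal (cmod c) * weight_avg p W Q x"
proof -
  note [measurable] = sets_cube[OF Q] weight_vnorm_measurable[OF W x]
  have Wc: "W z \<in> carrier_mat d d" for z using W by (simp add: matrix_weight_def)
  have "vnorm (W z *\<^sub>v (c \<cdot>\<^sub>v x)) = cmod c * vnorm (W z *\<^sub>v x)" for z
    using mult_mat_vec[OF Wc x] by (simp add: vnorm_smult)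
  then have *: "local_norm p Q (\<lambda>z. ennreal (vnorm (W z *\<^sub>v (c \<cdot>\<^sub>v x))))
    = Lp_norm p lebesgue (\<lambda>z. ennreal (cmod c) * (ennreal (vnorm (W z *\<^sub>v x)) * indicator Q z))"
    by (simp add: local_norm_def ennreal_mult mult.assoc)
  have main: "weight_avg p W Q (c \<cdot>\<^sub>v x) = ennreal ((r ^ (2 * CARD('n))) powr - exponent_inv p)
     * Lp_norm p lebesgue (\<lambda>z. ennreal (cmod c) * (ennreal (vnorm (W z *\<^sub>v x)) * indicator Q z))"
    using x by (simp add: weight_avg_eq[OF p Q r W] *)
  show ?thesis
  proof (cases "c = 0")
    case True
    then show ?thesis unfolding main by (simp add: Lp_norm_zero)
  next
    case False
    then show ?thesis unfolding main using x
      by (simp add: weight_avg_eq[OF p Q r W] Lp_norm_cmult[OF p] local_norm_def mult_ac)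
  qed
qed

section \<open>Consequences of the \<open>\<A>\<^sub>p\<^sub>,\<^sub>r\<close> condition\<close>

lemma A_weight_bound_dual_avg:
  assumes "A_metric_bound p r d (\<lambda>z x. ennreal (vnorm (W z *\<^sub>v x))) C"
    and "Q \<in> cubes r" "x \<in> carrier_vec d"
  shows "dual_avg d p W Q x \<le> ennreal C * dual_norm d (weight_avg p W Q) x"
  using assms by (auto simp: A_metric_bound_weight_iff)

lemma dual_avg_finite:
  assumes "1 \<le> p" "matrix_weight d W" "0 < r"
    and "A_metric_bound p r d (\<lambda>z x. ennreal (vnorm (W z *\<^sub>v x))) C"
    and "Q \<in> cubes r" "x \<in> carrier_vec d"
  shows "dual_avg d p W Q x < top"
  using A_weight_bound_dual_avg[OF assms(4-6)] dual_weight_avg_finite[OF assms(1-3,5,6)]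
  by (auto intro: le_less_trans simp: ennreal_mult_less_top)

lemma cube_pairing_same:
  fixes W :: "complex^'n \<Rightarrow> complex Matrix.mat"
  assumes p: "1 \<le> p" and W: "matrix_weight d W" and r: "0 < r" and Q: "Q \<in> cubes r"
    and x: "x \<in> carrier_vec d" and y: "y \<in> carrier_vec d"
  shows "ennreal (cmod (x \<bullet>c y)) \<le> dual_avg d p W Q x * weight_avg p W Q y"
  using cube_pairing[where \<theta> = 1, OF p W r Q Q _ _ x y] emeasure_cube[OF Q r] by simp

lemma dual_avg_nonzero:
  fixes W :: "complex^'n \<Rightarrow> complex Matrix.mat"
  assumes p: "1 \<le> p" and W: "matrix_weight d W" and r: "0 < r" and Q: "Q \<in> cubes r"
    and x: "x \<in> carrier_vec d" "x \<noteq> 0\<^sub>v d"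
  shows "dual_avg d p W Q x \<noteq> 0"
proof -
  have "0 < cmod (x \<bullet>c x)" using x by simp
  moreover have "ennreal (cmod (x \<bullet>c x)) \<le> dual_avg d p W Q x * weight_avg p W Q x"
    by (rule cube_pairing_same[OF p W r Q x(1) x(1)])
  ultimately show ?thesis by auto
qed

text \<open>Because \<open>\<tau>\<^sub>Q \<le> \<sigma>\<^sub>Q \<le> C \<tau>\<^sub>Q\<close>, with \<open>\<sigma>\<^sub>Q(x)\<close> positive and finite for \<open>x \<noteq> 0\<close>.\<close>

lemma A_metric_bound_ge_1:
  fixes W :: "complex^'n \<Rightarrow> complex Matrix.mat"
  assumes p: "1 \<le> p" and d: "1 \<le> d" and W: "matrix_weight d W" and r: "0 < r"
    and A: "A_metric_bound p r d (\<lambda>z x. ennreal (vnorm (W z *\<^sub>v x))) C"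
  shows "1 \<le> C"
proof -
  define Q :: "(complex^'n) set" where "Q = cbox 0 (0 + r *\<^sub>R (\<Sum>b\<in>Basis. b))"
  have Q: "Q \<in> cubes r" unfolding Q_def cubes_def by blast
  define x where "x = (unit_vec d 0 :: complex Matrix.vec)"
  have x: "x \<in> carrier_vec d" "x \<noteq> 0\<^sub>v d"
    using d by (auto simp: x_def vec_eq_iff dest!: arg_cong[of _ _ "\<lambda>v. v $ 0"])
  let ?s = "dual_avg d p W Q x" and ?t = "dual_norm d (weight_avg p W Q) x"
  have "?s \<le> ennreal C * ?t" by (rule A_weight_bound_dual_avg[OF A Q x(1)])
  also have "?t \<le> ?s"
    using dual_weight_avg_le[where \<theta> = 1, OF p W r Q Q _ _ x(1)] emeasure_cube[OF Q r] by simp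
  then have "ennreal C * ?t \<le> ennreal C * ?s" by (intro mult_left_mono) auto
  finally have le: "?s \<le> ennreal C * ?s" .
  obtain s where s: "?s = ennreal s" "0 < s"
    using dual_avg_nonzero[OF p W r Q x] dual_avg_finite[OF p W r A Q x(1)]
    by (cases ?s) (auto simp: less_le)
  have "0 < C" using A by (simp add: A_metric_bound_def)
  then have "s \<le> C * s" using le s by (simp add: ennreal_mult[symmetric])
  then show ?thesis using s by simp
qed

text \<open>Since \<open>\<tau>\<^sub>Q\<close> is finite, the inequality \<open>\<sigma>\<^sub>Q \<le> C \<tau>\<^sub>Q\<close> passes to the infimum over \<open>C\<close>.\<close>

lemma A_weight_const_bound:
  fixes W :: "complex^'n \<Rightarrow> complex Matrix.mat"
  assumes p: "1 \<le> p" and d: "1 \<le> d" and W: "matrix_weight d W" and r: "0 < r"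
    and A: "A_weight p r d W"
  shows "A_metric_bound p r d (\<lambda>z x. ennreal (vnorm (W z *\<^sub>v x))) (A_weight_const p r d W)"
    and "1 \<le> A_weight_const p r d W"
proof -
  define B where "B = {C. A_metric_bound p r d (\<lambda>z x. ennreal (vnorm (W z *\<^sub>v x))) C}"
  have c: "A_weight_const p r d W = Inf B"
    by (simp add: A_weight_const_def A_metric_const_def B_def)
  have ne: "B \<noteq> {}" using A by (auto simp: A_weight_def A_metric_def B_def)
  have ge1: "1 \<le> C" if "C \<in> B" for C
    using that A_metric_bound_ge_1[OF p d W r] by (simp add: B_def)
  show 1: "1 \<le> A_weight_const p r d W" unfolding c using ne ge1 by (intro cInf_greatest)
  show "A_metric_bound p r d (\<lambda>z x. ennreal (vnorm (W z *\<^sub>v x))) (A_weight_const p r d W)"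
    unfolding A_metric_bound_weight_iff
  proof (intro conjI ballI)
    show "0 < A_weight_const p r d W" using 1 by simp
    fix x :: "complex Matrix.vec" and Q :: "(complex^'n) set" assume x: "x \<in> carrier_vec d" and Q: "Q \<in> cubes r"
    obtain t where t: "dual_norm d (weight_avg p W Q) x = ennreal t" "0 \<le> t"
      using dual_weight_avg_finite[OF p W r Q x] by (cases "dual_norm d (weight_avg p W Q) x") auto
    have le: "dual_avg d p W Q x \<le> ennreal (C * t)" if "C \<in> B" for C
      using A_weight_bound_dual_avg[of p r d W C, OF _ Q x] that ge1[OF that] t by (simp add: B_def ennreal_mult)
    obtain s where s: "dual_avg d p W Q x = ennreal s" "0 \<le> s"
      using ne le by (cases "dual_avg d p W Q x") (auto simp: top_unique)
    have le': "s \<le> C * t" if "C \<in> B" for C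
      using le[OF that] s ge1[OF that] t by (simp add: ennreal_le_iff)
    have "s \<le> Inf B * t"
    proof (cases "t = 0")
      case True
      then show ?thesis using le' ne by auto
    next
      case False
      then have "0 < t" using t by simp
      then have "s / t \<le> Inf B" using ne le' by (intro cInf_greatest) (auto simp: divide_le_eq)
      then show ?thesis using \<open>0 < t\<close> by (simp add: divide_le_eq)
    qed
    then show "dual_avg d p W Q x \<le> ennreal (A_weight_const p r d W) * dual_norm d (weight_avg p W Q) x"
      using s t 1 unfolding c by (simp add: ennreal_mult[symmetric] ennreal_leI)
  qed
qed

lemma cscalar_conjugate_row:
  fixes y :: "complex Matrix.vec"
  assumes F: "F \<in> carrier_mat d d" and y: "y \<in> carrier_vec d" and i: "i < d"
  shows "y \<bullet>c conjugate (Matrix.row F i) = (F *\<^sub>v y) $ i"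
  using assms comm_scalar_prod[of y d "Matrix.row F i"] by simp

text \<open>An almost Auerbach basis for \<open>\<rho>\<^sub>p\<^sub>,\<^sub>Q\<close>: the coordinate functionals satisfy \<open>\<tau>\<^sub>Q \<le> 2\<close>, hence
\<open>\<sigma>\<^sub>Q \<le> 2 C\<close>. The vectors where \<open>\<rho>\<^sub>p\<^sub>,\<^sub>Q\<close> is finite separate points because \<open>\<tau>\<^sub>Q\<close> does not vanish.\<close>

lemma A_weight_adapted_basis:
  fixes W :: "complex^'n \<Rightarrow> complex Matrix.mat"
  assumes p: "1 \<le> p" and W: "matrix_weight d W" and r: "0 < r"
    and A: "A_metric_bound p r d (\<lambda>z x. ennreal (vnorm (W z *\<^sub>v x))) C"
    and Q: "Q \<in> cubes r"
  shows "\<exists>E F. E \<in> carrier_mat d d \<and> F \<in> carrier_mat d d \<and> E * F = 1\<^sub>m d \<and>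
    (\<forall>i<d. weight_avg p W Q (col E i) \<le> 1) \<and>
    (\<forall>i<d. dual_avg d p W Q (conjugate (Matrix.row F i)) \<le> ennreal (2 * C))"
proof -
  define K where "K = (\<Sum>i<d. enn2real (dual_avg d p W Q (unit_vec d i)))"
  have C: "0 < C" using A by (simp add: A_metric_bound_def)
  obtain E F where EF: "E \<in> carrier_mat d d" "F \<in> carrier_mat d d" "E * F = 1\<^sub>m d" "F * E = 1\<^sub>m d"
    "\<And>i. i < d \<Longrightarrow> weight_avg p W Q (col E i) \<le> 1"
    "\<And>y i. y \<in> carrier_vec d \<Longrightarrow> i < d \<Longrightarrow> ennreal (cmod ((F *\<^sub>v y) $ i)) \<le> 2 * weight_avg p W Q y"
  proof (rule near_Auerbach_basis[of d "weight_avg p W Q" K])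
    show "0 \<le> K" by (auto simp: K_def intro: sum_nonneg)
    show "weight_avg p W Q (c \<cdot>\<^sub>v x) = ennreal (cmod c) * weight_avg p W Q x" if "x \<in> carrier_vec d" for x c
      by (rule weight_avg_smult[OF p W r Q that])
    fix x :: "complex Matrix.vec" assume x: "x \<in> carrier_vec d"
    show "ennreal (cmod (x $ i)) \<le> ennreal K * weight_avg p W Q x" if i: "i < d" for i
    proof -
      have "cmod (unit_vec d i \<bullet>c x) = cmod (x $ i)"
        using x i by (simp add: scalar_prod_left_unit)
      then have "ennreal (cmod (x $ i)) \<le> dual_avg d p W Q (unit_vec d i) * weight_avg p W Q x"
        using cube_pairing_same[OF p W r Q unit_vec_carrier[where n = d and i = i and 'a = complex] x] by simp
      also have "dual_avg d p W Q (unit_vec d i) = ennreal (enn2real (dual_avg d p W Q (unit_vec d i)))"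
        using dual_avg_finite[OF p W r A Q unit_vec_carrier[where n = d and i = i and 'a = complex]] by simp
      also have "\<dots> * weight_avg p W Q x \<le> ennreal K * weight_avg p W Q x"
        unfolding K_def using i by (intro mult_right_mono ennreal_leI member_le_sum) auto
      finally show ?thesis .
    qed
    assume "x \<noteq> 0\<^sub>v d"
    with x have "dual_norm d (weight_avg p W Q) x \<noteq> 0"
      using A_weight_bound_dual_avg[OF A Q x] dual_avg_nonzero[OF p W r Q x] by auto
    then obtain y where y: "y \<in> carrier_vec d" "ennreal (cmod (x \<bullet>c y)) / weight_avg p W Q y \<noteq> 0"
      unfolding dual_norm_def by (auto simp: SUP_eq_const bot_ennreal[symmetric] SUP_bot_conv simp del: bot_ennreal)
    then have "x \<bullet>c y \<noteq> 0" "weight_avg p W Q y < top"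
      by (auto simp: less_top)
    moreover have "y \<bullet>c x \<noteq> 0"
      using cscalar_commute[OF x y(1)] \<open>x \<bullet>c y \<noteq> 0\<close> by (metis complex_cnj_zero_iff)
    ultimately show "\<exists>y\<in>carrier_vec d. y \<bullet>c x \<noteq> 0 \<and> weight_avg p W Q y < top"
      using y(1) by blast
  qed auto
  have "dual_avg d p W Q (conjugate (Matrix.row F i)) \<le> ennreal (2 * C)" if i: "i < d" for i
  proof -
    let ?e = "conjugate (Matrix.row F i)"
    have e: "?e \<in> carrier_vec d" using EF(2) by auto
    have "dual_norm d (weight_avg p W Q) ?e \<le> 2"
      unfolding dual_norm_def
    proof (intro SUP_least ennreal_divide_le_if_le_mult)
      fix y :: "complex Matrix.vec" assume "y \<in> carrier_vec d - {0\<^sub>v d}"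
      then have y: "y \<in> carrier_vec d" by simp
      have "cmod (?e \<bullet>c y) = cmod ((F *\<^sub>v y) $ i)"
        using cscalar_commute[OF e y] cscalar_conjugate_row[OF EF(2) y i] by (metis complex_mod_cnj)
      then show "ennreal (cmod (?e \<bullet>c y)) \<le> 2 * weight_avg p W Q y"
        using EF(6)[OF y i] by simp
    qed
    then have "ennreal C * dual_norm d (weight_avg p W Q) ?e \<le> ennreal C * 2"
      by (intro mult_left_mono) auto
    with A_weight_bound_dual_avg[OF A Q e] have "dual_avg d p W Q ?e \<le> ennreal C * 2"
      by (rule order_trans)
    also have "ennreal C * 2 = ennreal (2 * C)" using C by (simp add: ennreal_mult mult.commute)
    finally show ?thesis .
  qed
  with EF show ?thesis by blast
qed

definition cube :: "real \<Rightarrow> complex^'n \<Rightarrow> (complex^'n) set" where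
  "cube r a = cbox a (a + r *\<^sub>R (\<Sum>b\<in>Basis. b))"

lemma cube_in_cubes [simp]: "cube r a \<in> cubes r"
  by (auto simp: cube_def cubes_def)

lemma cube_measurable [measurable]: "cube r a \<in> sets lebesgue"
  by (rule sets_cube[OF cube_in_cubes])

lemma mem_cube_iff: "z \<in> cube r a \<longleftrightarrow> (\<forall>b\<in>Basis. a \<bullet> b \<le> z \<bullet> b \<and> z \<bullet> b \<le> a \<bullet> b + r)"
  by (simp add: cube_def mem_box inner_add_left inner_sum_Basis)

text \<open>In each of the \<open>2 n\<close> real directions the two cubes overlap in an interval of length at least \<open>r / 2\<close>.\<close>

lemma emeasure_cube_Int_ge:
  fixes a b :: "complex^'n"
  assumes r: "0 < r" and ab: "norm (a - b) \<le> r / 2"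
  shows "ennreal ((1 / 4) ^ CARD('n) * r ^ (2 * CARD('n))) \<le> emeasure lebesgue (cube r a \<inter> cube r b)"
proof -
  let ?l = "\<Sum>i\<in>Basis. max (a \<bullet> i) (b \<bullet> i) *\<^sub>R i"
  let ?u = "?l + (r / 2) *\<^sub>R (\<Sum>b\<in>Basis. b)"
  have l: "?l \<bullet> i = max (a \<bullet> i) (b \<bullet> i)" if "i \<in> Basis" for i using that by simp
  have diff: "\<bar>a \<bullet> i - b \<bullet> i\<bar> \<le> r / 2" if "i \<in> Basis" for i
    using Basis_le_norm[OF that, of "a - b"] ab by (simp add: inner_diff_left)
  have sub: "cbox ?l ?u \<subseteq> cube r a \<inter> cube r b"
  proof
    fix z assume "z \<in> cbox ?l ?u"
    then have z: "max (a \<bullet> i) (b \<bullet> i) \<le> z \<bullet> i \<and> z \<bullet> i \<le> max (a \<bullet> i) (b \<bullet> i) + r / 2" if "i \<in> Basis" for i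
      using that by (auto simp: mem_box l inner_add_left inner_sum_Basis)
    show "z \<in> cube r a \<inter> cube r b"
      unfolding Int_iff mem_cube_iff using z diff by (smt (verit, best) field_sum_of_halves)
  qed
  have "emeasure lborel (cbox ?l ?u) = ennreal (\<Prod>i\<in>(Basis :: (complex^'n) set). r / 2)"
    using r by (subst emeasure_lborel_cbox) (auto simp: inner_add_left inner_sum_Basis)
  also have "(\<Prod>i\<in>(Basis :: (complex^'n) set). r / 2) = (1 / 4) ^ CARD('n) * r ^ (2 * CARD('n))"
  proof -
    have "(\<Prod>i\<in>(Basis :: (complex^'n) set). r / 2) = (r / 2) ^ (2 * CARD('n))"
      by (simp add: mult.commute)
    also have "\<dots> = (1 / 4) ^ CARD('n) * r ^ (2 * CARD('n))"
      by (simp add: power_mult power_divide power_mult_distrib[symmetric])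
    finally show ?thesis .
  qed
  finally have "ennreal ((1 / 4) ^ CARD('n) * r ^ (2 * CARD('n))) = emeasure lebesgue (cbox ?l ?u)" by simp
  also have "\<dots> \<le> emeasure lebesgue (cube r a \<inter> cube r b)"
    using sub by (rule emeasure_mono) (rule sets.Int[OF sets_cube[OF cube_in_cubes] sets_cube[OF cube_in_cubes]])
  finally show ?thesis .
qed

text \<open>The cubes at \<open>a + (j / k) v\<close> for \<open>j \<le> k\<close> form a chain in which neighbours overlap in a fixed proportion.
Each link costs \<open>\<sigma>\<^sub>Q \<le> C \<tau>\<^sub>Q \<le> 4\<^sup>n C \<sigma>\<^sub>Q'\<close>.\<close>

lemma dual_avg_shift_chain:
  fixes W :: "complex^'n \<Rightarrow> complex Matrix.mat"
  assumes p: "1 \<le> p" and W: "matrix_weight d W" and r: "0 < r"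
    and A: "A_metric_bound p r d (\<lambda>z x. ennreal (vnorm (W z *\<^sub>v x))) C"
    and x: "x \<in> carrier_vec d"
  shows "norm v \<le> real k * r / 2 \<Longrightarrow>
    dual_avg d p W (cube r (a + v)) x \<le> ennreal ((4 ^ CARD('n) * C) ^ k) * dual_avg d p W (cube r a) x"
proof (induction k arbitrary: v)
  case 0
  then show ?case by simp
next
  case (Suc k)
  have C: "0 < C" using A by (simp add: A_metric_bound_def)
  define w where "w = (real k / real (Suc k)) *\<^sub>R v"
  have "norm w = real k / real (Suc k) * norm v" by (simp add: w_def)
  also have "\<dots> \<le> real k / real (Suc k) * (real (Suc k) * r / 2)"
    using Suc.prems by (intro mult_left_mono) auto
  also have "\<dots> = real k * r / 2" by simp
  finally have w: "norm w \<le> real k * r / 2" .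
  have "v - w = (1 / real (Suc k)) *\<^sub>R v"
    by (simp add: w_def scaleR_left_diff_distrib[symmetric, of 1, simplified] field_simps)
  then have "norm (v - w) = norm v / real (Suc k)" by simp
  also have "\<dots> \<le> r / 2" using Suc.prems by (simp add: field_simps)
  finally have vw: "norm ((a + v) - (a + w)) \<le> r / 2" by simp
  have "dual_avg d p W (cube r (a + v)) x \<le> ennreal C * dual_norm d (weight_avg p W (cube r (a + v))) x"
    by (rule A_weight_bound_dual_avg[OF A _ x]) simp
  also have "\<dots> \<le> ennreal C * (ennreal (1 / (1 / 4) ^ CARD('n)) * dual_avg d p W (cube r (a + w)) x)"
    using emeasure_cube_Int_ge[OF r vw] by (intro mult_left_mono dual_weight_avg_le[OF p W r _ _ _ _ x]) auto
  also have "\<dots> = ennreal (4 ^ CARD('n) * C) * dual_avg d p W (cube r (a + w)) x"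
    using C by (simp add: ennreal_mult mult_ac power_one_over)
  also have "\<dots> \<le> ennreal (4 ^ CARD('n) * C) * (ennreal ((4 ^ CARD('n) * C) ^ k) * dual_avg d p W (cube r a) x)"
    by (intro mult_left_mono Suc.IH w) auto
  also have "\<dots> = ennreal ((4 ^ CARD('n) * C) ^ Suc k) * dual_avg d p W (cube r a) x"
    using C by (simp add: ennreal_mult[symmetric] mult.assoc[symmetric])
  finally show ?case .
qed

lemma vnorm_mult_mat_le_cols:
  assumes A: "A \<in> carrier_mat d d" and w: "w \<in> carrier_vec d"
  shows "vnorm (A *\<^sub>v w) \<le> (\<Sum>j<d. cmod (w $ j) * vnorm (col A j))"
proof -
  have "A *\<^sub>v w = Matrix.vec d (\<lambda>i. \<Sum>j<d. w $ j * col A j $ i)"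
    using A w by (intro eq_vecI) (auto simp: mult_mat_vec_index mult.commute simp del: index_mult_mat_vec)
  then show ?thesis
    using vnorm_lincomb_le[of "{..<d}" "col A" d "\<lambda>j. w $ j"] A by (simp add: carrier_vecI)
qed

lemma vnorm_mult_mat_le_entries:
  assumes A: "A \<in> carrier_mat d d" and v: "v \<in> carrier_vec d"
  shows "vnorm (A *\<^sub>v v) \<le> (\<Sum>i<d. \<Sum>j<d. cmod (A $$ (i, j))) * vnorm v"
proof -
  have "vnorm (A *\<^sub>v v) \<le> (\<Sum>i<d. cmod ((A *\<^sub>v v) $ i))" using A v by (intro vnorm_le_sum) auto
  also have "\<dots> \<le> (\<Sum>i<d. \<Sum>j<d. cmod (A $$ (i, j)) * vnorm v)"
  proof (rule sum_mono)
    fix i assume "i \<in> {..<d}"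
    then have "cmod ((A *\<^sub>v v) $ i) = cmod (\<Sum>j<d. A $$ (i, j) * v $ j)"
      using mult_mat_vec_index[OF A v] by simp
    also have "\<dots> \<le> (\<Sum>j<d. cmod (A $$ (i, j)) * vnorm v)"
      using v by (intro order.trans[OF norm_sum] sum_mono) (auto simp: norm_mult intro!: mult_left_mono cmod_index_le_vnorm)
    finally show "cmod ((A *\<^sub>v v) $ i) \<le> (\<Sum>j<d. cmod (A $$ (i, j)) * vnorm v)" .
  qed
  finally show ?thesis by (simp add: sum_distrib_right)
qed

text \<open>Inserting \<open>1 = \<Sum>\<^sub>i e\<^sub>i e\<^sub>i\<^sup>*\<close> between \<open>W(z)\<close> and \<open>W\<^sup>-\<^sup>1(u)\<close>; the columns of \<open>E\<close> are the \<open>e\<^sub>i\<close>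
and the conjugated rows of \<open>F\<close> are the \<open>e\<^sub>i\<^sup>*\<close>. The Hermitian matrix \<open>W\<^sup>-\<^sup>1(u)\<close> is moved onto \<open>e\<^sub>i\<^sup>*\<close>.\<close>

lemma vnorm_weight_mult_inv_le:
  assumes Wz: "W z \<in> carrier_mat d d" and u: "good_mat d (W u)" and f: "f \<in> carrier_vec d"
    and E: "E \<in> carrier_mat d d" and F: "F \<in> carrier_mat d d" and EF: "E * F = 1\<^sub>m d"
  shows "vnorm (W z *\<^sub>v (inv_mat (W u) *\<^sub>v f))
    \<le> (\<Sum>i<d. vnorm (W z *\<^sub>v col E i) * vnorm (weight_inv d W u *\<^sub>v conjugate (Matrix.row F i)) * vnorm f)"
proof -
  note inv = good_mat_inverse[OF u]
  define v where "v = inv_mat (W u) *\<^sub>v f"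
  have v: "v \<in> carrier_vec d" using inv f by (simp add: v_def)
  have ve: "v = E *\<^sub>v (F *\<^sub>v v)" using assoc_mult_mat_vec[OF E F v] EF v by simp
  have Fv: "F *\<^sub>v v \<in> carrier_vec d" using F v by simp
  have Wv: "W z *\<^sub>v v = (W z * E) *\<^sub>v (F *\<^sub>v v)"
    using assoc_mult_mat_vec[OF Wz E Fv] ve by simp
  have "vnorm (W z *\<^sub>v v) \<le> (\<Sum>i<d. cmod ((F *\<^sub>v v) $ i) * vnorm (col (W z * E) i))"
    unfolding Wv using Wz E Fv by (intro vnorm_mult_mat_le_cols) auto
  also have "\<dots> \<le> (\<Sum>i<d. vnorm (W z *\<^sub>v col E i) * vnorm (weight_inv d W u *\<^sub>v conjugate (Matrix.row F i)) * vnorm f)"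
  proof (rule sum_mono)
    fix i assume "i \<in> {..<d}"
    then have i: "i < d" by simp
    let ?e = "conjugate (Matrix.row F i)"
    have e: "?e \<in> carrier_vec d" using F by auto
    have "(F *\<^sub>v v) $ i = v \<bullet>c ?e" by (rule cscalar_conjugate_row[OF F v i, symmetric])
    also have "\<dots> = f \<bullet>c (inv_mat (W u) *\<^sub>v ?e)" unfolding v_def by (rule inv(5)[OF f e])
    finally have "cmod ((F *\<^sub>v v) $ i) \<le> vnorm f * vnorm (inv_mat (W u) *\<^sub>v ?e)"
      using cscalar_Cauchy_Schwarz[OF f, of "inv_mat (W u) *\<^sub>v ?e"] inv(2) e by simp
    moreover have "col (W z * E) i = W z *\<^sub>v col E i" using Wz E i by (rule col_mult2)
    ultimately show "cmod ((F *\<^sub>v v) $ i) * vnorm (col (W z * E) i)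
      \<le> vnorm (W z *\<^sub>v col E i) * vnorm (weight_inv d W u *\<^sub>v ?e) * vnorm f"
      using u mult_right_mono[of "cmod ((F *\<^sub>v v) $ i)" "vnorm f * vnorm (inv_mat (W u) *\<^sub>v ?e)" "vnorm (W z *\<^sub>v col E i)"]
      by (simp add: weight_inv_def mult_ac)
  qed
  finally show ?thesis by (simp add: v_def)
qed

section \<open>A grid of cubes\<close>

definition cube_lattice :: "real \<Rightarrow> (complex^'n) set" where
  "cube_lattice r = {x. \<forall>b\<in>Basis. (x \<bullet> b) / r \<in> \<int>}"

text \<open>The lower corner of the half-open grid cube that contains \<open>z\<close>.\<close>

definition cell :: "real \<Rightarrow> complex^'n \<Rightarrow> complex^'n" where
  "cell r z = (\<Sum>b\<in>Basis. (r * of_int \<lfloor>(z \<bullet> b) / r\<rfloor>) *\<^sub>R b)"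

lemma cell_inner: "b \<in> Basis \<Longrightarrow> cell r z \<bullet> b = r * of_int \<lfloor>(z \<bullet> b) / r\<rfloor>"
  by (simp add: cell_def)

lemma cell_in_lattice: "0 < r \<Longrightarrow> cell r z \<in> cube_lattice r"
  by (simp add: cube_lattice_def cell_inner)

lemma cell_bounds:
  assumes "0 < r" "b \<in> Basis"
  shows "cell r z \<bullet> b \<le> z \<bullet> b" "z \<bullet> b < cell r z \<bullet> b + r"
proof -
  have "r * of_int \<lfloor>(z \<bullet> b) / r\<rfloor> \<le> r * ((z \<bullet> b) / r)"
    using assms by (intro mult_left_mono) auto
  then show "cell r z \<bullet> b \<le> z \<bullet> b" using assms by (simp add: cell_inner)
  have "r * ((z \<bullet> b) / r) < r * (of_int \<lfloor>(z \<bullet> b) / r\<rfloor> + 1)"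
    using assms by (intro mult_strict_left_mono) auto
  then show "z \<bullet> b < cell r z \<bullet> b + r" using assms by (simp add: cell_inner algebra_simps)
qed

lemma mem_cube_cell: "0 < r \<Longrightarrow> z \<in> cube r (cell r z)"
  using cell_bounds[of r] by (fastforce simp: mem_cube_iff intro: less_imp_le)

lemma norm_diff_cell_le:
  fixes z :: "complex^'n"
  assumes "0 < r" shows "norm (z - cell r z) \<le> r * (2 * CARD('n))"
proof -
  have "norm (z - cell r z) \<le> (\<Sum>b\<in>Basis. \<bar>(z - cell r z) \<bullet> b\<bar>)" by (rule norm_le_l1)
  also have "\<dots> \<le> (\<Sum>b\<in>(Basis :: (complex^'n) set). r)"
  proof (rule sum_mono)
    fix b :: "complex^'n" assume "b \<in> Basis"
    from cell_bounds[OF assms this, of z] show "\<bar>(z - cell r z) \<bullet> b\<bar> \<le> r"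
      by (simp add: inner_diff_left abs_le_iff)
  qed
  finally show ?thesis by (simp add: mult_ac)
qed

lemma countable_lattice: "countable (cube_lattice r :: (complex^'n) set)" if "r \<noteq> 0"
proof (rule countable_image_inj_on)
  let ?f = "\<lambda>x. \<lambda>b\<in>(Basis :: (complex^'n) set). (x \<bullet> b) / r"
  have "?f ` cube_lattice r \<subseteq> PiE Basis (\<lambda>_. \<int>)" by (auto simp: cube_lattice_def)
  moreover have "countable (PiE (Basis :: (complex^'n) set) (\<lambda>_. \<int> :: real set))"
    by (intro countable_PiE) (auto simp: Ints_def)
  ultimately show "countable (?f ` cube_lattice r)" by (rule countable_subset)
  show "inj_on ?f (cube_lattice r)"
  proof (rule inj_onI)
    fix x y :: "complex^'n" assume eq: "?f x = ?f y"
    show "x = y"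
    proof (rule euclidean_eqI)
      fix b :: "complex^'n" assume "b \<in> Basis"
      with fun_cong[OF eq, of b] that show "x \<bullet> b = y \<bullet> b" by simp
    qed
  qed
qed

lemma lattice_add: "x \<in> cube_lattice r \<Longrightarrow> y \<in> cube_lattice r \<Longrightarrow> x + y \<in> cube_lattice r"
  by (auto simp: cube_lattice_def inner_add_left add_divide_distrib)

lemma lattice_diff: "x \<in> cube_lattice r \<Longrightarrow> y \<in> cube_lattice r \<Longrightarrow> x - y \<in> cube_lattice r"
  by (auto simp: cube_lattice_def inner_diff_left diff_divide_distrib)

lemma lattice_shift_bij: "x \<in> cube_lattice r \<Longrightarrow> bij_betw (\<lambda>k. x + k) (cube_lattice r) (cube_lattice r)"
  by (rule bij_betw_byWitness[where f' = "\<lambda>k. k - x"])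
     (auto intro: lattice_add lattice_diff)

definition cell_set :: "real \<Rightarrow> complex^'n \<Rightarrow> (complex^'n) set" where
  "cell_set r \<nu> = {z. cell r z = \<nu>}"

lemma cell_set_measurable [measurable]: "cell_set r \<nu> \<in> sets lebesgue"
proof -
  have "cell_set r \<nu> = {z. \<forall>b\<in>Basis. cell r z \<bullet> b = \<nu> \<bullet> b}"
    by (auto simp: cell_set_def intro: euclidean_eqI)
  also have "\<dots> = {z \<in> space borel. \<forall>b\<in>Basis. r * of_int \<lfloor>(z \<bullet> b) / r\<rfloor> = \<nu> \<bullet> b}"
    by (auto simp: cell_inner)
  also have "\<dots> \<in> sets borel" by measurable
  finally show ?thesis by simp
qed

lemma cell_set_subset_cube: "0 < r \<Longrightarrow> cell_set r \<nu> \<subseteq> cube r \<nu>"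
  using mem_cube_cell by (auto simp: cell_set_def)

lemma measurable_by_cells:
  fixes f :: "complex^'n \<Rightarrow> complex^'n \<Rightarrow> ennreal"
  assumes r: "0 < r" and f: "\<And>\<nu>. \<nu> \<in> cube_lattice r \<Longrightarrow> f \<nu> \<in> borel_measurable lebesgue"
  shows "(\<lambda>z. f (cell r z) z) \<in> borel_measurable lebesgue"
proof (rule measurable_compose_countable'[where I = "cube_lattice r" and g = "cell r"])
  show "f \<nu> \<in> borel_measurable lebesgue" if "\<nu> \<in> cube_lattice r" for \<nu> by (rule f[OF that])
  show "countable (cube_lattice r :: (complex^'n) set)" using r by (intro countable_lattice) simp
  show "cell r \<in> (lebesgue :: (complex^'n) measure) \<rightarrow>\<^sub>M count_space (cube_lattice r)"
  proof -
    have cl: "countable (cube_lattice r :: (complex^'n) set)" using r by (intro countable_lattice) simp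
    have "cell r -` {a} \<inter> space lebesgue \<in> sets lebesgue" for a :: "complex^'n"
      using cell_set_measurable[of r a] by (simp add: cell_set_def vimage_def)
    then show ?thesis
      using cell_in_lattice[OF r] by (intro iffD2[OF measurable_count_space_eq_countable[OF cl]]) auto
  qed
qed

lemma nn_integral_by_cells:
  fixes f :: "complex^'n \<Rightarrow> ennreal"
  assumes r: "0 < r" and f[measurable]: "f \<in> borel_measurable lebesgue"
  shows "(\<integral>\<^sup>+ z. f z \<partial>lebesgue) = (\<integral>\<^sup>+ \<nu>. (\<integral>\<^sup>+ z. f z * indicator (cell_set r \<nu>) z \<partial>lebesgue) \<partial>count_space (cube_lattice r))"
proof -
  have "f z = (\<integral>\<^sup>+ \<nu>. f z * indicator (cell_set r \<nu>) z \<partial>count_space (cube_lattice r))" for z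
    using cell_in_lattice[OF r, of z]
    by (subst nn_integral_count_space'[where A = "{cell r z}"]) (auto simp: cell_set_def)
  then have "(\<integral>\<^sup>+ z. f z \<partial>lebesgue) = (\<integral>\<^sup>+ z. (\<integral>\<^sup>+ \<nu>. f z * indicator (cell_set r \<nu>) z \<partial>count_space (cube_lattice r)) \<partial>lebesgue)"
    by (intro nn_integral_cong) simp
  also have "\<dots> = (\<integral>\<^sup>+ \<nu>. (\<integral>\<^sup>+ z. f z * indicator (cell_set r \<nu>) z \<partial>lebesgue) \<partial>count_space (cube_lattice r))"
    using r by (intro nn_integral_count_space_nn_integral countable_lattice) auto
  finally show ?thesis .
qed

text \<open>If \<open>F\<close> on each cell is dominated by \<open>\<phi>\<close> on the cell shifted by \<open>\<kappa>\<close>, the \<open>p\<close>-th powers can be summed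
over the cells, because the shift permutes the grid.\<close>

lemma Lp_norm_le_by_shifted_cells:
  fixes F \<phi> :: "complex^'n \<Rightarrow> ennreal"
  assumes p: "1 \<le> p" and r: "0 < r" and k: "\<kappa> \<in> cube_lattice r"
    and F[measurable]: "F \<in> borel_measurable lebesgue" and \<phi>[measurable]: "\<phi> \<in> borel_measurable lebesgue"
    and le: "\<And>\<mu>. \<mu> \<in> cube_lattice r \<Longrightarrow> Lp_norm p lebesgue (\<lambda>z. F z * indicator (cell_set r \<mu>) z)
      \<le> B * Lp_norm p lebesgue (\<lambda>z. \<phi> z * indicator (cell_set r (\<mu> + \<kappa>)) z)"
  shows "Lp_norm p lebesgue F \<le> B * Lp_norm p lebesgue \<phi>"
proof (cases p)
  case top
  have "AE z in lebesgue. \<forall>\<mu>\<in>cube_lattice r. F z * indicator (cell_set r \<mu>) z \<le> B * esssup lebesgue \<phi>"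
  proof (subst AE_ball_countable)
    show "countable (cube_lattice r :: (complex^'n) set)" using r by (intro countable_lattice) simp
    show "\<forall>\<mu>\<in>cube_lattice r. AE z in lebesgue. F z * indicator (cell_set r \<mu>) z \<le> B * esssup lebesgue \<phi>"
    proof
      fix \<mu> :: "complex^'n" assume \<mu>: "\<mu> \<in> cube_lattice r"
      have "esssup lebesgue (\<lambda>z. F z * indicator (cell_set r \<mu>) z)
          \<le> B * esssup lebesgue (\<lambda>z. \<phi> z * indicator (cell_set r (\<mu> + \<kappa>)) z)"
        using le[OF \<mu>] by (simp add: top Lp_norm_top)
      also have "\<dots> \<le> B * esssup lebesgue \<phi>"
        by (intro mult_left_mono esssup_mono) (auto simp: indicator_def)
      finally have *: "esssup lebesgue (\<lambda>z. F z * indicator (cell_set r \<mu>) z) \<le> B * esssup lebesgue \<phi>" .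
      show "AE z in lebesgue. F z * indicator (cell_set r \<mu>) z \<le> B * esssup lebesgue \<phi>"
        using esssup_AE[of "\<lambda>z. F z * indicator (cell_set r \<mu>) z" lebesgue]
        by (rule eventually_mono) (rule order_trans[OF _ *])
    qed
  qed
  then have "AE z in lebesgue. F z \<le> B * esssup lebesgue \<phi>"
  proof (rule eventually_mono)
    fix z assume "\<forall>\<mu>\<in>cube_lattice r. F z * indicator (cell_set r \<mu>) z \<le> B * esssup lebesgue \<phi>"
    from bspec[OF this cell_in_lattice[OF r, of z]] show "F z \<le> B * esssup lebesgue \<phi>"
      by (simp add: cell_set_def)
  qed
  then show ?thesis unfolding top Lp_norm_top by (rule esssup_I[OF F])
next
  case (real q)
  with p have q: "1 \<le> q" by (simp flip: ennreal_1)
  have ind: "ennpow (g z * indicator A z) q = ennpow (g z) q * indicator A z" for g :: "complex^'n \<Rightarrow> ennreal" and A z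
    by (simp add: indicator_def)
  have le': "(\<integral>\<^sup>+ z. ennpow (F z) q * indicator (cell_set r \<mu>) z \<partial>lebesgue)
     \<le> ennpow B q * (\<integral>\<^sup>+ z. ennpow (\<phi> z) q * indicator (cell_set r (\<mu> + \<kappa>)) z \<partial>lebesgue)"
    if "\<mu> \<in> cube_lattice r" for \<mu>
  proof -
    have "ennpow (ennpow (\<integral>\<^sup>+ z. ennpow (F z) q * indicator (cell_set r \<mu>) z \<partial>lebesgue) (1 / q)) q
      \<le> ennpow (B * ennpow (\<integral>\<^sup>+ z. ennpow (\<phi> z) q * indicator (cell_set r (\<mu> + \<kappa>)) z \<partial>lebesgue) (1 / q)) q"
      using le[OF that] q by (intro ennpow_mono) (simp_all add: real Lp_norm_real ind)
    then show ?thesis using q by (simp add: ennpow_mult ennpow_ennpow)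
  qed
  have "(\<integral>\<^sup>+ z. ennpow (F z) q \<partial>lebesgue)
     = (\<integral>\<^sup>+ \<mu>. (\<integral>\<^sup>+ z. ennpow (F z) q * indicator (cell_set r \<mu>) z \<partial>lebesgue) \<partial>count_space (cube_lattice r))"
    by (rule nn_integral_by_cells[OF r]) simp
  also have "\<dots> \<le> (\<integral>\<^sup>+ \<mu>. ennpow B q * (\<integral>\<^sup>+ z. ennpow (\<phi> z) q * indicator (cell_set r (\<mu> + \<kappa>)) z \<partial>lebesgue) \<partial>count_space (cube_lattice r))"
    by (intro nn_integral_mono le') simp
  also have "\<dots> = ennpow B q * (\<integral>\<^sup>+ \<mu>. (\<integral>\<^sup>+ z. ennpow (\<phi> z) q * indicator (cell_set r (\<kappa> + \<mu>)) z \<partial>lebesgue) \<partial>count_space (cube_lattice r))"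
    by (simp add: nn_integral_cmult add.commute)
  also have "(\<integral>\<^sup>+ \<mu>. (\<integral>\<^sup>+ z. ennpow (\<phi> z) q * indicator (cell_set r (\<kappa> + \<mu>)) z \<partial>lebesgue) \<partial>count_space (cube_lattice r))
     = (\<integral>\<^sup>+ \<mu>. (\<integral>\<^sup>+ z. ennpow (\<phi> z) q * indicator (cell_set r \<mu>) z \<partial>lebesgue) \<partial>count_space (cube_lattice r))"
    by (rule nn_integral_bij_count_space[OF lattice_shift_bij[OF k]])
  also have "\<dots> = (\<integral>\<^sup>+ z. ennpow (\<phi> z) q \<partial>lebesgue)"
    by (rule nn_integral_by_cells[OF r, symmetric]) simp
  finally have "ennpow (\<integral>\<^sup>+ z. ennpow (F z) q \<partial>lebesgue) (1 / q)
     \<le> ennpow (ennpow B q * (\<integral>\<^sup>+ z. ennpow (\<phi> z) q \<partial>lebesgue)) (1 / q)"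
    using q by (intro ennpow_mono) auto
  then show ?thesis using q by (simp add: real Lp_norm_real ennpow_mult ennpow_ennpow)
qed

section \<open>From \<open>\<A>\<^sub>p\<^sub>,\<^sub>r\<close> to the maximal projection\<close>

lemma Re_herm: "Re (herm u z) = u \<bullet> z"
  by (simp add: herm_def inner_vec_def inner_complex_def)

lemma cmod_fock_kernel: "cmod (fock_kernel \<alpha> z u) = exp (\<alpha> * (u \<bullet> z))"
  by (simp add: fock_kernel_def Re_herm[symmetric])

text \<open>Absorbing \<open>exp (- \<alpha> \<bar>u\<bar>\<^sup>2 / 2)\<close> into the functions turns the Fock kernel into
\<open>(\<alpha> / \<pi>)\<^sup>n exp (- \<alpha> \<bar>z - u\<bar>\<^sup>2 / 2)\<close> in absolute value, which decays off the diagonal.\<close>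

definition gauss_weighted :: "real \<Rightarrow> (complex^'n \<Rightarrow> complex Matrix.vec) \<Rightarrow> complex^'n \<Rightarrow> ennreal" where
  "gauss_weighted \<alpha> f u = ennreal (vnorm (f u) * exp (- (\<alpha> / 2) * (norm u)\<^sup>2))"

lemma norm_diff_exponent:
  fixes u z :: "'a::real_inner"
  shows "- \<alpha> * (norm u)\<^sup>2 + \<alpha> * (u \<bullet> z) - (\<alpha> / 2) * (norm z)\<^sup>2
    = - (\<alpha> / 2) * (norm (z - u))\<^sup>2 - (\<alpha> / 2) * (norm u)\<^sup>2"
  by (simp add: power2_norm_eq_inner inner_diff_left inner_diff_right inner_commute algebra_simps)

lemma nn_integral_gauss_measure:
  fixes g :: "complex^'n \<Rightarrow> ennreal"
  assumes "g \<in> borel_measurable lebesgue"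
  shows "(\<integral>\<^sup>+ u. g u \<partial>gauss_measure \<alpha>)
    = (\<integral>\<^sup>+ u. ennreal ((\<alpha> / pi) ^ CARD('n) * exp (- \<alpha> * (norm u)\<^sup>2)) * g u \<partial>lebesgue)"
  unfolding gauss_measure_def
proof (rule nn_integral_density)
  show "(\<lambda>u :: complex^'n. ennreal ((\<alpha> / pi) ^ CARD('n) * exp (- \<alpha> * (norm u)\<^sup>2))) \<in> borel_measurable lebesgue"
    by (intro measurable_completion) measurable
qed fact

lemma gauss_weighted_measurable:
  fixes g :: "complex^'n \<Rightarrow> complex Matrix.vec"
  assumes g: "vec_measurable d lebesgue g"
  shows "gauss_weighted \<alpha> g \<in> borel_measurable lebesgue"
proof -
  have [measurable]: "(\<lambda>z :: complex^'n. exp (- (\<alpha> / 2) * (norm z)\<^sup>2)) \<in> borel_measurable lebesgue"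
    by (rule borel_measurable_lebesgue_if_borel) measurable
  note [measurable] = vec_measurable_vnorm[OF g]
  show ?thesis unfolding gauss_weighted_def[abs_def] by measurable
qed

lemma max_fock_proj_eq:
  fixes W :: "complex^'n \<Rightarrow> complex Matrix.mat"
  assumes W: "matrix_weight d W" and f: "vec_measurable d lebesgue f" and \<alpha>: "0 < \<alpha>"
  shows "max_fock_proj \<alpha> W f z * ennreal (exp (- (\<alpha> / 2) * (norm z)\<^sup>2))
    = (\<integral>\<^sup>+ u. ennreal ((\<alpha> / pi) ^ CARD('n) * vnorm (W z *\<^sub>v (weight_inv d W u *\<^sub>v f u))
         * exp (- (\<alpha> / 2) * (norm (z - u))\<^sup>2) * exp (- (\<alpha> / 2) * (norm u)\<^sup>2)) \<partial>lebesgue)"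
proof -
  have Wz: "mat_measurable d lebesgue (\<lambda>_ :: complex^'n. W z)"
    using matrix_weight_measurable[OF W] by (simp add: mat_measurable_def)
  note m = vec_measurable_vnorm[OF vec_measurable_mult[OF Wz vec_measurable_mult[OF weight_inv_measurable[OF W] f]]]
  have exp_m: "(\<lambda>u :: complex^'n. exp (\<alpha> * (u \<bullet> z))) \<in> borel_measurable lebesgue"
    by (intro measurable_completion) measurable
  have exp_m2: "(\<lambda>u :: complex^'n. exp (- \<alpha> * (norm u)\<^sup>2)) \<in> borel_measurable lebesgue"
    by (intro measurable_completion) measurable
  note [measurable] = m exp_m exp_m2
  have AEg: "AE u in gauss_measure \<alpha>. good_mat d (W u)"
    using matrix_weight_AE_good[OF W] unfolding gauss_measure_def
    by (subst AE_density) (auto intro!: measurable_completion elim: eventually_mono)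
  have "max_fock_proj \<alpha> W f z = (\<integral>\<^sup>+ u. ennreal (vnorm (W z *\<^sub>v (weight_inv d W u *\<^sub>v f u)) * exp (\<alpha> * (u \<bullet> z))) \<partial>gauss_measure \<alpha>)"
    unfolding max_fock_proj_def cmod_fock_kernel
    using AEg by (intro nn_integral_cong_AE) (auto elim!: eventually_mono simp: weight_inv_def)
  also have "\<dots> = (\<integral>\<^sup>+ u. ennreal ((\<alpha> / pi) ^ CARD('n) * exp (- \<alpha> * (norm u)\<^sup>2))
      * ennreal (vnorm (W z *\<^sub>v (weight_inv d W u *\<^sub>v f u)) * exp (\<alpha> * (u \<bullet> z))) \<partial>lebesgue)"
    by (rule nn_integral_gauss_measure) measurable
  finally have "max_fock_proj \<alpha> W f z * ennreal (exp (- (\<alpha> / 2) * (norm z)\<^sup>2)) =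
      (\<integral>\<^sup>+ u. ennreal ((\<alpha> / pi) ^ CARD('n) * exp (- \<alpha> * (norm u)\<^sup>2))
      * ennreal (vnorm (W z *\<^sub>v (weight_inv d W u *\<^sub>v f u)) * exp (\<alpha> * (u \<bullet> z))) \<partial>lebesgue)
      * ennreal (exp (- (\<alpha> / 2) * (norm z)\<^sup>2))" by simp
  also have "\<dots> = (\<integral>\<^sup>+ u. ennreal ((\<alpha> / pi) ^ CARD('n) * exp (- \<alpha> * (norm u)\<^sup>2))
      * ennreal (vnorm (W z *\<^sub>v (weight_inv d W u *\<^sub>v f u)) * exp (\<alpha> * (u \<bullet> z))) * ennreal (exp (- (\<alpha> / 2) * (norm z)\<^sup>2)) \<partial>lebesgue)"
    by (rule nn_integral_multc[symmetric]) measurable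
  also have "\<dots> = (\<integral>\<^sup>+ u. ennreal ((\<alpha> / pi) ^ CARD('n) * vnorm (W z *\<^sub>v (weight_inv d W u *\<^sub>v f u))
         * exp (- (\<alpha> / 2) * (norm (z - u))\<^sup>2) * exp (- (\<alpha> / 2) * (norm u)\<^sup>2)) \<partial>lebesgue)"
  proof (rule nn_integral_cong)
    fix u :: "complex^'n"
    have "exp (- \<alpha> * (norm u)\<^sup>2) * exp (\<alpha> * (u \<bullet> z)) * exp (- (\<alpha> / 2) * (norm z)\<^sup>2)
       = exp (- (\<alpha> / 2) * (norm (z - u))\<^sup>2) * exp (- (\<alpha> / 2) * (norm u)\<^sup>2)"
      using norm_diff_exponent[of \<alpha> u z] by (simp add: exp_add[symmetric])
    then have "(\<alpha> / pi) ^ CARD('n) * exp (- \<alpha> * (norm u)\<^sup>2) * (vnorm (W z *\<^sub>v (weight_inv d W u *\<^sub>v f u)) * exp (\<alpha> * (u \<bullet> z))) * exp (- (\<alpha> / 2) * (norm z)\<^sup>2)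
      = (\<alpha> / pi) ^ CARD('n) * vnorm (W z *\<^sub>v (weight_inv d W u *\<^sub>v f u))
         * exp (- (\<alpha> / 2) * (norm (z - u))\<^sup>2) * exp (- (\<alpha> / 2) * (norm u)\<^sup>2)"
      by (simp add: mult_ac)
    then show "ennreal ((\<alpha> / pi) ^ CARD('n) * exp (- \<alpha> * (norm u)\<^sup>2))
      * ennreal (vnorm (W z *\<^sub>v (weight_inv d W u *\<^sub>v f u)) * exp (\<alpha> * (u \<bullet> z))) * ennreal (exp (- (\<alpha> / 2) * (norm z)\<^sup>2))
      = ennreal ((\<alpha> / pi) ^ CARD('n) * vnorm (W z *\<^sub>v (weight_inv d W u *\<^sub>v f u))
         * exp (- (\<alpha> / 2) * (norm (z - u))\<^sup>2) * exp (- (\<alpha> / 2) * (norm u)\<^sup>2))"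
      using \<alpha> by (simp add: ennreal_mult[symmetric])
  qed
  finally show ?thesis .
qed

text \<open>For \<open>p = \<infinity>\<close> measurability is part of having a finite essential supremum.\<close>

lemma max_fock_proj_measurable:
  fixes W :: "complex^'n \<Rightarrow> complex Matrix.mat"
  assumes W: "matrix_weight d W" and f: "vec_measurable d lebesgue f" and \<alpha>: "0 < \<alpha>"
  shows "(\<lambda>z. max_fock_proj \<alpha> W f z * ennreal (exp (- (\<alpha> / 2) * (norm z)\<^sup>2))) \<in> borel_measurable lebesgue"
  unfolding max_fock_proj_eq[OF W f \<alpha>]
proof (rule lebesgue.borel_measurable_nn_integral)
  let ?M = "lebesgue \<Otimes>\<^sub>M lebesgue :: ((complex^'n) \<times> (complex^'n)) measure"
  have [measurable]: "fst \<in> ?M \<rightarrow>\<^sub>M lebesgue" "snd \<in> ?M \<rightarrow>\<^sub>M lebesgue" by auto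
  have id_borel: "(\<lambda>z. z) \<in> lebesgue \<rightarrow>\<^sub>M (borel :: (complex^'n) measure)"
    by (intro measurable_completion) simp
  have [measurable]: "fst \<in> borel_measurable ?M" "snd \<in> borel_measurable ?M"
    using measurable_compose[OF measurable_fst id_borel] measurable_compose[OF measurable_snd id_borel]
    by auto
  have [measurable]: "(\<lambda>x. vnorm (W (fst x) *\<^sub>v (weight_inv d W (snd x) *\<^sub>v f (snd x)))) \<in> borel_measurable ?M"
    by (rule vec_measurable_vnorm[OF vec_measurable_mult[OF mat_measurable_compose[OF matrix_weight_measurable[OF W]]
        vec_measurable_mult[OF mat_measurable_compose[OF weight_inv_measurable[OF W]] vec_measurable_compose[OF f]]]])
       measurable
  show "(\<lambda>(z, u). ennreal ((\<alpha> / pi) ^ CARD('n) * vnorm (W z *\<^sub>v (weight_inv d W u *\<^sub>v f u))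
         * exp (- (\<alpha> / 2) * (norm (z - u))\<^sup>2) * exp (- (\<alpha> / 2) * (norm u)\<^sup>2))) \<in> borel_measurable ?M"
    unfolding split_beta by measurable
qed

definition chain_length :: "real \<Rightarrow> complex^'n \<Rightarrow> nat" where
  "chain_length r \<kappa> = nat \<lceil>2 * norm \<kappa> / r\<rceil>"

lemma chain_length: "0 < r \<Longrightarrow> norm \<kappa> \<le> real (chain_length r \<kappa>) * r / 2"
proof -
  assume r: "0 < r"
  have "2 * norm \<kappa> / r \<le> real (chain_length r \<kappa>)"
    unfolding chain_length_def by (rule real_nat_ceiling_ge)
  then show ?thesis using r by (simp add: field_simps)
qed

text \<open>A bound for the interaction of two cells at displacement \<open>\<kappa>\<close>: the Gaussian kernel times the factor
of the chain that joins the two cubes.\<close>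

definition off_diagonal_decay :: "real \<Rightarrow> real \<Rightarrow> real \<Rightarrow> complex^'n \<Rightarrow> real" where
  "off_diagonal_decay \<alpha> r C \<kappa> =
     exp (8 * \<alpha> * (r * CARD('n))\<^sup>2 - (\<alpha> / 4) * (norm \<kappa>)\<^sup>2) * (4 ^ CARD('n) * C) ^ chain_length r \<kappa>"

text \<open>Moving both points to the corners of their cells changes the distance by at most \<open>4 n r\<close>, and
\<open>(x + y)\<^sup>2 \<le> 2 x\<^sup>2 + 2 y\<^sup>2\<close> trades this for half of the Gaussian exponent.\<close>

lemma exp_dist_le_cells:
  fixes z u :: "complex^'n"
  assumes \<alpha>: "0 < \<alpha>" and r: "0 < r" and u: "cell r u = cell r z + \<kappa>"
  shows "exp (- (\<alpha> / 2) * (norm (z - u))\<^sup>2) \<le> exp (8 * \<alpha> * (r * CARD('n))\<^sup>2 - (\<alpha> / 4) * (norm \<kappa>)\<^sup>2)"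
proof -
  define D where "D = r * CARD('n)"
  have "\<kappa> = (cell r u - u) + (u - z) + (z - cell r z)" using u by simp
  then have "norm \<kappa> \<le> norm (u - cell r u) + norm (z - u) + norm (z - cell r z)"
    by (smt (verit) norm_triangle_ineq norm_minus_commute)
  then have "norm \<kappa> \<le> norm (z - u) + 4 * D"
    using norm_diff_cell_le[OF r, of z] norm_diff_cell_le[OF r, of u] by (simp add: D_def)
  then have "(norm \<kappa>)\<^sup>2 \<le> (norm (z - u) + 4 * D)\<^sup>2" by (intro power_mono) auto
  also have "\<dots> \<le> 2 * (norm (z - u))\<^sup>2 + 2 * (4 * D)\<^sup>2"
    using zero_le_power2[of "norm (z - u) - 4 * D"] by (simp add: power2_eq_square algebra_simps)
  finally have *: "(norm \<kappa>)\<^sup>2 \<le> 2 * (norm (z - u))\<^sup>2 + 32 * D\<^sup>2" by (simp add: power_mult_distrib)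
  have "(\<alpha> / 4) * (norm \<kappa>)\<^sup>2 \<le> (\<alpha> / 4) * (2 * (norm (z - u))\<^sup>2 + 32 * D\<^sup>2)"
    using * \<alpha> by (intro mult_left_mono) auto
  then show ?thesis by (simp add: D_def algebra_simps)
qed

text \<open>On the cell with corner \<open>\<mu>\<close> the rank-one decomposition uses the basis adapted to the cube at \<open>\<mu>\<close>. The
integral over the cell at \<open>\<mu> + \<kappa>\<close> is estimated by Hoelder's inequality, and \<open>\<sigma>\<close> of the dual basis on
that distant cube by the chain. This dominates the maximal projection by the sum over \<open>i\<close> and \<open>\<kappa>\<close> of the
decay times functions \<open>\<Psi> i \<kappa>\<close>, all of which have norm at most a constant times the norm of \<open>f\<close>.\<close>

lemma max_fock_proj_Lp_bound:
  fixes W :: "complex^'n \<Rightarrow> complex Matrix.mat"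
  assumes p: "1 \<le> p" and \<alpha>: "0 < \<alpha>" and r: "0 < r" and W: "matrix_weight d W"
    and A: "A_metric_bound p r d (\<lambda>z x. ennreal (vnorm (W z *\<^sub>v x))) C"
    and f: "vec_measurable d lebesgue f"
  defines "S \<equiv> (\<integral>\<^sup>+ \<kappa>. ennreal (off_diagonal_decay \<alpha> r C \<kappa>) \<partial>count_space (cube_lattice r :: (complex^'n) set))"
  assumes S: "S < top"
  shows "Lp_norm p lebesgue (\<lambda>z. max_fock_proj \<alpha> W f z * ennreal (exp (- (\<alpha> / 2) * (norm z)\<^sup>2)))
    \<le> ennreal ((\<alpha> / pi) ^ CARD('n) * r ^ (2 * CARD('n)) * (2 * C) * d) * S * Lp_norm p lebesgue (gauss_weighted \<alpha> f)"
proof -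
  define L where "L = (cube_lattice r :: (complex^'n) set)"
  have L: "countable L" using r by (simp add: L_def countable_lattice)
  have C: "0 < C" using A by (simp add: A_metric_bound_def)
  define V where "V = r ^ (2 * CARD('n))"
  have V: "0 < V" using r by (simp add: V_def)
  define e e' where "e = exponent_inv p" and "e' = exponent_inv (conj_exponent p)"
  define \<phi> where "\<phi> = gauss_weighted \<alpha> f"
  have [measurable]: "(\<lambda>u :: complex^'n. exp (- (\<alpha> / 2) * (norm u)\<^sup>2)) \<in> borel_measurable lebesgue"
    by (intro measurable_completion) measurable
  have [measurable]: "(\<lambda>u :: complex^'n. exp (- (\<alpha> / 2) * (norm (z - u))\<^sup>2)) \<in> borel_measurable lebesgue" for z
    by (intro measurable_completion) measurable
  have \<phi>m[measurable]: "\<phi> \<in> borel_measurable lebesgue"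
    using vec_measurable_vnorm[OF f] unfolding \<phi>_def gauss_weighted_def by measurable
  define a where "a \<nu> = Lp_norm p lebesgue (\<lambda>u. \<phi> u * indicator (cell_set r \<nu>) u)" for \<nu>
  have "\<forall>\<mu>. \<exists>E F. E \<in> carrier_mat d d \<and> F \<in> carrier_mat d d \<and> E * F = 1\<^sub>m d \<and>
    (\<forall>i<d. weight_avg p W (cube r \<mu>) (col E i) \<le> 1) \<and>
    (\<forall>i<d. dual_avg d p W (cube r \<mu>) (conjugate (Matrix.row F i)) \<le> ennreal (2 * C))"
    using A_weight_adapted_basis[OF p W r A] by simp
  then obtain E F where E: "\<And>\<mu>. E \<mu> \<in> carrier_mat d d" and F: "\<And>\<mu>. F \<mu> \<in> carrier_mat d d"
    and EF: "\<And>\<mu>. E \<mu> * F \<mu> = 1\<^sub>m d"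
    and Eavg: "\<And>\<mu> i. i < d \<Longrightarrow> weight_avg p W (cube r \<mu>) (col (E \<mu>) i) \<le> 1"
    and Favg: "\<And>\<mu> i. i < d \<Longrightarrow> dual_avg d p W (cube r \<mu>) (conjugate (Matrix.row (F \<mu>) i)) \<le> ennreal (2 * C)"
    by metis
  have ecar: "col (E \<mu>) i \<in> carrier_vec d" for \<mu> i by (rule carrier_vecI) (use E[of \<mu>] in simp)
  have fcar: "conjugate (Matrix.row (F \<mu>) i) \<in> carrier_vec d" for \<mu> i by (rule carrier_vecI) (use F[of \<mu>] in simp)
  \<comment> \<open>The factor \<open>a (cell r z + \<kappa>)\<close> is constant on each cell, so that \<open>\<Psi> i \<kappa>\<close> has on the cell \<open>\<mu>\<close> at most the norm of \<open>\<phi>\<close> on the cell \<open>\<mu> + \<kappa>\<close>.\<close>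
  define \<Psi> where "\<Psi> i \<kappa> z = ennreal (vnorm (W z *\<^sub>v col (E (cell r z)) i)) * a (cell r z + \<kappa>)" for i \<kappa> z
  have \<Psi>m[measurable]: "\<Psi> i \<kappa> \<in> borel_measurable lebesgue" for i \<kappa>
    unfolding \<Psi>_def
    by (rule measurable_by_cells[OF r, where f = "\<lambda>\<nu> z. ennreal (vnorm (W z *\<^sub>v col (E \<nu>) i)) * a (\<nu> + \<kappa>)"])
       (intro borel_measurable_times_ennreal weight_vnorm_measurable[OF W ecar] borel_measurable_const)
  have \<Psi>B: "Lp_norm p lebesgue (\<Psi> i \<kappa>) \<le> ennreal (V powr e) * Lp_norm p lebesgue \<phi>"
    if i: "i < d" and \<kappa>: "\<kappa> \<in> L" for i \<kappa>
  proof (rule Lp_norm_le_by_shifted_cells[OF p r \<kappa>[unfolded L_def] \<Psi>m \<phi>m])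
    fix \<mu> :: "complex^'n"
    note [measurable] = weight_vnorm_measurable[OF W ecar[of \<mu> i]]
    have "Lp_norm p lebesgue (\<lambda>z. \<Psi> i \<kappa> z * indicator (cell_set r \<mu>) z)
       = Lp_norm p lebesgue (\<lambda>z. a (\<mu> + \<kappa>) * (ennreal (vnorm (W z *\<^sub>v col (E \<mu>) i)) * indicator (cell_set r \<mu>) z))"
      by (intro arg_cong[where f = "Lp_norm p lebesgue"] ext) (auto simp: \<Psi>_def indicator_def cell_set_def mult_ac)
    also have "\<dots> \<le> a (\<mu> + \<kappa>) * Lp_norm p lebesgue (\<lambda>z. ennreal (vnorm (W z *\<^sub>v col (E \<mu>) i)) * indicator (cell_set r \<mu>) z)"
      by (rule Lp_norm_cmult_le[OF p]) measurable
    also have "\<dots> \<le> a (\<mu> + \<kappa>) * local_norm p (cube r \<mu>) (\<lambda>z. ennreal (vnorm (W z *\<^sub>v col (E \<mu>) i)))"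
      unfolding local_norm_def using cell_set_subset_cube[OF r, of \<mu>]
      by (intro mult_left_mono Lp_norm_mono) (auto simp: indicator_def)
    also have "local_norm p (cube r \<mu>) (\<lambda>z. ennreal (vnorm (W z *\<^sub>v col (E \<mu>) i)))
      = ennreal (V powr e) * weight_avg p W (cube r \<mu>) (col (E \<mu>) i)"
      using V by (simp add: weight_avg_eq[OF p cube_in_cubes r W ecar] V_def[symmetric] e_def mult.assoc[symmetric]
          ennreal_mult[symmetric] powr_add[symmetric])
    also have "a (\<mu> + \<kappa>) * (ennreal (V powr e) * weight_avg p W (cube r \<mu>) (col (E \<mu>) i)) \<le> a (\<mu> + \<kappa>) * (ennreal (V powr e) * 1)"
      using Eavg[OF i] by (intro mult_left_mono) auto
    finally show "Lp_norm p lebesgue (\<lambda>z. \<Psi> i \<kappa> z * indicator (cell_set r \<mu>) z)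
       \<le> ennreal (V powr e) * Lp_norm p lebesgue (\<lambda>z. \<phi> z * indicator (cell_set r (\<mu> + \<kappa>)) z)"
      by (simp add: a_def mult.commute)
  qed
  define c0 where "c0 = (\<alpha> / pi) ^ CARD('n)"
  have c0: "0 < c0" using \<alpha> by (simp add: c0_def)
  define c1 where "c1 = c0 * V powr e' * (2 * C)"
  have c1: "0 < c1" using c0 V C by (simp add: c1_def)
  define h where "h \<kappa> = ennreal c1 * ennreal (off_diagonal_decay \<alpha> r C \<kappa>)" for \<kappa> :: "complex^'n"
  define g where "g \<kappa> = exp (8 * \<alpha> * (r * CARD('n))\<^sup>2 - (\<alpha> / 4) * (norm \<kappa>)\<^sup>2)" for \<kappa> :: "complex^'n"
  define \<Psi>' where "\<Psi>' i z = (\<integral>\<^sup>+ \<kappa>. h \<kappa> * \<Psi> i \<kappa> z \<partial>count_space L)" for i z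
  have \<Psi>'m: "\<Psi>' i \<in> borel_measurable lebesgue" for i
    unfolding \<Psi>'_def by (rule borel_measurable_nn_integral_count_space[OF L]) measurable
  have H: "(\<integral>\<^sup>+ \<kappa>. h \<kappa> \<partial>count_space L) = ennreal c1 * S"
    by (simp add: h_def S_def L_def nn_integral_cmult)
  have \<Psi>'B: "Lp_norm p lebesgue (\<Psi>' i) \<le> (ennreal c1 * S) * (ennreal (V powr e) * Lp_norm p lebesgue \<phi>)"
    if i: "i < d" for i
    unfolding \<Psi>'_def H[symmetric]
    using \<Psi>B[OF i] S by (intro Lp_norm_weighted_sum_le[OF p L]) (auto simp: H ennreal_mult_less_top)
  have inner: "(\<integral>\<^sup>+ u. ennreal (vnorm (weight_inv d W u *\<^sub>v conjugate (Matrix.row (F (cell r z)) i))) * \<phi> u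
       * ennreal (exp (- (\<alpha> / 2) * (norm (z - u))\<^sup>2)) \<partial>lebesgue)
     \<le> (\<integral>\<^sup>+ \<kappa>. ennreal (V powr e' * (2 * C)) * (ennreal (off_diagonal_decay \<alpha> r C \<kappa>) * a (cell r z + \<kappa>)) \<partial>count_space L)"
    (is "(\<integral>\<^sup>+ u. ?X u \<partial>lebesgue) \<le> _") if i: "i < d" for i z
  proof -
    let ?e = "conjugate (Matrix.row (F (cell r z)) i)"
    note [measurable] = weight_inv_vnorm_measurable[OF W fcar[of "cell r z" i]]
    have "(\<integral>\<^sup>+ u. ?X u \<partial>lebesgue) = (\<integral>\<^sup>+ \<nu>. (\<integral>\<^sup>+ u. ?X u * indicator (cell_set r \<nu>) u \<partial>lebesgue) \<partial>count_space L)"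
      unfolding L_def by (rule nn_integral_by_cells[OF r]) measurable
    also have "\<dots> = (\<integral>\<^sup>+ \<kappa>. (\<integral>\<^sup>+ u. ?X u * indicator (cell_set r (cell r z + \<kappa>)) u \<partial>lebesgue) \<partial>count_space L)"
      unfolding L_def
      by (rule nn_integral_bij_count_space[OF lattice_shift_bij[OF cell_in_lattice[OF r]], symmetric])
    also have "\<dots> \<le> (\<integral>\<^sup>+ \<kappa>. ennreal (V powr e' * (2 * C)) * (ennreal (off_diagonal_decay \<alpha> r C \<kappa>) * a (cell r z + \<kappa>)) \<partial>count_space L)"
    proof (rule nn_integral_mono)
      fix \<kappa> :: "complex^'n"
      let ?Q = "cube r (cell r z + \<kappa>)"
      have "(\<integral>\<^sup>+ u. ?X u * indicator (cell_set r (cell r z + \<kappa>)) u \<partial>lebesgue)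
        \<le> (\<integral>\<^sup>+ u. ennreal (g \<kappa>) * ((\<phi> u * indicator (cell_set r (cell r z + \<kappa>)) u)
              * (ennreal (vnorm (weight_inv d W u *\<^sub>v ?e)) * indicator ?Q u)) \<partial>lebesgue)"
      proof (rule nn_integral_mono)
        fix u
        show "?X u * indicator (cell_set r (cell r z + \<kappa>)) u \<le> ennreal (g \<kappa>) * ((\<phi> u * indicator (cell_set r (cell r z + \<kappa>)) u)
              * (ennreal (vnorm (weight_inv d W u *\<^sub>v ?e)) * indicator ?Q u))"
        proof (cases "u \<in> cell_set r (cell r z + \<kappa>)")
          case True
          then have "u \<in> ?Q" using cell_set_subset_cube[OF r] by auto
          moreover have "exp (- (\<alpha> / 2) * (norm (z - u))\<^sup>2) \<le> g \<kappa>"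
            using True unfolding g_def by (intro exp_dist_le_cells[OF \<alpha> r]) (simp add: cell_set_def)
          then have "?X u \<le> ennreal (vnorm (weight_inv d W u *\<^sub>v ?e)) * \<phi> u * ennreal (g \<kappa>)"
            by (intro mult_left_mono ennreal_leI) auto
          ultimately show ?thesis using True by (simp add: mult_ac)
        qed simp
      qed
      also have "\<dots> = ennreal (g \<kappa>) * (\<integral>\<^sup>+ u. (\<phi> u * indicator (cell_set r (cell r z + \<kappa>)) u)
              * (ennreal (vnorm (weight_inv d W u *\<^sub>v ?e)) * indicator ?Q u) \<partial>lebesgue)"
        by (intro nn_integral_cmult) measurable
      also have "\<dots> \<le> ennreal (g \<kappa>) * (a (cell r z + \<kappa>) * local_norm (conj_exponent p) ?Q (\<lambda>u. ennreal (vnorm (weight_inv d W u *\<^sub>v ?e))))"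
        unfolding a_def local_norm_def
        by (intro mult_left_mono Hoelder_inequality[OF p]) measurable
      also have "local_norm (conj_exponent p) ?Q (\<lambda>u. ennreal (vnorm (weight_inv d W u *\<^sub>v ?e)))
         = ennreal (V powr e') * dual_avg d p W ?Q ?e"
        using V by (simp add: dual_avg_eq[OF p cube_in_cubes r W fcar] V_def[symmetric] e'_def mult.assoc[symmetric]
          ennreal_mult[symmetric] powr_add[symmetric])
      also have "ennreal (g \<kappa>) * (a (cell r z + \<kappa>) * (ennreal (V powr e') * dual_avg d p W ?Q ?e))
        \<le> ennreal (g \<kappa>) * (a (cell r z + \<kappa>) * (ennreal (V powr e') * (ennreal ((4 ^ CARD('n) * C) ^ chain_length r \<kappa>) * ennreal (2 * C))))"
      proof (intro mult_left_mono)
        have "dual_avg d p W ?Q ?e \<le> ennreal ((4 ^ CARD('n) * C) ^ chain_length r \<kappa>) * dual_avg d p W (cube r (cell r z)) ?e"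
          by (rule dual_avg_shift_chain[OF p W r A fcar chain_length[OF r]])
        also have "\<dots> \<le> ennreal ((4 ^ CARD('n) * C) ^ chain_length r \<kappa>) * ennreal (2 * C)"
          using Favg[OF i] by (intro mult_left_mono) auto
        finally show "dual_avg d p W ?Q ?e \<le> ennreal ((4 ^ CARD('n) * C) ^ chain_length r \<kappa>) * ennreal (2 * C)" .
      qed auto
      also have "\<dots> = ennreal (V powr e' * (2 * C)) * (ennreal (off_diagonal_decay \<alpha> r C \<kappa>) * a (cell r z + \<kappa>))"
        using C V by (simp add: off_diagonal_decay_def g_def ennreal_mult mult_ac)
      finally show "(\<integral>\<^sup>+ u. ?X u * indicator (cell_set r (cell r z + \<kappa>)) u \<partial>lebesgue)
        \<le> ennreal (V powr e' * (2 * C)) * (ennreal (off_diagonal_decay \<alpha> r C \<kappa>) * a (cell r z + \<kappa>))" .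
    qed
    finally show ?thesis .
  qed
  have pointwise: "max_fock_proj \<alpha> W f z * ennreal (exp (- (\<alpha> / 2) * (norm z)\<^sup>2)) \<le> (\<integral>\<^sup>+ i. 1 * \<Psi>' i z \<partial>count_space {..<d})" for z
  proof -
    let ?w = "\<lambda>i. vnorm (W z *\<^sub>v col (E (cell r z)) i)"
    let ?v = "\<lambda>i u. vnorm (weight_inv d W u *\<^sub>v conjugate (Matrix.row (F (cell r z)) i))"
    let ?X = "\<lambda>i u. ennreal (?v i u) * \<phi> u * ennreal (exp (- (\<alpha> / 2) * (norm (z - u))\<^sup>2))"
    note [measurable] = weight_inv_vnorm_measurable[OF W fcar[of "cell r z"]]
    have Wz: "W z \<in> carrier_mat d d" using W by (simp add: matrix_weight_def)
    have fc: "f u \<in> carrier_vec d" for u using f by (simp add: vec_measurable_def)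
    have "max_fock_proj \<alpha> W f z * ennreal (exp (- (\<alpha> / 2) * (norm z)\<^sup>2))
       \<le> (\<integral>\<^sup>+ u. (\<Sum>i<d. ennreal (c0 * ?w i) * ?X i u) \<partial>lebesgue)"
      unfolding max_fock_proj_eq[OF W f \<alpha>]
    proof (rule nn_integral_mono_AE, rule eventually_mono[OF matrix_weight_AE_good[OF W]])
      fix u assume u: "good_mat d (W u)"
      let ?e1 = "exp (- (\<alpha> / 2) * (norm (z - u))\<^sup>2)" and ?e2 = "exp (- (\<alpha> / 2) * (norm u)\<^sup>2)"
      have "vnorm (W z *\<^sub>v (weight_inv d W u *\<^sub>v f u)) \<le> (\<Sum>i<d. ?w i * ?v i u * vnorm (f u))"
        using vnorm_weight_mult_inv_le[where W = W and z = z and u = u, OF Wz u fc[of u] E F EF, of "cell r z"] u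
        by (simp add: weight_inv_def)
      then have "c0 * vnorm (W z *\<^sub>v (weight_inv d W u *\<^sub>v f u)) * ?e1 * ?e2
         \<le> c0 * (\<Sum>i<d. ?w i * ?v i u * vnorm (f u)) * ?e1 * ?e2"
        using c0 by (intro mult_right_mono mult_left_mono) auto
      also have "\<dots> = (\<Sum>i<d. c0 * ?w i * (?v i u * (vnorm (f u) * ?e2) * ?e1))"
        by (simp add: sum_distrib_left sum_distrib_right mult_ac)
      finally have "ennreal (c0 * vnorm (W z *\<^sub>v (weight_inv d W u *\<^sub>v f u)) * ?e1 * ?e2)
        \<le> ennreal (\<Sum>i<d. c0 * ?w i * (?v i u * (vnorm (f u) * ?e2) * ?e1))" by (rule ennreal_leI)
      also have "\<dots> = (\<Sum>i<d. ennreal (c0 * ?w i) * ?X i u)"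
        using c0 by (subst sum_ennreal[symmetric]) (auto simp: \<phi>_def gauss_weighted_def ennreal_mult intro!: sum.cong)
      finally show "ennreal ((\<alpha> / pi) ^ CARD('n) * vnorm (W z *\<^sub>v (weight_inv d W u *\<^sub>v f u)) * ?e1 * ?e2)
         \<le> (\<Sum>i<d. ennreal (c0 * ?w i) * ?X i u)" by (simp only: c0_def)
    qed
    also have "\<dots> = (\<Sum>i<d. ennreal (c0 * ?w i) * (\<integral>\<^sup>+ u. ?X i u \<partial>lebesgue))"
      by (subst nn_integral_sum, measurable) (intro sum.cong refl nn_integral_cmult, measurable)
    also have "\<dots> \<le> (\<Sum>i<d. ennreal (c0 * ?w i) *
       (\<integral>\<^sup>+ \<kappa>. ennreal (V powr e' * (2 * C)) * (ennreal (off_diagonal_decay \<alpha> r C \<kappa>) * a (cell r z + \<kappa>)) \<partial>count_space L))"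
      by (intro sum_mono mult_left_mono inner) auto
    also have "\<dots> = (\<Sum>i<d. \<Psi>' i z)"
    proof (rule sum.cong[OF refl])
      fix i
      have "ennreal (c0 * ?w i) *
       (\<integral>\<^sup>+ \<kappa>. ennreal (V powr e' * (2 * C)) * (ennreal (off_diagonal_decay \<alpha> r C \<kappa>) * a (cell r z + \<kappa>)) \<partial>count_space L)
       = (\<integral>\<^sup>+ \<kappa>. ennreal (c0 * ?w i) * (ennreal (V powr e' * (2 * C)) * (ennreal (off_diagonal_decay \<alpha> r C \<kappa>) * a (cell r z + \<kappa>))) \<partial>count_space L)"
        by (rule nn_integral_cmult[symmetric]) simp
      also have "\<dots> = \<Psi>' i z"
        unfolding \<Psi>'_def h_def \<Psi>_def c1_def using c0 V C
        by (intro nn_integral_cong) (simp add: ennreal_mult mult_ac)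
      finally show "ennreal (c0 * ?w i) *
       (\<integral>\<^sup>+ \<kappa>. ennreal (V powr e' * (2 * C)) * (ennreal (off_diagonal_decay \<alpha> r C \<kappa>) * a (cell r z + \<kappa>)) \<partial>count_space L) = \<Psi>' i z" .
    qed
    finally show ?thesis by (simp add: nn_integral_count_space_finite)
  qed
  have "Lp_norm p lebesgue (\<lambda>z. max_fock_proj \<alpha> W f z * ennreal (exp (- (\<alpha> / 2) * (norm z)\<^sup>2)))
     \<le> Lp_norm p lebesgue (\<lambda>z. \<integral>\<^sup>+ i. 1 * \<Psi>' i z \<partial>count_space {..<d})"
    by (rule Lp_norm_mono[OF max_fock_proj_measurable[OF W f \<alpha>] pointwise])
  also have "\<dots> \<le> (\<integral>\<^sup>+ i. 1 \<partial>count_space {..<d}) * ((ennreal c1 * S) * (ennreal (V powr e) * Lp_norm p lebesgue \<phi>))"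
    using \<Psi>'B \<Psi>'m by (intro Lp_norm_weighted_sum_le[OF p]) (auto simp: ennreal_of_nat_eq_real_of_nat)
  also have "(\<integral>\<^sup>+ i. 1 \<partial>count_space {..<d}) = ennreal (real d)"
    by (simp add: ennreal_of_nat_eq_real_of_nat)
  also have "ennreal (real d) * ((ennreal c1 * S) * (ennreal (V powr e) * Lp_norm p lebesgue \<phi>))
     = ennreal (real d * c1 * V powr e) * S * Lp_norm p lebesgue \<phi>"
    using c1 by (simp add: ennreal_mult mult_ac)
  also have "real d * c1 * V powr e = (\<alpha> / pi) ^ CARD('n) * r ^ (2 * CARD('n)) * (2 * C) * d"
  proof -
    have "V powr e * V powr e' = V"
      using V exponent_inv_conj[OF p] by (simp add: powr_add[symmetric] e_def e'_def)
    then show ?thesis unfolding c1_def c0_def V_def[symmetric] by (metis (no_types, opaque_lifting) mult.assoc mult.commute)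
  qed
  finally show ?thesis by (simp add: \<phi>_def)
qed

lemma nn_integral_exp_square_finite:
  assumes "0 < (c::real)"
  shows "(\<integral>\<^sup>+ x. ennreal (exp (- c * x\<^sup>2)) \<partial>lborel) < top"
proof -
  define \<sigma> where "\<sigma> = sqrt (1 / (2 * c))"
  have s: "\<sigma>\<^sup>2 = 1 / (2 * c)" using assms by (simp add: \<sigma>_def)
  have *: "exp (- c * x\<^sup>2) = sqrt (2 * pi * \<sigma>\<^sup>2) * normal_density 0 \<sigma> x" for x
    using assms by (simp add: normal_density_def s)
  have "0 < \<sigma>" using assms by (simp add: \<sigma>_def)
  then have "integrable lborel (\<lambda>x. sqrt (2 * pi * \<sigma>\<^sup>2) * normal_density 0 \<sigma> x)" by simp
  then have "(\<integral>\<^sup>+ x. ennreal (sqrt (2 * pi * \<sigma>\<^sup>2) * normal_density 0 \<sigma> x) \<partial>lborel) < top"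
    by (subst nn_integral_eq_integral) auto
  then show ?thesis by (simp only: *)
qed

lemma nn_integral_gaussian_finite:
  assumes "0 < (c::real)"
  shows "(\<integral>\<^sup>+ x. ennreal (exp (- c * (norm x)\<^sup>2)) \<partial>(lebesgue :: 'a::euclidean_space measure)) < top"
proof -
  have nsq: "(norm x)\<^sup>2 = (\<Sum>b\<in>Basis. (x \<bullet> b)\<^sup>2)" for x :: 'a
    unfolding power2_norm_eq_inner by (subst euclidean_inner) (simp add: power2_eq_square)
  have "ennreal (exp (- c * (norm x)\<^sup>2)) = (\<Prod>b\<in>Basis. ennreal (exp (- c * (x \<bullet> b)\<^sup>2)))" for x :: 'a
    by (subst prod_ennreal) (auto simp: exp_sum[symmetric] nsq sum_distrib_left sum_negf)
  then have "(\<integral>\<^sup>+ x. ennreal (exp (- c * (norm x)\<^sup>2)) \<partial>(lebesgue :: 'a measure))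
    = (\<integral>\<^sup>+ x. (\<Prod>b\<in>Basis. ennreal (exp (- c * (x \<bullet> b)\<^sup>2))) \<partial>(lborel :: 'a measure))"
    by (simp add: nn_integral_completion)
  also have "\<dots> = (\<Prod>b\<in>(Basis :: 'a set). (\<integral>\<^sup>+ x. ennreal (exp (- c * x\<^sup>2)) \<partial>lborel))"
    by (rule nn_integral_lborel_prod) auto
  also have "\<dots> < top"
    using nn_integral_exp_square_finite[OF assms] by (simp add: power_less_top_ennreal)
  finally show ?thesis .
qed

text \<open>Comparison with a Gaussian integral, one cell for each lattice point.\<close>

lemma cube_lattice_gauss_sum_finite:
  assumes \<beta>: "0 < \<beta>" and r: "0 < r"
  shows "(\<integral>\<^sup>+ \<kappa>. ennreal (exp (- \<beta> * (norm \<kappa>)\<^sup>2)) \<partial>count_space (cube_lattice r :: (complex^'n) set)) < top"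
proof -
  define V where "V = r ^ (2 * CARD('n))"
  have V: "0 < V" using r by (simp add: V_def)
  define D where "D = r * (2 * CARD('n))"
  have cell_V: "ennreal V \<le> emeasure lebesgue (cell_set r \<kappa>)" if "\<kappa> \<in> cube_lattice r" for \<kappa> :: "complex^'n"
  proof -
    have "box \<kappa> (\<kappa> + r *\<^sub>R (\<Sum>b\<in>Basis. b)) \<subseteq> cell_set r \<kappa>"
    proof
      fix z assume z: "z \<in> box \<kappa> (\<kappa> + r *\<^sub>R (\<Sum>b\<in>Basis. b))"
      have "cell r z = \<kappa>"
      proof (rule euclidean_eqI)
        fix b :: "complex^'n" assume b: "b \<in> Basis"
        then obtain m where m: "(\<kappa> \<bullet> b) / r = of_int m"
          using \<open>\<kappa> \<in> cube_lattice r\<close> by (auto simp: cube_lattice_def Ints_def)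
        have "\<kappa> \<bullet> b < z \<bullet> b" "z \<bullet> b < \<kappa> \<bullet> b + r"
          using z b by (auto simp: mem_box inner_add_left inner_sum_Basis)
        moreover have "\<kappa> \<bullet> b = r * of_int m" using m r by (simp add: field_simps)
        ultimately have "\<lfloor>(z \<bullet> b) / r\<rfloor> = m"
          using r by (intro floor_unique) (auto simp: field_simps)
        then show "cell r z \<bullet> b = \<kappa> \<bullet> b" using b \<open>\<kappa> \<bullet> b = r * of_int m\<close> by (simp add: cell_inner)
      qed
      then show "z \<in> cell_set r \<kappa>" by (simp add: cell_set_def)
    qed
    moreover have "emeasure lebesgue (box \<kappa> (\<kappa> + r *\<^sub>R (\<Sum>b\<in>Basis. b))) = ennreal V"
      using r by (simp add: emeasure_lborel_box inner_add_left inner_sum_Basis V_def mult.commute)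
    ultimately show ?thesis by (metis emeasure_mono cell_set_measurable)
  qed
  have le: "ennreal (exp (- \<beta> * (norm \<kappa>)\<^sup>2)) \<le> ennreal (1 / V) *
     (\<integral>\<^sup>+ u. ennreal (exp (\<beta> * D\<^sup>2) * exp (- (\<beta> / 2) * (norm u)\<^sup>2)) * indicator (cell_set r \<kappa>) u \<partial>lebesgue)"
    if "\<kappa> \<in> cube_lattice r" for \<kappa> :: "complex^'n"
  proof -
    have "ennreal (exp (- \<beta> * (norm \<kappa>)\<^sup>2)) = ennreal (1 / V) * (ennreal (exp (- \<beta> * (norm \<kappa>)\<^sup>2)) * ennreal V)"
      using V by (simp add: ennreal_mult[symmetric])
    also have "\<dots> \<le> ennreal (1 / V) * (ennreal (exp (- \<beta> * (norm \<kappa>)\<^sup>2)) * emeasure lebesgue (cell_set r \<kappa>))"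
      by (intro mult_left_mono cell_V that) auto
    also have "\<dots> = ennreal (1 / V) * (\<integral>\<^sup>+ u. ennreal (exp (- \<beta> * (norm \<kappa>)\<^sup>2)) * indicator (cell_set r \<kappa>) u \<partial>lebesgue)"
      by (subst nn_integral_cmult_indicator) auto
    also have "\<dots> \<le> ennreal (1 / V) *
     (\<integral>\<^sup>+ u. ennreal (exp (\<beta> * D\<^sup>2) * exp (- (\<beta> / 2) * (norm u)\<^sup>2)) * indicator (cell_set r \<kappa>) u \<partial>lebesgue)"
    proof (intro mult_left_mono nn_integral_mono)
      fix u :: "complex^'n"
      have "exp (- \<beta> * (norm \<kappa>)\<^sup>2) \<le> exp (\<beta> * D\<^sup>2) * exp (- (\<beta> / 2) * (norm u)\<^sup>2)" if "cell r u = \<kappa>"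
      proof -
        have "norm u \<le> norm \<kappa> + D"
          using norm_diff_cell_le[OF r, of u] norm_triangle_ineq2[of u \<kappa>] by (simp add: that D_def)
        then have "(norm u)\<^sup>2 \<le> (norm \<kappa> + D)\<^sup>2" by (intro power_mono) auto
        also have "\<dots> \<le> 2 * (norm \<kappa>)\<^sup>2 + 2 * D\<^sup>2"
          using zero_le_power2[of "norm \<kappa> - D"] by (simp add: power2_eq_square algebra_simps)
        finally have "(\<beta> / 2) * (norm u)\<^sup>2 \<le> (\<beta> / 2) * (2 * (norm \<kappa>)\<^sup>2 + 2 * D\<^sup>2)"
          using \<beta> by (intro mult_left_mono) auto
        then show ?thesis by (simp add: exp_add[symmetric] algebra_simps)
      qed
      then show "ennreal (exp (- \<beta> * (norm \<kappa>)\<^sup>2)) * indicator (cell_set r \<kappa>) u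
        \<le> ennreal (exp (\<beta> * D\<^sup>2) * exp (- (\<beta> / 2) * (norm u)\<^sup>2)) * indicator (cell_set r \<kappa>) u"
        by (auto simp: indicator_def cell_set_def intro!: ennreal_leI)
    qed auto
    finally show ?thesis .
  qed
  have m: "(\<lambda>u :: complex^'n. ennreal (exp (\<beta> * D\<^sup>2) * exp (- (\<beta> / 2) * (norm u)\<^sup>2))) \<in> borel_measurable lebesgue"
    by (intro measurable_completion) measurable
  have "(\<integral>\<^sup>+ \<kappa>. ennreal (exp (- \<beta> * (norm \<kappa>)\<^sup>2)) \<partial>count_space (cube_lattice r :: (complex^'n) set))
    \<le> (\<integral>\<^sup>+ \<kappa>. ennreal (1 / V) * (\<integral>\<^sup>+ u. ennreal (exp (\<beta> * D\<^sup>2) * exp (- (\<beta> / 2) * (norm u)\<^sup>2)) * indicator (cell_set r \<kappa>) u \<partial>lebesgue)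
        \<partial>count_space (cube_lattice r :: (complex^'n) set))"
    using le by (intro nn_integral_mono) auto
  also have "\<dots> = ennreal (1 / V) * (\<integral>\<^sup>+ \<kappa>. (\<integral>\<^sup>+ u. ennreal (exp (\<beta> * D\<^sup>2) * exp (- (\<beta> / 2) * (norm u)\<^sup>2)) * indicator (cell_set r \<kappa>) u \<partial>lebesgue)
        \<partial>count_space (cube_lattice r :: (complex^'n) set))"
    by (rule nn_integral_cmult) simp
  also have "\<dots> = ennreal (1 / V) * (\<integral>\<^sup>+ u. ennreal (exp (\<beta> * D\<^sup>2) * exp (- (\<beta> / 2) * (norm u)\<^sup>2)) \<partial>(lebesgue :: (complex^'n) measure))"
    by (simp only: nn_integral_by_cells[OF r m])
  also have "\<dots> = ennreal (1 / V) * (ennreal (exp (\<beta> * D\<^sup>2)) * (\<integral>\<^sup>+ u. ennreal (exp (- (\<beta> / 2) * (norm u)\<^sup>2)) \<partial>(lebesgue :: (complex^'n) measure)))"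
  proof -
    have m': "(\<lambda>u :: complex^'n. ennreal (exp (- (\<beta> / 2) * (norm u)\<^sup>2))) \<in> borel_measurable lebesgue"
      by (intro measurable_completion) measurable
    show ?thesis by (subst nn_integral_cmult[OF m', symmetric]) (simp add: ennreal_mult)
  qed
  also have "\<dots> < top"
    using nn_integral_gaussian_finite[of "\<beta> / 2", where 'a = "complex^'n"] \<beta> by (simp add: ennreal_mult_less_top)
  finally show ?thesis .
qed

text \<open>With \<open>l = ln (4\<^sup>n C)\<close> and \<open>t = \<bar>\<kappa>\<bar>\<close> the chain contributes the exponent \<open>(2 t / r + 1) l\<close>. Completing the
square bounds \<open>(2 t / r) l\<close> by \<open>\<alpha> t\<^sup>2 / 8 + 8 l\<^sup>2 / (\<alpha> r\<^sup>2)\<close>; half of the Gaussian exponent remains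
for the summation over \<open>\<kappa>\<close>, and the term with \<open>l\<^sup>2\<close> is the source of \<open>[W]\<close> to the power \<open>log [W]\<close>.\<close>

lemma off_diagonal_decay_le:
  fixes \<kappa> :: "complex^'n"
  assumes \<alpha>: "0 < \<alpha>" and r: "0 < r" and C: "1 \<le> C"
  defines "b \<equiv> ln (4 ^ CARD('n))"
  shows "off_diagonal_decay \<alpha> r C \<kappa> \<le>
    exp (8 * \<alpha> * (r * CARD('n))\<^sup>2 + b + (16 / (\<alpha> * r\<^sup>2)) * b\<^sup>2) * exp (ln C + (16 / (\<alpha> * r\<^sup>2)) * (ln C)\<^sup>2)
      * exp (- (\<alpha> / 8) * (norm \<kappa>)\<^sup>2)"
proof -
  define t where "t = norm \<kappa>"
  define l where "l = b + ln C"
  have t: "0 \<le> t" by (simp add: t_def)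
  have b: "0 \<le> b" by (simp add: b_def)
  have lC: "0 \<le> ln C" using C by simp
  have l: "0 \<le> l" using b lC by (simp add: l_def)
  have base: "4 ^ CARD('n) * C = exp l"
    using C by (simp add: l_def b_def exp_add)
  have "(4 ^ CARD('n) * C) ^ chain_length r \<kappa> = exp (real (chain_length r \<kappa>) * l)"
    unfolding base by (simp add: exp_of_nat_mult)
  moreover have "real (chain_length r \<kappa>) \<le> 2 * t / r + 1"
  proof -
    have "0 \<le> 2 * t / r" using t r by simp
    then show ?thesis unfolding chain_length_def t_def by linarith
  qed
  then have "real (chain_length r \<kappa>) * l \<le> (2 * t / r + 1) * l" using l by (rule mult_right_mono)
  moreover have "(2 * t / r) * l \<le> \<alpha> * t\<^sup>2 / 8 + 8 * l\<^sup>2 / (\<alpha> * r\<^sup>2)"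
  proof -
    have "0 \<le> (\<alpha> * t * r / 8 - l)\<^sup>2 * (8 / (\<alpha> * r\<^sup>2))" using \<alpha> by simp
    also have "\<dots> = \<alpha> * t\<^sup>2 / 8 + 8 * l\<^sup>2 / (\<alpha> * r\<^sup>2) - (2 * t / r) * l"
      using \<alpha> r by (simp add: power2_eq_square field_simps)
    finally show ?thesis by simp
  qed
  moreover have "8 * l\<^sup>2 / (\<alpha> * r\<^sup>2) \<le> (16 / (\<alpha> * r\<^sup>2)) * b\<^sup>2 + (16 / (\<alpha> * r\<^sup>2)) * (ln C)\<^sup>2"
  proof -
    have "l\<^sup>2 \<le> 2 * b\<^sup>2 + 2 * (ln C)\<^sup>2"
      using zero_le_power2[of "b - ln C"] by (simp add: l_def power2_eq_square algebra_simps)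
    then have "(8 / (\<alpha> * r\<^sup>2)) * l\<^sup>2 \<le> (8 / (\<alpha> * r\<^sup>2)) * (2 * b\<^sup>2 + 2 * (ln C)\<^sup>2)"
      using \<alpha> by (intro mult_left_mono) auto
    then show ?thesis by (simp add: distrib_left)
  qed
  ultimately show ?thesis
    unfolding off_diagonal_decay_def t_def[symmetric]
    by (simp add: exp_add[symmetric] l_def algebra_simps)
qed

lemma weighted_space_vec_measurable:
  "f \<in> weighted_space \<alpha> p d W \<Longrightarrow> vec_measurable d lebesgue f"
  by (simp add: weighted_space_def vec_measurable_def)

lemma weighted_norm_eq_Lp_norm:
  assumes "1 \<le> p"
  shows "weighted_norm \<alpha> p W f = Lp_norm p lebesgue (gauss_weighted \<alpha> (\<lambda>z. W z *\<^sub>v f z))"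
  by (simp add: weighted_norm_def gauss_norm_eq_Lp_norm[OF assms] gauss_weighted_def[abs_def] ennreal_mult)

lemma weighted_norm_one:
  assumes "1 \<le> p" "\<And>z. f z \<in> carrier_vec d"
  shows "weighted_norm \<alpha> p (\<lambda>_. 1\<^sub>m d) f = Lp_norm p lebesgue (gauss_weighted \<alpha> f)"
  using assms by (simp add: weighted_norm_eq_Lp_norm gauss_weighted_def[abs_def])

text \<open>The exponent \<open>2 ln C + m (ln C)\<^sup>2\<close> collects one factor \<open>C\<close> from the adapted basis, one from the
rounding of the chain length, and the completed square; it is at most \<open>c (1 + ln C) ln C\<close> for
\<open>c \<ge> max 2 m\<close>.\<close>

lemma max_fock_proj_bound_of_A_metric_bound:
  assumes p: "1 \<le> p" and \<alpha>: "0 < \<alpha>" and r: "0 < r"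
  shows "\<exists>c>0. \<forall>d\<ge>1. \<forall>W :: complex^'n \<Rightarrow> complex Matrix.mat. \<forall>C\<ge>1. \<forall>s\<ge>1.
    matrix_weight d W \<longrightarrow> A_metric_bound p r d (\<lambda>z x. ennreal (vnorm (W z *\<^sub>v x))) C \<longrightarrow>
    max_fock_proj_bound \<alpha> p d W (c * real d powr s * C powr (c * (1 + ln C)))"
proof -
  define b where "b = ln (4 ^ CARD('n) :: real)"
  define m where "m = 16 / (\<alpha> * r\<^sup>2)"
  have m: "0 < m" using \<alpha> r by (simp add: m_def)
  define K1 where "K1 = exp (8 * \<alpha> * (r * CARD('n))\<^sup>2 + b + m * b\<^sup>2)"
  have K1: "0 < K1" by (simp add: K1_def)
  obtain G where G: "(\<integral>\<^sup>+ \<kappa>. ennreal (exp (- (\<alpha> / 8) * (norm \<kappa>)\<^sup>2)) \<partial>count_space (cube_lattice r :: (complex^'n) set)) = ennreal G" "0 \<le> G"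
    using cube_lattice_gauss_sum_finite[of "\<alpha> / 8" r, where 'n = 'n] \<alpha> r
    by (cases "\<integral>\<^sup>+ \<kappa>. ennreal (exp (- (\<alpha> / 8) * (norm \<kappa>)\<^sup>2)) \<partial>count_space (cube_lattice r :: (complex^'n) set)") auto
  define K2 where "K2 = (\<alpha> / pi) ^ CARD('n) * r ^ (2 * CARD('n)) * 2 * K1 * G"
  have K2: "0 \<le> K2" using \<alpha> r K1 G by (simp add: K2_def)
  define c where "c = max K2 (2 + m)"
  have c: "0 < c" "K2 \<le> c" "2 \<le> c" "m \<le> c" using m by (auto simp: c_def)
  show ?thesis
  proof (intro exI[of _ c] conjI c(1) allI impI)
    fix d and W :: "complex^'n \<Rightarrow> complex Matrix.mat" and C s :: real
    assume d: "1 \<le> d" and C: "1 \<le> C" and s: "1 \<le> s" and W: "matrix_weight d W"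
      and A: "A_metric_bound p r d (\<lambda>z x. ennreal (vnorm (W z *\<^sub>v x))) C"
    define L where "L = ln C"
    have L: "0 \<le> L" using C by (simp add: L_def)
    define S where "S = (\<integral>\<^sup>+ \<kappa>. ennreal (off_diagonal_decay \<alpha> r C \<kappa>) \<partial>count_space (cube_lattice r :: (complex^'n) set))"
    have "S \<le> (\<integral>\<^sup>+ \<kappa>. ennreal (K1 * exp (L + m * L\<^sup>2)) * ennreal (exp (- (\<alpha> / 8) * (norm \<kappa>)\<^sup>2)) \<partial>count_space (cube_lattice r :: (complex^'n) set))"
      unfolding S_def
    proof (rule nn_integral_mono)
      fix \<kappa> :: "complex^'n"
      have "off_diagonal_decay \<alpha> r C \<kappa> \<le> K1 * exp (L + m * L\<^sup>2) * exp (- (\<alpha> / 8) * (norm \<kappa>)\<^sup>2)"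
        unfolding K1_def m_def L_def b_def by (rule off_diagonal_decay_le[OF \<alpha> r C])
      then have "ennreal (off_diagonal_decay \<alpha> r C \<kappa>) \<le> ennreal (K1 * exp (L + m * L\<^sup>2) * exp (- (\<alpha> / 8) * (norm \<kappa>)\<^sup>2))"
        by (rule ennreal_leI)
      also have "\<dots> = ennreal (K1 * exp (L + m * L\<^sup>2)) * ennreal (exp (- (\<alpha> / 8) * (norm \<kappa>)\<^sup>2))"
        using K1 by (intro ennreal_mult) auto
      finally show "ennreal (off_diagonal_decay \<alpha> r C \<kappa>)
        \<le> ennreal (K1 * exp (L + m * L\<^sup>2)) * ennreal (exp (- (\<alpha> / 8) * (norm \<kappa>)\<^sup>2))" .
    qed
    also have "\<dots> = ennreal (K1 * exp (L + m * L\<^sup>2)) * ennreal G"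
      using G by (subst nn_integral_cmult) auto
    finally have S: "S \<le> ennreal (K1 * exp (L + m * L\<^sup>2) * G)"
      using K1 G by (simp add: ennreal_mult)
    then have Sfin: "S < top" by (auto intro: le_less_trans)
    define B where "B = (\<alpha> / pi) ^ CARD('n) * r ^ (2 * CARD('n)) * (2 * C) * d"
    have B: "0 \<le> B" using \<alpha> r C by (simp add: B_def)
    have "ennreal B * S \<le> ennreal B * ennreal (K1 * exp (L + m * L\<^sup>2) * G)"
      using S by (rule mult_left_mono) simp
    also have "\<dots> = ennreal (B * (K1 * exp (L + m * L\<^sup>2) * G))"
      using B K1 G by (simp add: ennreal_mult)
    also have "B * (K1 * exp (L + m * L\<^sup>2) * G) = K2 * d * exp (2 * L + m * L\<^sup>2)"
    proof -
      have "exp L = C" using C by (simp add: L_def)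
      then have "exp (L + m * L\<^sup>2) = C * exp (m * L\<^sup>2)" "exp (2 * L + m * L\<^sup>2) = C * C * exp (m * L\<^sup>2)"
        by (simp_all only: exp_add exp_double power2_eq_square)
      then show ?thesis by (simp add: B_def K2_def mult_ac)
    qed
    also have "K2 * d * exp (2 * L + m * L\<^sup>2) \<le> c * (real d powr s) * C powr (c * (1 + ln C))"
    proof (intro mult_mono)
      have "real d powr 1 \<le> real d powr s" using d s by (intro powr_mono) auto
      then show "real d \<le> real d powr s" using d by simp
      have "2 * L + m * L\<^sup>2 \<le> c * L + c * L\<^sup>2" using L c by (intro add_mono mult_right_mono) auto
      also have "\<dots> = c * (1 + ln C) * ln C" by (simp add: L_def power2_eq_square algebra_simps)
      finally show "exp (2 * L + m * L\<^sup>2) \<le> C powr (c * (1 + ln C))" using C by (simp add: powr_def)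
    qed (use c K2 in auto)
    finally have BS: "ennreal B * S \<le> ennreal (c * (real d powr s) * C powr (c * (1 + ln C)))"
      by (simp add: ennreal_leI)
    show "max_fock_proj_bound \<alpha> p d W (c * real d powr s * C powr (c * (1 + ln C)))"
      unfolding max_fock_proj_bound_def
    proof (intro conjI ballI)
      show "0 \<le> c * real d powr s * C powr (c * (1 + ln C))" using c by simp
      fix f :: "complex^'n \<Rightarrow> complex Matrix.vec" assume "f \<in> weighted_space \<alpha> p d (\<lambda>_. 1\<^sub>m d)"
      then have f: "vec_measurable d lebesgue f" by (rule weighted_space_vec_measurable)
      have "gauss_norm \<alpha> p (max_fock_proj \<alpha> W f) \<le> (ennreal B * S) * Lp_norm p lebesgue (gauss_weighted \<alpha> f)"
        unfolding gauss_norm_eq_Lp_norm[OF p] B_def S_def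
        by (rule max_fock_proj_Lp_bound[OF p \<alpha> r W A f Sfin[unfolded S_def]])
      also have "\<dots> \<le> ennreal (c * (real d powr s) * C powr (c * (1 + ln C))) * Lp_norm p lebesgue (gauss_weighted \<alpha> f)"
        by (intro mult_right_mono BS) simp
      also have "Lp_norm p lebesgue (gauss_weighted \<alpha> f) = weighted_norm \<alpha> p (\<lambda>_. 1\<^sub>m d) f"
        using f by (simp add: weighted_norm_one[OF p] vec_measurable_def)
      finally show "gauss_norm \<alpha> p (max_fock_proj \<alpha> W f)
        \<le> ennreal (c * real d powr s * C powr (c * (1 + ln C))) * weighted_norm \<alpha> p (\<lambda>_. 1\<^sub>m d) f" .
    qed
  qed
qed

section \<open>From the maximal projection to the projection\<close>

lemma Lp_norm_finite_AE:
  assumes p: "1 \<le> p" and g[measurable]: "g \<in> borel_measurable M" and fin: "Lp_norm p M g < top"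
  shows "AE x in M. g x < top"
proof (cases p)
  case top
  then show ?thesis using esssup_AE[of g M] fin by (auto elim!: eventually_mono simp: Lp_norm_top)
next
  case (real q)
  with p have "1 \<le> q" by (simp flip: ennreal_1)
  then have "(\<integral>\<^sup>+ x. ennpow (g x) q \<partial>M) \<noteq> top"
    using fin real by (auto simp: Lp_norm_real)
  then have "AE x in M. ennpow (g x) q \<noteq> top"
    by (intro nn_integral_PInf_AE[unfolded infinity_ennreal_def]) auto
  then show ?thesis by eventually_elim (simp add: less_top)
qed

text \<open>The vector-valued triangle inequality for integrals, by pairing with the value of the integral.\<close>

lemma vnorm_integral_le:
  assumes F: "\<And>i. i < d \<Longrightarrow> integrable M (\<lambda>u. F u $ i)" and Fc: "\<And>u. F u \<in> carrier_vec d"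
  shows "ennreal (vnorm (Matrix.vec d (\<lambda>i. LINT u|M. F u $ i))) \<le> (\<integral>\<^sup>+ u. ennreal (vnorm (F u)) \<partial>M)"
proof -
  define v where "v = Matrix.vec d (\<lambda>i. LINT u|M. F u $ i)"
  have v: "v \<in> carrier_vec d" by (simp add: v_def)
  have m: "vec_measurable d M F" using F Fc by (auto simp: vec_measurable_def)
  note [measurable] = vec_measurable_vnorm[OF m]
  have int: "integrable M (\<lambda>u. \<Sum>i<d. F u $ i * cnj (v $ i))"
    using F by (intro Bochner_Integration.integrable_sum integrable_mult_left) auto
  have "complex_of_real ((vnorm v)\<^sup>2) = (\<Sum>i<d. (LINT u|M. F u $ i) * cnj (v $ i))"
    unfolding cscalar_self[symmetric] cscalar_sum[OF v] by (simp add: v_def)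
  also have "\<dots> = (LINT u|M. (\<Sum>i<d. F u $ i * cnj (v $ i)))"
    using F by (subst Bochner_Integration.integral_sum) (auto intro!: sum.cong integrable_mult_left)
  finally have "ennreal (cmod (complex_of_real ((vnorm v)\<^sup>2))) \<le> (\<integral>\<^sup>+ u. ennreal (cmod (\<Sum>i<d. F u $ i * cnj (v $ i))) \<partial>M)"
    using integral_norm_bound_ennreal[OF int] by simp
  also have "\<dots> \<le> (\<integral>\<^sup>+ u. ennreal (vnorm (F u)) * ennreal (vnorm v) \<partial>M)"
    using cscalar_Cauchy_Schwarz[OF Fc v] unfolding cscalar_sum[OF v]
    by (intro nn_integral_mono) (simp add: ennreal_mult[symmetric] ennreal_leI)
  also have "\<dots> = (\<integral>\<^sup>+ u. ennreal (vnorm (F u)) \<partial>M) * ennreal (vnorm v)"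
    by (rule nn_integral_multc) measurable
  finally have *: "ennreal ((vnorm v)\<^sup>2) \<le> (\<integral>\<^sup>+ u. ennreal (vnorm (F u)) \<partial>M) * ennreal (vnorm v)"
    by (simp add: norm_mult power2_eq_square)
  show ?thesis
  proof (cases "vnorm v = 0")
    case False
    then have pos: "0 < vnorm v" by (simp add: less_le)
    have "ennreal (vnorm v) = ennreal ((vnorm v)\<^sup>2) / ennreal (vnorm v)"
      using pos by (simp add: divide_ennreal power2_eq_square)
    also have "\<dots> \<le> (\<integral>\<^sup>+ u. ennreal (vnorm (F u)) \<partial>M)"
      using * by (rule ennreal_divide_le_if_le_mult)
    finally show ?thesis by (simp add: v_def)
  qed (simp add: v_def)
qed

lemma borel_measurable_cnj [measurable]:
  assumes "f \<in> borel_measurable M" shows "(\<lambda>x. cnj (f x)) \<in> borel_measurable M"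
  by (rule measurable_compose[OF assms]) (intro borel_measurable_continuous_onI continuous_intros)

lemma fock_kernel_measurable_right:
  "fock_kernel \<alpha> z \<in> borel_measurable (lebesgue :: (complex^'n) measure)"
proof -
  have "fock_kernel \<alpha> z \<in> borel_measurable (borel :: (complex^'n) measure)"
    unfolding fock_kernel_def[abs_def] herm_def
    by (intro borel_measurable_continuous_onI continuous_intros)
  then show ?thesis by (rule borel_measurable_lebesgue_if_borel)
qed

lemma measurable_gauss_measure:
  "f \<in> borel_measurable (lebesgue :: (complex^'n) measure) \<Longrightarrow> f \<in> borel_measurable (gauss_measure \<alpha>)"
  by (simp add: gauss_measure_def)

lemma integral_gauss_measure:
  fixes h :: "complex^'n \<Rightarrow> complex"
  assumes "h \<in> borel_measurable lebesgue" and \<alpha>: "0 < \<alpha>"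
  shows "(LINT u|gauss_measure \<alpha>. h u) = (LINT u|lebesgue. ((\<alpha> / pi) ^ CARD('n) * exp (- \<alpha> * (norm u)\<^sup>2)) *\<^sub>R h u)"
  unfolding gauss_measure_def
proof (rule integral_density)
  show "(\<lambda>u :: complex^'n. (\<alpha> / pi) ^ CARD('n) * exp (- \<alpha> * (norm u)\<^sup>2)) \<in> borel_measurable lebesgue"
    by (intro measurable_completion) measurable
qed (use assms in auto)

lemma fock_proj_vec_measurable:
  fixes f :: "complex^'n \<Rightarrow> complex Matrix.vec"
  assumes f: "vec_measurable d lebesgue f" and \<alpha>: "0 < \<alpha>"
  shows "vec_measurable d lebesgue (fock_proj \<alpha> d f)"
  unfolding vec_measurable_def
proof (intro conjI allI impI)
  fix i assume i: "i < d"
  let ?M = "lebesgue \<Otimes>\<^sub>M lebesgue :: ((complex^'n) \<times> (complex^'n)) measure"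
  have fi[measurable]: "(\<lambda>u. f u $ i) \<in> borel_measurable lebesgue" using f i by (simp add: vec_measurable_def)
  note [measurable] = fock_kernel_measurable_right
  have eq: "fock_proj \<alpha> d f z $ i = (LINT u|lebesgue. ((\<alpha> / pi) ^ CARD('n) * exp (- \<alpha> * (norm u)\<^sup>2)) *\<^sub>R (f u $ i * cnj (fock_kernel \<alpha> z u)))" for z
  proof -
    have "(\<lambda>u. f u $ i * cnj (fock_kernel \<alpha> z u)) \<in> borel_measurable lebesgue" by measurable
    from integral_gauss_measure[OF this \<alpha>] show ?thesis using i by (simp add: fock_proj_def)
  qed
  have id_borel: "(\<lambda>z. z) \<in> lebesgue \<rightarrow>\<^sub>M (borel :: (complex^'n) measure)"
    by (intro measurable_completion) simp
  have fs: "fst \<in> borel_measurable ?M" "snd \<in> borel_measurable ?M"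
    using measurable_compose[OF measurable_fst id_borel] measurable_compose[OF measurable_snd id_borel]
    by auto
  note [measurable] = fs
  have "(\<lambda>x. fock_kernel \<alpha> (fst x) (snd x)) \<in> borel_measurable ?M"
  proof -
    have "(\<lambda>x :: (complex^'n) \<times> (complex^'n). fock_kernel \<alpha> (fst x) (snd x)) \<in> borel_measurable borel"
      unfolding fock_kernel_def[abs_def] herm_def
      by (intro borel_measurable_continuous_onI continuous_intros)
    moreover have "(\<lambda>x. (fst x, snd x)) \<in> ?M \<rightarrow>\<^sub>M borel"
      using fs by (rule borel_measurable_Pair)
    ultimately show ?thesis using measurable_compose by fastforce
  qed
  moreover have "(\<lambda>x. f (snd x) $ i) \<in> borel_measurable ?M"
    using measurable_compose[OF measurable_snd fi] by auto
  ultimately show "(\<lambda>z. fock_proj \<alpha> d f z $ i) \<in> borel_measurable lebesgue"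
    unfolding eq
    by (intro lebesgue.borel_measurable_lebesgue_integral) (unfold split_beta, measurable)
qed (simp add: fock_proj_def)

text \<open>The maximal projection is applied to \<open>g = W f\<close>. Where it is finite, the invertibility of \<open>W z\<close> gives the
absolute convergence of the integral that defines \<open>P f z\<close>, as \<open>\<bar>f\<bar>\<close> is at most a constant
(depending on \<open>z\<close>) times \<open>\<bar>W z f\<bar>\<close>.\<close>

lemma fock_proj_bound_of_max_fock_proj_bound:
  fixes W :: "complex^'n \<Rightarrow> complex Matrix.mat"
  assumes p: "1 \<le> p" and \<alpha>: "0 < \<alpha>" and W: "matrix_weight d W"
    and bound: "max_fock_proj_bound \<alpha> p d W C"
  shows "fock_proj_bound \<alpha> p d W C"
  unfolding fock_proj_bound_def
proof (intro conjI ballI)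
  show C: "0 \<le> C" using bound by (simp add: max_fock_proj_bound_def)
  fix f assume f: "f \<in> weighted_space \<alpha> p d W"
  have fm: "vec_measurable d lebesgue f" by (rule weighted_space_vec_measurable[OF f])
  have fc: "f u \<in> carrier_vec d" for u using fm by (simp add: vec_measurable_def)
  have Wc: "W z \<in> carrier_mat d d" for z using W by (simp add: matrix_weight_def)
  define g where "g z = W z *\<^sub>v f z" for z
  have gm: "vec_measurable d lebesgue g"
    unfolding g_def by (rule vec_measurable_mult[OF matrix_weight_measurable[OF W] fm])
  have gc: "g u \<in> carrier_vec d" for u using gm by (simp add: vec_measurable_def)
  have norm_g: "weighted_norm \<alpha> p (\<lambda>_. 1\<^sub>m d) g = weighted_norm \<alpha> p W f"
    unfolding weighted_norm_one[OF p gc] weighted_norm_eq_Lp_norm[OF p] by (simp add: g_def)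
  have "weighted_norm \<alpha> p W f < top" using f by (simp add: weighted_space_def)
  then have g: "g \<in> weighted_space \<alpha> p d (\<lambda>_. 1\<^sub>m d)"
    using gm norm_g by (simp add: weighted_space_def vec_measurable_def)
  have le: "gauss_norm \<alpha> p (max_fock_proj \<alpha> W g) \<le> ennreal C * weighted_norm \<alpha> p W f"
    using bound g norm_g by (auto simp: max_fock_proj_bound_def)
  also have "\<dots> < top" using f by (simp add: weighted_space_def ennreal_mult_less_top)
  finally have fin: "gauss_norm \<alpha> p (max_fock_proj \<alpha> W g) < top" .
  have AEg: "AE u in gauss_measure \<alpha>. good_mat d (W u)"
    using matrix_weight_AE_good[OF W] unfolding gauss_measure_def
    by (subst AE_density) (auto intro!: measurable_completion elim: eventually_mono)
  have max_eq: "max_fock_proj \<alpha> W g z = (\<integral>\<^sup>+ u. ennreal (vnorm (W z *\<^sub>v f u) * cmod (fock_kernel \<alpha> z u)) \<partial>gauss_measure \<alpha>)" for z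
    unfolding max_fock_proj_def g_def
    using AEg by (intro nn_integral_cong_AE) (auto elim!: eventually_mono simp: good_mat_inverse(4)[OF _ fc])
  have "AE z in lebesgue. max_fock_proj \<alpha> W g z * ennreal (exp (- (\<alpha> / 2) * (norm z)\<^sup>2)) < top"
    using fin unfolding gauss_norm_eq_Lp_norm[OF p]
    by (rule Lp_norm_finite_AE[OF p max_fock_proj_measurable[OF W gm \<alpha>]])
  then have finAE: "AE z in lebesgue. max_fock_proj \<alpha> W g z < top"
    by eventually_elim (auto simp: ennreal_mult_less_top ennreal_mult_eq_top_iff less_top)
  note [measurable] = fock_kernel_measurable_right
  have fi[measurable]: "(\<lambda>u. f u $ i) \<in> borel_measurable lebesgue" if "i < d" for i
    using fm that by (simp add: vec_measurable_def)
  have conv: "fock_converges \<alpha> d f z" if z: "good_mat d (W z)" "max_fock_proj \<alpha> W g z < top" for z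
    unfolding fock_converges_def
  proof (intro allI impI)
    fix i assume i: "i < d"
    note inv = good_mat_inverse[OF z(1)]
    define K where "K = (\<Sum>i<d. \<Sum>j<d. cmod (inv_mat (W z) $$ (i, j)))"
    have K: "0 \<le> K" "\<And>v. v \<in> carrier_vec d \<Longrightarrow> vnorm (inv_mat (W z) *\<^sub>v v) \<le> K * vnorm v"
      unfolding K_def by (auto intro!: sum_nonneg vnorm_mult_mat_le_entries[OF inv(2)])
    have fle: "cmod (f u $ i) \<le> K * vnorm (W z *\<^sub>v f u)" for u
    proof -
      have "cmod (f u $ i) \<le> vnorm (f u)" using cmod_index_le_vnorm[of i "f u"] fc[of u] i by simp
      also have "vnorm (f u) \<le> K * vnorm (W z *\<^sub>v f u)"
        using K(2)[of "W z *\<^sub>v f u"] inv(4)[OF fc] Wc[of z] fc[of u] by simp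
      finally show ?thesis .
    qed
    show "integrable (gauss_measure \<alpha>) (\<lambda>u. f u $ i * cnj (fock_kernel \<alpha> z u))"
    proof (rule integrableI_bounded)
      have m: "(\<lambda>u. f u $ i * cnj (fock_kernel \<alpha> z u)) \<in> borel_measurable lebesgue" using i by measurable
      then show "(\<lambda>u. f u $ i * cnj (fock_kernel \<alpha> z u)) \<in> borel_measurable (gauss_measure \<alpha>)"
        by (rule measurable_gauss_measure)
      have m2: "(\<lambda>u. ennreal (vnorm (W z *\<^sub>v f u) * cmod (fock_kernel \<alpha> z u))) \<in> borel_measurable (gauss_measure \<alpha>)"
      proof -
        have "mat_measurable d lebesgue (\<lambda>_ :: complex^'n. W z)" using Wc by (simp add: mat_measurable_def)
        note [measurable] = vec_measurable_vnorm[OF vec_measurable_mult[OF this fm]]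
        show ?thesis by (rule measurable_gauss_measure) measurable
      qed
      have "(\<integral>\<^sup>+ u. ennreal (norm (f u $ i * cnj (fock_kernel \<alpha> z u))) \<partial>gauss_measure \<alpha>)
         \<le> (\<integral>\<^sup>+ u. ennreal K * ennreal (vnorm (W z *\<^sub>v f u) * cmod (fock_kernel \<alpha> z u)) \<partial>gauss_measure \<alpha>)"
        using fle K(1) by (intro nn_integral_mono)
          (simp add: norm_mult ennreal_mult[symmetric] ennreal_leI mult.assoc[symmetric] mult_right_mono)
      also have "\<dots> = ennreal K * max_fock_proj \<alpha> W g z"
        unfolding max_eq by (rule nn_integral_cmult[OF m2])
      also have "\<dots> < top" using z by (simp add: ennreal_mult_less_top)
      finally show "(\<integral>\<^sup>+ u. ennreal (norm (f u $ i * cnj (fock_kernel \<alpha> z u))) \<partial>gauss_measure \<alpha>) < \<infinity>" by simp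
    qed
  qed
  show "AE z in lebesgue. fock_converges \<alpha> d f z"
    using matrix_weight_AE_good[OF W] finAE by eventually_elim (rule conv)
  have ptw: "AE z in lebesgue. ennreal (vnorm (W z *\<^sub>v fock_proj \<alpha> d f z)) \<le> max_fock_proj \<alpha> W g z"
    using matrix_weight_AE_good[OF W] finAE
  proof eventually_elim
    case (elim z)
    define F where "F u = cnj (fock_kernel \<alpha> z u) \<cdot>\<^sub>v (W z *\<^sub>v f u)" for u
    have Fc: "F u \<in> carrier_vec d" for u using Wc[of z] fc[of u] by (simp add: F_def)
    have int: "integrable (gauss_measure \<alpha>) (\<lambda>u. f u $ j * cnj (fock_kernel \<alpha> z u))" if "j < d" for j
      using conv[OF elim] that by (simp add: fock_converges_def)
    have Fi: "F u $ i = (\<Sum>j<d. W z $$ (i, j) * (f u $ j * cnj (fock_kernel \<alpha> z u)))" if "i < d" for u i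
      using that Wc[of z] fc[of u]
      by (simp add: F_def mult_mat_vec_index[OF Wc fc] sum_distrib_left mult_ac del: index_mult_mat_vec)
    have intF: "integrable (gauss_measure \<alpha>) (\<lambda>u. F u $ i)" if "i < d" for i
      unfolding Fi[OF that] using int by (intro Bochner_Integration.integrable_sum integrable_mult_right) auto
    have "W z *\<^sub>v fock_proj \<alpha> d f z = Matrix.vec d (\<lambda>i. LINT u|gauss_measure \<alpha>. F u $ i)"
    proof (rule eq_vecI)
      fix i assume "i < dim_vec (Matrix.vec d (\<lambda>i. LINT u|gauss_measure \<alpha>. F u $ i))"
      then have i: "i < d" by simp
      have Pc: "fock_proj \<alpha> d f z \<in> carrier_vec d" by (simp add: fock_proj_def)
      have "(W z *\<^sub>v fock_proj \<alpha> d f z) $ i = (\<Sum>j<d. W z $$ (i, j) * (LINT u|gauss_measure \<alpha>. f u $ j * cnj (fock_kernel \<alpha> z u)))"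
        unfolding mult_mat_vec_index[OF Wc Pc i] by (simp add: fock_proj_def)
      also have "\<dots> = (LINT u|gauss_measure \<alpha>. F u $ i)"
        unfolding Fi[OF i] using int by (subst Bochner_Integration.integral_sum) auto
      finally show "(W z *\<^sub>v fock_proj \<alpha> d f z) $ i = Matrix.vec d (\<lambda>i. LINT u|gauss_measure \<alpha>. F u $ i) $ i"
        using i by simp
    qed (use Wc[of z] in simp)
    then have "ennreal (vnorm (W z *\<^sub>v fock_proj \<alpha> d f z)) \<le> (\<integral>\<^sup>+ u. ennreal (vnorm (F u)) \<partial>gauss_measure \<alpha>)"
      using vnorm_integral_le[OF intF Fc] by simp
    also have "\<dots> = max_fock_proj \<alpha> W g z"
      unfolding max_eq by (simp add: F_def vnorm_smult mult.commute)
    finally show ?case .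
  qed
  have Pm: "vec_measurable d lebesgue (\<lambda>z. W z *\<^sub>v fock_proj \<alpha> d f z)"
    by (intro vec_measurable_mult matrix_weight_measurable[OF W] fock_proj_vec_measurable[OF fm \<alpha>])
  have expm: "(\<lambda>z :: complex^'n. exp (- (\<alpha> / 2) * (norm z)\<^sup>2)) \<in> borel_measurable lebesgue"
    by (intro measurable_completion) measurable
  note [measurable] = vec_measurable_vnorm[OF Pm] expm
  have "weighted_norm \<alpha> p W (fock_proj \<alpha> d f) \<le> gauss_norm \<alpha> p (max_fock_proj \<alpha> W g)"
    unfolding weighted_norm_def gauss_norm_eq_Lp_norm[OF p]
  proof (rule Lp_norm_mono_AE)
    show "AE z in lebesgue. ennreal (vnorm (W z *\<^sub>v fock_proj \<alpha> d f z)) * ennreal (exp (- (\<alpha> / 2) * (norm z)\<^sup>2))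
       \<le> max_fock_proj \<alpha> W g z * ennreal (exp (- (\<alpha> / 2) * (norm z)\<^sup>2))"
      using ptw by eventually_elim (rule mult_right_mono, auto)
  qed measurable
  with le show "weighted_norm \<alpha> p W (fock_proj \<alpha> d f) \<le> ennreal C * weighted_norm \<alpha> p W f" by (rule order_trans[rotated])
qed

section \<open>From the projection to averages\<close>

text \<open>Words instead of multi-indices: the words of length \<open>k\<close> expand \<open>\<langle>z, u\<rangle>\<^sup>k\<close> with all coefficients equal to
\<open>1\<close>, and there are \<open>n\<^sup>k\<close> of them.\<close>

definition vec_monomial :: "'n list \<Rightarrow> complex^'n \<Rightarrow> complex" where
  "vec_monomial js z = prod_list (map (vec_nth z) js)"

lemma finite_lists_length: "finite {js :: 'n::finite list. length js = k}"
  using finite_lists_length_eq[of "UNIV :: 'n set" k] by simp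

lemma card_lists_length: "card {js :: 'n::finite list. length js = k} = CARD('n) ^ k"
  using card_lists_length_eq[of "UNIV :: 'n set" k] by simp

lemma herm_power:
  fixes z u :: "complex^'n"
  shows "herm z u ^ k = (\<Sum>js | length js = k. vec_monomial js z * cnj (vec_monomial js u))"
proof (induction k)
  case 0
  have "{js :: 'n list. length js = 0} = {[]}" by auto
  then show ?case by (simp add: vec_monomial_def)
next
  case (Suc k)
  have eq: "{js :: 'n list. length js = Suc k} = (\<lambda>(j, js). j # js) ` (UNIV \<times> {js. length js = k})"
    by (auto simp: length_Suc_conv)
  have "(\<Sum>js | length js = Suc k. vec_monomial js z * cnj (vec_monomial js u))
     = (\<Sum>(j, js)\<in>UNIV \<times> {js. length js = k}. (vec_nth z j * cnj (vec_nth u j)) * (vec_monomial js z * cnj (vec_monomial js u)))"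
    unfolding eq by (subst sum.reindex) (auto simp: inj_on_def vec_monomial_def mult_ac intro!: sum.cong)
  also have "\<dots> = (\<Sum>j\<in>UNIV. \<Sum>js | length js = k. (vec_nth z j * cnj (vec_nth u j)) * (vec_monomial js z * cnj (vec_monomial js u)))"
    by (rule sum.cartesian_product[symmetric])
  also have "\<dots> = herm z u * (\<Sum>js | length js = k. vec_monomial js z * cnj (vec_monomial js u))"
    by (simp add: herm_def sum_product)
  finally show ?case using Suc by simp
qed

lemma vec_monomial_le:
  assumes "\<And>j. cmod (vec_nth z j) \<le> \<rho>"
  shows "cmod (vec_monomial js z) \<le> \<rho> ^ length js"
proof (induction js)
  case (Cons j js)
  have "0 \<le> \<rho>" using assms[of j] norm_ge_zero[of "vec_nth z j"] by linarith
  then show ?case using Cons assms[of j] by (auto simp: vec_monomial_def norm_mult intro!: mult_mono)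
qed (simp add: vec_monomial_def)

lemma vec_monomial_measurable:
  "(\<lambda>u. vec_monomial js (u - c)) \<in> borel_measurable (borel :: (complex^'n) measure)"
  unfolding vec_monomial_def
proof (induction js)
  case (Cons j js)
  have "(\<lambda>u :: complex^'n. vec_nth (u - c) j) \<in> borel_measurable borel"
    by (intro borel_measurable_continuous_onI continuous_intros)
  then show ?case using Cons by (simp add: borel_measurable_times)
qed simp

lemma herm_measurable:
  "(\<lambda>u. herm z u) \<in> borel_measurable (borel :: (complex^'n) measure)"
  unfolding herm_def by (intro borel_measurable_continuous_onI continuous_intros)

lemma herm_self: "herm c c = complex_of_real ((norm c)\<^sup>2)"
proof -
  have "herm c c = (\<Sum>i\<in>UNIV. complex_of_real ((cmod (vec_nth c i))\<^sup>2))"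
    unfolding herm_def by (simp only: complex_norm_square)
  also have "\<dots> = complex_of_real ((norm c)\<^sup>2)"
    by (simp add: norm_vec_def L2_set_def sum_nonneg)
  finally show ?thesis .
qed

lemma herm_diff: "herm (z - c) (u - c) = herm z u - herm z c - herm c u + complex_of_real ((norm c)\<^sup>2)"
  unfolding herm_self[symmetric] herm_def by (simp add: sum_subtractf sum.distrib algebra_simps)

lemma cnj_fock_kernel: "cnj (fock_kernel \<alpha> z u) = exp (complex_of_real \<alpha> * herm z u)"
proof -
  have "cnj (herm u z) = herm z u" by (simp add: herm_def mult.commute)
  then show ?thesis by (simp add: fock_kernel_def exp_cnj)
qed

definition cube_centre :: "real \<Rightarrow> complex^'n \<Rightarrow> complex^'n" where
  "cube_centre r a = a + (r / 2) *\<^sub>R (\<Sum>b\<in>Basis. b)"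

lemma cube_centre_inner:
  assumes "z \<in> cube r a" "b \<in> Basis"
  shows "\<bar>(z - cube_centre r a) \<bullet> b\<bar> \<le> r / 2"
proof -
  have *: "a \<bullet> b \<le> z \<bullet> b" "z \<bullet> b \<le> a \<bullet> b + r"
    using assms unfolding mem_cube_iff by auto
  have "(z - cube_centre r a) \<bullet> b = z \<bullet> b - (a \<bullet> b + r / 2)"
    using assms(2) by (simp add: cube_centre_def inner_diff_left inner_add_left inner_sum_Basis)
  then show ?thesis using * by (intro abs_leI) linarith+
qed

text \<open>Real and imaginary part are each at most \<open>r / 2\<close> in absolute value.\<close>

lemma cube_centre_component:
  fixes z :: "complex^'n"
  assumes z: "z \<in> cube r a"
  shows "(cmod (vec_nth (z - cube_centre r a) j))\<^sup>2 \<le> r\<^sup>2 / 2"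
proof -
  let ?w = "z - cube_centre r a"
  have 1: "axis j 1 \<in> (Basis :: (complex^'n) set)" "axis j \<i> \<in> (Basis :: (complex^'n) set)"
    by (auto simp: axis_in_Basis_iff Basis_complex_def)
  have "\<bar>Re (vec_nth ?w j)\<bar> \<le> r / 2" "\<bar>Im (vec_nth ?w j)\<bar> \<le> r / 2"
    using cube_centre_inner[OF z 1(1)] cube_centre_inner[OF z 1(2)]
    by (simp_all add: inner_axis inner_complex_def)
  then have "(Re (vec_nth ?w j))\<^sup>2 \<le> (r / 2)\<^sup>2" "(Im (vec_nth ?w j))\<^sup>2 \<le> (r / 2)\<^sup>2"
    by (metis abs_ge_zero power2_abs power_mono)+
  then show ?thesis by (simp add: cmod_power2 power_divide)
qed

lemma cube_centre_norm:
  fixes z :: "complex^'n" and r :: real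
  assumes z: "z \<in> cube r a"
  shows "(norm (z - cube_centre r a))\<^sup>2 \<le> CARD('n) * r\<^sup>2 / 2"
proof -
  have "(norm (z - cube_centre r a))\<^sup>2 = (\<Sum>j\<in>UNIV. (cmod (vec_nth (z - cube_centre r a) j))\<^sup>2)"
    by (simp add: norm_vec_def L2_set_def sum_nonneg)
  also have "\<dots> \<le> (\<Sum>j\<in>(UNIV :: 'n set). r\<^sup>2 / 2)"
    by (intro sum_mono cube_centre_component z)
  finally show ?thesis by simp
qed

lemma cmod_herm_le: "cmod (herm z u) \<le> norm z * norm (u :: complex^'n)"
proof -
  have "cmod (herm z u) \<le> (\<Sum>i\<in>UNIV. \<bar>cmod (vec_nth z i)\<bar> * \<bar>cmod (vec_nth u i)\<bar>)"
    unfolding herm_def by (rule order.trans[OF norm_sum]) (simp add: norm_mult)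
  also have "\<dots> \<le> norm z * norm u"
    unfolding norm_vec_def by (rule L2_set_mult_ineq)
  finally show ?thesis .
qed

lemma power_sum_le_exp:
  fixes x :: complex
  shows "cmod (\<Sum>k<K. x ^ k / fact k) \<le> exp (cmod x)"
proof -
  have "cmod (\<Sum>k<K. x ^ k / fact k) \<le> (\<Sum>k<K. cmod x ^ k / fact k)"
    by (rule order.trans[OF norm_sum]) (simp add: norm_divide norm_power)
  also have "\<dots> \<le> exp (cmod x)"
    using sum_le_suminf[OF summable_exp_generic[of "cmod x"], of "{..<K}"]
    by (simp add: exp_def scaleR_conv_of_real divide_inverse mult.commute)
  finally show ?thesis .
qed

lemma exp_sums_divide: "(\<lambda>k. x ^ k / fact k) sums exp x"
  for x :: "'a :: {real_normed_field, banach}"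
  using exp_converges[of x] by (simp add: scaleR_conv_of_real divide_inverse mult.commute)

text \<open>Let \<open>s u = \<langle>z - c, u - c\<rangle>\<close>, \<open>\<rho> = r / sqrt 2\<close> and let \<open>m\<^sub>j\<^sub>s\<close> be the monomial of the word \<open>js\<close> of length
\<open>k\<close>. For \<open>z \<in> Q\<close> the vector \<open>Y\<close> is the integral of \<open>f exp (\<alpha> s) exp (- \<alpha> s)\<close>, and expanding the last factor
gives \<open>Y = \<Sum>\<^sub>j\<^sub>s (- \<alpha>)\<^sup>k / k! m\<^sub>j\<^sub>s(z - c) T\<^sub>j\<^sub>s\<close>, where \<open>T\<^sub>j\<^sub>s\<close> is the integral of \<open>f cnj (m\<^sub>j\<^sub>s(u - c)) exp (\<alpha> s)\<close>.
Up to a factor depending on \<open>z\<close> alone, \<open>T\<^sub>j\<^sub>s\<close> is the Fock projection of a multiple \<open>G\<^sub>j\<^sub>s\<close> of \<open>f\<close>. The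
\<open>G\<^sub>j\<^sub>s\<close> are normalised by \<open>\<rho>\<^sup>-\<^sup>k\<close>, so that one bound holds for all of them; the weights are then
\<open>\<alpha>\<^sup>k \<rho>\<^sup>2\<^sup>k / k!\<close> for each of the \<open>n\<^sup>k\<close> words, which sums to \<open>exp (\<alpha> n r\<^sup>2 / 2)\<close>. The factors
\<open>exp (\<alpha> \<bar>z - c\<bar>\<^sup>2 / 2)\<close> and \<open>exp (\<alpha> \<bar>u - c\<bar>\<^sup>2 / 2)\<close> that come from the Gaussian weights are each at
most \<open>exp (\<alpha> n r\<^sup>2 / 4)\<close> on \<open>Q\<close>.\<close>

lemma fock_proj_dominates_averaging:
  fixes W :: "complex^'n \<Rightarrow> complex Matrix.mat" and f :: "complex^'n \<Rightarrow> complex Matrix.vec"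
    and \<alpha> r N b :: real
  assumes p: "1 \<le> p" and \<alpha>: "0 < \<alpha>" and r: "0 < r" and W: "matrix_weight d W"
    and bound: "fock_proj_bound \<alpha> p d W N"
    and f: "vec_measurable d lebesgue f" and supp: "\<And>u. u \<notin> cube r a \<Longrightarrow> f u = 0\<^sub>v d"
    and fb: "\<And>u. vnorm (f u) \<le> b"
    and fin: "Lp_norm p lebesgue (\<lambda>u. ennreal (vnorm (W u *\<^sub>v f u))) < top"
  defines "Y \<equiv> Matrix.vec d (\<lambda>i. LINT u|lebesgue. f u $ i)"
  shows "local_norm p (cube r a) (\<lambda>z. ennreal (vnorm (W z *\<^sub>v Y)))
    \<le> ennreal ((pi / \<alpha>) ^ CARD('n) * exp (CARD('n) * \<alpha> * r\<^sup>2) * N) * Lp_norm p lebesgue (\<lambda>u. ennreal (vnorm (W u *\<^sub>v f u)))"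
proof -
  define n where "n = real CARD('n)"
  define Q where "Q = cube r a"
  define c where "c = cube_centre r a"
  define \<rho> where "\<rho> = r / sqrt 2"
  have \<rho>: "0 < \<rho>" "\<rho>\<^sup>2 = r\<^sup>2 / 2" using r by (simp_all add: \<rho>_def power_divide)
  define Lf where "Lf = Lp_norm p lebesgue (\<lambda>u. ennreal (vnorm (W u *\<^sub>v f u)))"
  have N: "0 \<le> N" using bound by (simp add: fock_proj_bound_def)
  have fc: "f u \<in> carrier_vec d" for u using f by (simp add: vec_measurable_def)
  have Wc: "W z \<in> carrier_mat d d" for z using W by (simp add: matrix_weight_def)
  have Yc: "Y \<in> carrier_vec d" by (simp add: Y_def)
  have comp: "cmod (vec_nth (z - c) j) \<le> \<rho>" if "z \<in> Q" for z j
  proof (rule power2_le_imp_le)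
    show "(cmod (vec_nth (z - c) j))\<^sup>2 \<le> \<rho>\<^sup>2"
      unfolding c_def \<rho>(2) by (rule cube_centre_component[OF that[unfolded Q_def]])
  qed (use \<rho> in simp)
  have nrm: "(norm (z - c))\<^sup>2 \<le> n * r\<^sup>2 / 2" if "z \<in> Q" for z
    using cube_centre_norm[OF that[unfolded Q_def]] by (simp add: c_def n_def)
  have herm_le: "cmod (herm (z - c) (u - c)) \<le> n * r\<^sup>2 / 2" if "z \<in> Q" "u \<in> Q" for z u
  proof -
    have "norm (z - c) * norm (u - c) \<le> ((norm (z - c))\<^sup>2 + (norm (u - c))\<^sup>2) / 2"
      using zero_le_power2[of "norm (z - c) - norm (u - c)"] by (simp add: power2_eq_square algebra_simps)
    then show ?thesis using cmod_herm_le[of "z - c" "u - c"] nrm[OF that(1)] nrm[OF that(2)] by simp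
  qed
  have Qm[measurable]: "Q \<in> sets lebesgue" by (simp add: Q_def cube_measurable)
  have Qfin: "emeasure lebesgue Q < top"
    using emeasure_cube[OF cube_in_cubes r, of a] by (simp add: Q_def)
  have f0: "f u $ i = 0" if "u \<notin> Q" "i < d" for u i using supp[of u] that by (simp add: Q_def)
  have fib: "cmod (f u $ i) \<le> b" if "i < d" for u i
    using cmod_index_le_vnorm[of i "f u"] fb[of u] fc[of u] that by simp
  have fi[measurable]: "(\<lambda>u. f u $ i) \<in> borel_measurable lebesgue" if "i < d" for i
    using f that by (simp add: vec_measurable_def)
  have b0: "0 \<le> b" using fb[of undefined] vnorm_nonneg order_trans by blast

  \<comment> \<open>The multiplier cancels the Gaussian measure and the part \<open>exp (\<alpha> \<langle>c, u\<rangle>)\<close> of the kernel, and inserts the conjugate monomial.\<close>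
  define \<kappa> where "\<kappa> js u = complex_of_real ((pi / \<alpha>) ^ CARD('n) * (1 / \<rho>) ^ length js * exp (\<alpha> * (norm u)\<^sup>2 + \<alpha> * (norm c)\<^sup>2 / 2))
     * (cnj (vec_monomial js (u - c)) * exp (- (complex_of_real \<alpha> * herm c u)))" for js u
  define G where "G js u = \<kappa> js u \<cdot>\<^sub>v f u" for js u
  have \<kappa>m: "\<kappa> js \<in> borel_measurable lebesgue" for js
  proof -
    note [measurable] = vec_monomial_measurable[of js c] herm_measurable[of c]
    show ?thesis unfolding \<kappa>_def[abs_def] by (rule borel_measurable_lebesgue_if_borel) measurable
  qed
  have Gc: "G js u \<in> carrier_vec d" for js u using fc by (simp add: G_def)
  have Gm: "vec_measurable d lebesgue (G js)" for js
    unfolding vec_measurable_def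
  proof (intro conjI allI impI Gc)
    fix i assume i: "i < d"
    have "(\<lambda>u. G js u $ i) = (\<lambda>u. \<kappa> js u * f u $ i)"
      using i by (simp add: G_def carrier_vecD[OF fc])
    then show "(\<lambda>u. G js u $ i) \<in> borel_measurable lebesgue" using \<kappa>m[of js] fi[OF i] by simp
  qed
  have \<kappa>_le: "cmod (\<kappa> js u) * exp (- (\<alpha> / 2) * (norm u)\<^sup>2) \<le> (pi / \<alpha>) ^ CARD('n) * exp (\<alpha> * n * r\<^sup>2 / 4)" if u: "u \<in> Q" for js u
  proof -
    have m: "(1 / \<rho>) ^ length js * cmod (vec_monomial js (u - c)) \<le> 1"
    proof -
      have "cmod (vec_monomial js (u - c)) \<le> \<rho> ^ length js" by (rule vec_monomial_le[OF comp[OF u]])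
      then show ?thesis using \<rho> by (simp add: power_one_over field_simps)
    qed
    have e: "exp (\<alpha> * (norm u)\<^sup>2 + \<alpha> * (norm c)\<^sup>2 / 2) * exp (- (\<alpha> * (c \<bullet> u))) * exp (- (\<alpha> / 2) * (norm u)\<^sup>2) = exp ((\<alpha> / 2) * (norm (u - c))\<^sup>2)"
      by (simp add: exp_add[symmetric] power2_norm_eq_inner inner_diff_left inner_diff_right inner_commute algebra_simps)
    have "(\<alpha> / 2) * (norm (u - c))\<^sup>2 \<le> (\<alpha> / 2) * (n * r\<^sup>2 / 2)" using nrm[OF u] \<alpha> by (intro mult_left_mono) auto
    then have e2: "exp ((\<alpha> / 2) * (norm (u - c))\<^sup>2) \<le> exp (\<alpha> * n * r\<^sup>2 / 4)" by simp
    have "cmod (\<kappa> js u) * exp (- (\<alpha> / 2) * (norm u)\<^sup>2)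
      = (pi / \<alpha>) ^ CARD('n) * (((1 / \<rho>) ^ length js * cmod (vec_monomial js (u - c))) * exp ((\<alpha> / 2) * (norm (u - c))\<^sup>2))"
      unfolding e[symmetric] using \<alpha> \<rho> by (simp add: \<kappa>_def norm_mult norm_power norm_divide Re_herm power_one_over)
    also have "\<dots> \<le> (pi / \<alpha>) ^ CARD('n) * (1 * exp (\<alpha> * n * r\<^sup>2 / 4))"
    proof (rule mult_left_mono)
      show "((1 / \<rho>) ^ length js * cmod (vec_monomial js (u - c))) * exp ((\<alpha> / 2) * (norm (u - c))\<^sup>2) \<le> 1 * exp (\<alpha> * n * r\<^sup>2 / 4)"
        by (rule mult_mono[OF m e2]) auto
    qed (use \<alpha> in simp)
    finally show ?thesis by simp
  qed
  define B0 where "B0 = (pi / \<alpha>) ^ CARD('n) * exp (\<alpha> * n * r\<^sup>2 / 4)"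
  have B0: "0 \<le> B0" using \<alpha> by (simp add: B0_def)
  have Wfm[measurable]: "(\<lambda>u. vnorm (W u *\<^sub>v f u)) \<in> borel_measurable lebesgue"
    by (intro vec_measurable_vnorm[OF vec_measurable_mult[OF matrix_weight_measurable[OF W] f]])
  have expm[measurable]: "(\<lambda>z :: complex^'n. exp (- (\<alpha> / 2) * (norm z)\<^sup>2)) \<in> borel_measurable lebesgue"
    by (rule borel_measurable_lebesgue_if_borel) measurable
  have G_norm: "weighted_norm \<alpha> p W (G js) \<le> ennreal B0 * Lf" for js
  proof -
    have le: "gauss_weighted \<alpha> (\<lambda>z. W z *\<^sub>v G js z) u \<le> ennreal B0 * ennreal (vnorm (W u *\<^sub>v f u))" for u
    proof -
      have eq: "vnorm (W u *\<^sub>v G js u) = cmod (\<kappa> js u) * vnorm (W u *\<^sub>v f u)"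
        using mult_mat_vec[OF Wc fc] by (simp add: G_def vnorm_smult)
      have "vnorm (W u *\<^sub>v G js u) * exp (- (\<alpha> / 2) * (norm u)\<^sup>2) \<le> B0 * vnorm (W u *\<^sub>v f u)"
      proof (cases "u \<in> Q")
        case True
        then have "(cmod (\<kappa> js u) * exp (- (\<alpha> / 2) * (norm u)\<^sup>2)) * vnorm (W u *\<^sub>v f u) \<le> B0 * vnorm (W u *\<^sub>v f u)"
          unfolding B0_def by (intro mult_right_mono \<kappa>_le) auto
        then show ?thesis by (simp add: eq mult_ac)
      next
        case False
        then have "W u *\<^sub>v f u = 0\<^sub>v d" using supp[of u] mult_mat_zero_vec[OF Wc[of u]] by (simp add: Q_def)
        then show ?thesis using vnorm_eq_0_iff[of "0\<^sub>v d" d] by (simp add: eq)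
      qed
      then show ?thesis using B0 by (simp add: gauss_weighted_def ennreal_mult[symmetric] ennreal_leI)
    qed
    have "weighted_norm \<alpha> p W (G js) \<le> Lp_norm p lebesgue (\<lambda>u. ennreal B0 * ennreal (vnorm (W u *\<^sub>v f u)))"
      unfolding weighted_norm_eq_Lp_norm[OF p]
      by (rule Lp_norm_mono[OF gauss_weighted_measurable[OF vec_measurable_mult[OF matrix_weight_measurable[OF W] Gm]] le])
    also have "\<dots> \<le> ennreal B0 * Lf" unfolding Lf_def by (intro Lp_norm_cmult_le[OF p]) measurable
    finally show ?thesis .
  qed
  have G_space: "G js \<in> weighted_space \<alpha> p d W" for js
    using Gm[of js] G_norm[of js] fin unfolding weighted_space_def vec_measurable_def Lf_def
    by (auto intro: le_less_trans simp: ennreal_mult_less_top)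
  define \<Psi> where "\<Psi> js = gauss_weighted \<alpha> (\<lambda>z. W z *\<^sub>v fock_proj \<alpha> d (G js) z)" for js
  have \<Psi>m: "\<Psi> js \<in> borel_measurable lebesgue" for js
    unfolding \<Psi>_def
    by (rule gauss_weighted_measurable[OF vec_measurable_mult[OF matrix_weight_measurable[OF W] fock_proj_vec_measurable[OF Gm \<alpha>]]])
  define B where "B = ennreal N * (ennreal B0 * Lf)"
  have \<Psi>B: "Lp_norm p lebesgue (\<Psi> js) \<le> B" for js
  proof -
    have "Lp_norm p lebesgue (\<Psi> js) \<le> ennreal N * weighted_norm \<alpha> p W (G js)"
      using bound G_space[of js] unfolding \<Psi>_def weighted_norm_eq_Lp_norm[OF p, symmetric]
      by (auto simp: fock_proj_bound_def)
    also have "\<dots> \<le> B" unfolding B_def by (intro mult_left_mono G_norm) simp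
    finally show ?thesis .
  qed

  define \<Lambda> where "\<Lambda> k = exp (\<alpha> * n * r\<^sup>2 / 4) * ((\<alpha> * n * r\<^sup>2 / 2) ^ k / fact k)" for k :: nat
  have \<Lambda>0: "0 \<le> \<Lambda> k" for k using \<alpha> by (simp add: \<Lambda>_def n_def)
  \<comment> \<open>The words of one length are averaged with equal weights, and the lengths are then summed with the weights of an exponential series.\<close>
  define \<Phi> where "\<Phi> k z = (\<integral>\<^sup>+ js. ennreal (1 / n ^ k) * \<Psi> js z \<partial>count_space {js. length js = k})" for k z
  have lists_fin: "finite {js :: 'n list. length js = k}" for k by (rule finite_lists_length)
  have n: "0 < n" by (simp add: n_def)
  have \<Phi>m: "\<Phi> k \<in> borel_measurable lebesgue" for k
    unfolding \<Phi>_def using \<Psi>m lists_fin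
    by (intro borel_measurable_nn_integral_count_space countable_finite borel_measurable_times_ennreal) auto
  have one: "(\<integral>\<^sup>+ js. ennreal (1 / n ^ k) \<partial>count_space {js :: 'n list. length js = k}) = 1" for k
  proof -
    have "(\<integral>\<^sup>+ js. ennreal (1 / n ^ k) \<partial>count_space {js :: 'n list. length js = k}) = of_nat (CARD('n) ^ k) * ennreal (1 / n ^ k)"
      by (subst nn_integral_count_space_finite[OF lists_fin]) (simp add: card_lists_length)
    also have "\<dots> = ennreal (real (CARD('n) ^ k)) * ennreal (1 / n ^ k)"
      by (simp only: ennreal_of_nat_eq_real_of_nat)
    also have "\<dots> = 1" using n by (simp add: ennreal_mult[symmetric] n_def)
    finally show ?thesis .
  qed
  have \<Phi>B: "Lp_norm p lebesgue (\<Phi> k) \<le> B" for k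
  proof -
    have "Lp_norm p lebesgue (\<Phi> k) \<le> (\<integral>\<^sup>+ js. ennreal (1 / n ^ k) \<partial>count_space {js :: 'n list. length js = k}) * B"
      unfolding \<Phi>_def
    proof (rule Lp_norm_weighted_sum_le[OF p countable_finite[OF lists_fin] \<Psi>m \<Psi>B])
      show "(\<integral>\<^sup>+ js. ennreal (1 / n ^ k) \<partial>count_space {js :: 'n list. length js = k}) < top"
        unfolding one by simp
    qed
    then show ?thesis by (simp only: one mult_1)
  qed
  have \<Lambda>sum: "(\<integral>\<^sup>+ k. ennreal (\<Lambda> k) \<partial>count_space UNIV) = ennreal (exp (\<alpha> * n * r\<^sup>2 / 4) * exp (\<alpha> * n * r\<^sup>2 / 2))"
  proof -
    have "(\<lambda>k. (\<alpha> * n * r\<^sup>2 / 2) ^ k / fact k) sums exp (\<alpha> * n * r\<^sup>2 / 2)"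
      by (rule exp_sums_divide)
    then have "\<Lambda> sums (exp (\<alpha> * n * r\<^sup>2 / 4) * exp (\<alpha> * n * r\<^sup>2 / 2))"
      unfolding \<Lambda>_def[abs_def] by (rule sums_mult)
    from suminf_ennreal_eq[OF \<Lambda>0 this] show ?thesis
      by (simp only: nn_integral_count_space_nat)
  qed

  have pointwise: "ennreal (vnorm (W z *\<^sub>v Y)) \<le> (\<integral>\<^sup>+ k. ennreal (\<Lambda> k) * \<Phi> k z \<partial>count_space UNIV)" if z: "z \<in> Q" for z
  proof -
    define s where "s u = herm (z - c) (u - c)" for u
    have sm: "s \<in> borel_measurable lebesgue"
      unfolding s_def[abs_def] herm_def
      by (intro borel_measurable_lebesgue_if_borel borel_measurable_continuous_onI continuous_intros)
    \<comment> \<open>The part of the kernel that depends only on \<open>z\<close>.\<close>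
    define e0 where "e0 = exp (complex_of_real \<alpha> * herm z c - complex_of_real (\<alpha> * (norm c)\<^sup>2 / 2))"
    define T where "T js = Matrix.vec d (\<lambda>i. LINT u|lebesgue. f u $ i * cnj (vec_monomial js (u - c)) * exp (complex_of_real \<alpha> * s u))" for js
    have Tc: "T js \<in> carrier_vec d" for js by (simp add: T_def)
    have mono_m: "(\<lambda>u. vec_monomial js (u - c)) \<in> borel_measurable lebesgue" for js
      by (rule borel_measurable_lebesgue_if_borel[OF vec_monomial_measurable])
    note [measurable] = sm mono_m
    have T_int: "integrable lebesgue (\<lambda>u. f u $ i * cnj (vec_monomial js (u - c)) * exp (complex_of_real \<alpha> * s u))" if i: "i < d" for i js
    proof (rule Bochner_Integration.integrable_bound)
      show "integrable lebesgue (\<lambda>u. b * \<rho> ^ length js * exp (\<alpha> * (n * r\<^sup>2 / 2)) * indicator Q u)"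
        using Qfin by (intro integrable_mult_right integrable_real_indicator) auto
      show "(\<lambda>u. f u $ i * cnj (vec_monomial js (u - c)) * exp (complex_of_real \<alpha> * s u)) \<in> borel_measurable lebesgue"
        using i by measurable
      show "AE u in lebesgue. norm (f u $ i * cnj (vec_monomial js (u - c)) * exp (complex_of_real \<alpha> * s u))
         \<le> norm (b * \<rho> ^ length js * exp (\<alpha> * (n * r\<^sup>2 / 2)) * indicator Q u)"
      proof (rule AE_I2)
        fix u :: "complex^'n"
        show "norm (f u $ i * cnj (vec_monomial js (u - c)) * exp (complex_of_real \<alpha> * s u))
         \<le> norm (b * \<rho> ^ length js * exp (\<alpha> * (n * r\<^sup>2 / 2)) * indicator Q u)"
        proof (cases "u \<in> Q")
          case True
          have "Re (s u) \<le> n * r\<^sup>2 / 2" using herm_le[OF z True] complex_Re_le_cmod[of "s u"] by (simp add: s_def)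
          then have "exp (\<alpha> * Re (s u)) \<le> exp (\<alpha> * (n * r\<^sup>2 / 2))" using \<alpha> by simp
          moreover have "cmod (vec_monomial js (u - c)) \<le> \<rho> ^ length js" by (rule vec_monomial_le[OF comp[OF True]])
          ultimately show ?thesis using fib[OF i, of u] b0 \<rho> True
            by (auto simp: norm_mult intro!: mult_mono)
        qed (use f0 i in simp)
      qed
    qed
    have P_eq: "fock_proj \<alpha> d (G js) z = (complex_of_real ((1 / \<rho>) ^ length js) * e0) \<cdot>\<^sub>v T js" for js
    proof (rule eq_vecI)
      fix i assume "i < dim_vec ((complex_of_real ((1 / \<rho>) ^ length js) * e0) \<cdot>\<^sub>v T js)"
      then have i: "i < d" by (simp add: T_def)
      have "(\<lambda>u. G js u $ i * cnj (fock_kernel \<alpha> z u)) \<in> borel_measurable lebesgue"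
        using Gm[of js] i fock_kernel_measurable_right[of \<alpha> z] by (auto simp: vec_measurable_def)
      then have "fock_proj \<alpha> d (G js) z $ i = (LINT u|lebesgue. ((\<alpha> / pi) ^ CARD('n) * exp (- \<alpha> * (norm u)\<^sup>2)) *\<^sub>R (G js u $ i * cnj (fock_kernel \<alpha> z u)))"
        using i \<alpha> by (simp add: fock_proj_def integral_gauss_measure)
      also have "\<dots> = (LINT u|lebesgue. (complex_of_real ((1 / \<rho>) ^ length js) * e0) * (f u $ i * cnj (vec_monomial js (u - c)) * exp (complex_of_real \<alpha> * s u)))"
      proof (rule Bochner_Integration.integral_cong[OF refl])
        fix u :: "complex^'n"
        have pa: "(\<alpha> / pi) ^ CARD('n) * (pi / \<alpha>) ^ CARD('n) = 1"
          using \<alpha> by (simp add: power_mult_distrib[symmetric])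
        have "complex_of_real (exp (- \<alpha> * (norm u)\<^sup>2)) * complex_of_real (exp (\<alpha> * (norm u)\<^sup>2 + \<alpha> * (norm c)\<^sup>2 / 2))
           * exp (- (complex_of_real \<alpha> * herm c u)) * exp (complex_of_real \<alpha> * herm z u)
          = exp (complex_of_real (- \<alpha> * (norm u)\<^sup>2) + complex_of_real (\<alpha> * (norm u)\<^sup>2 + \<alpha> * (norm c)\<^sup>2 / 2)
              + - (complex_of_real \<alpha> * herm c u) + complex_of_real \<alpha> * herm z u)"
          by (simp only: exp_add exp_of_real)
        also have "\<dots> = exp ((complex_of_real \<alpha> * herm z c - complex_of_real (\<alpha> * (norm c)\<^sup>2 / 2)) + complex_of_real \<alpha> * s u)"
          unfolding s_def herm_diff by (rule arg_cong[where f = exp]) (simp add: field_simps)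
        also have "\<dots> = e0 * exp (complex_of_real \<alpha> * s u)"
          by (simp only: e0_def exp_add)
        finally have ex: "complex_of_real (exp (- \<alpha> * (norm u)\<^sup>2)) * complex_of_real (exp (\<alpha> * (norm u)\<^sup>2 + \<alpha> * (norm c)\<^sup>2 / 2))
           * exp (- (complex_of_real \<alpha> * herm c u)) * exp (complex_of_real \<alpha> * herm z u) = e0 * exp (complex_of_real \<alpha> * s u)" .
        have "((\<alpha> / pi) ^ CARD('n) * exp (- \<alpha> * (norm u)\<^sup>2)) *\<^sub>R (G js u $ i * cnj (fock_kernel \<alpha> z u))
          = complex_of_real ((\<alpha> / pi) ^ CARD('n) * (pi / \<alpha>) ^ CARD('n)) * (complex_of_real ((1 / \<rho>) ^ length js)
            * (f u $ i * cnj (vec_monomial js (u - c))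
            * (complex_of_real (exp (- \<alpha> * (norm u)\<^sup>2)) * complex_of_real (exp (\<alpha> * (norm u)\<^sup>2 + \<alpha> * (norm c)\<^sup>2 / 2))
           * exp (- (complex_of_real \<alpha> * herm c u)) * exp (complex_of_real \<alpha> * herm z u))))"
        proof -
          have Gi: "G js u $ i = \<kappa> js u * f u $ i" using i by (simp add: G_def carrier_vecD[OF fc])
          show ?thesis unfolding cnj_fock_kernel scaleR_conv_of_real
            by (simp only: Gi \<kappa>_def of_real_mult mult_ac)
        qed
        also have "\<dots> = (complex_of_real ((1 / \<rho>) ^ length js) * e0) * (f u $ i * cnj (vec_monomial js (u - c)) * exp (complex_of_real \<alpha> * s u))"
          unfolding ex pa by (simp only: of_real_1 mult_1 mult_ac)
        finally show "((\<alpha> / pi) ^ CARD('n) * exp (- \<alpha> * (norm u)\<^sup>2)) *\<^sub>R (G js u $ i * cnj (fock_kernel \<alpha> z u))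
          = (complex_of_real ((1 / \<rho>) ^ length js) * e0) * (f u $ i * cnj (vec_monomial js (u - c)) * exp (complex_of_real \<alpha> * s u))" .
      qed
      also have "\<dots> = (complex_of_real ((1 / \<rho>) ^ length js) * e0) * T js $ i"
        using i by (simp add: T_def)
      finally show "fock_proj \<alpha> d (G js) z $ i = ((complex_of_real ((1 / \<rho>) ^ length js) * e0) \<cdot>\<^sub>v T js) $ i"
        using i Tc[of js] by simp
    qed (simp add: fock_proj_def T_def)
    have e0_norm: "exp (- (\<alpha> / 2) * (norm z)\<^sup>2) \<ge> inverse (cmod e0) * exp (- (\<alpha> * n * r\<^sup>2 / 4))"
    proof -
      have "cmod e0 = exp (\<alpha> * (z \<bullet> c) - \<alpha> * (norm c)\<^sup>2 / 2)" by (simp add: e0_def Re_herm)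
      then have "inverse (cmod e0) * exp (- (\<alpha> * n * r\<^sup>2 / 4)) = exp (- (\<alpha> * (z \<bullet> c) - \<alpha> * (norm c)\<^sup>2 / 2) - (\<alpha> * n * r\<^sup>2 / 4))"
        by (simp only: exp_minus[symmetric] exp_add[symmetric]) simp
      also have "\<dots> \<le> exp (- (\<alpha> / 2) * (norm z)\<^sup>2)"
      proof -
        have "(\<alpha> / 2) * (norm (z - c))\<^sup>2 \<le> (\<alpha> / 2) * (n * r\<^sup>2 / 2)" using nrm[OF z] \<alpha> by (intro mult_left_mono) auto
        moreover have "(norm (z - c))\<^sup>2 = (norm z)\<^sup>2 - 2 * (z \<bullet> c) + (norm c)\<^sup>2"
          by (simp add: power2_norm_eq_inner inner_diff_left inner_diff_right inner_commute)
        ultimately show ?thesis by (simp add: algebra_simps)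
      qed
      finally show ?thesis .
    qed
    have T_le: "vnorm (W z *\<^sub>v T js) \<le> \<rho> ^ length js * exp (\<alpha> * n * r\<^sup>2 / 4) * (vnorm (W z *\<^sub>v fock_proj \<alpha> d (G js) z) * exp (- (\<alpha> / 2) * (norm z)\<^sup>2))" for js
    proof -
      have "vnorm (W z *\<^sub>v fock_proj \<alpha> d (G js) z) = (1 / \<rho>) ^ length js * cmod e0 * vnorm (W z *\<^sub>v T js)"
        unfolding P_eq mult_mat_vec[OF Wc Tc] vnorm_smult using \<rho> by (simp add: norm_mult norm_power norm_divide power_one_over)
      then have "\<rho> ^ length js * exp (\<alpha> * n * r\<^sup>2 / 4) * (vnorm (W z *\<^sub>v fock_proj \<alpha> d (G js) z) * exp (- (\<alpha> / 2) * (norm z)\<^sup>2))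
         = vnorm (W z *\<^sub>v T js) * (exp (\<alpha> * n * r\<^sup>2 / 4) * cmod e0 * exp (- (\<alpha> / 2) * (norm z)\<^sup>2))"
        using \<rho> by (simp add: power_one_over)
      moreover have "1 \<le> exp (\<alpha> * n * r\<^sup>2 / 4) * cmod e0 * exp (- (\<alpha> / 2) * (norm z)\<^sup>2)"
      proof -
        have "1 = exp (\<alpha> * n * r\<^sup>2 / 4) * cmod e0 * (inverse (cmod e0) * exp (- (\<alpha> * n * r\<^sup>2 / 4)))"
        proof -
          have "cmod e0 \<noteq> 0" by (simp add: e0_def)
          moreover have "a * b * (inverse b * inverse a) = 1" if "a \<noteq> 0" "b \<noteq> 0" for a b :: real
            using that by (simp add: field_simps)
          ultimately show ?thesis unfolding exp_minus by (metis exp_not_eq_zero)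
        qed
        also have "\<dots> \<le> exp (\<alpha> * n * r\<^sup>2 / 4) * cmod e0 * exp (- (\<alpha> / 2) * (norm z)\<^sup>2)"
          using e0_norm by (intro mult_left_mono) auto
        finally show ?thesis .
      qed
      then have "vnorm (W z *\<^sub>v T js) * 1 \<le> vnorm (W z *\<^sub>v T js) * (exp (\<alpha> * n * r\<^sup>2 / 4) * cmod e0 * exp (- (\<alpha> / 2) * (norm z)\<^sup>2))"
        by (intro mult_left_mono) auto
      ultimately show ?thesis by (simp only: mult_1_right)
    qed
    define I where "I K = (SIGMA k:{..<K}. {js :: 'n list. length js = k})" for K :: nat
    have Ifin: "finite (I K)" for K unfolding I_def by (intro finite_SigmaI lists_fin) auto
    define co where "co x = (- complex_of_real \<alpha>) ^ fst x / fact (fst x) * vec_monomial (snd x) (z - c)" for x :: "nat \<times> 'n list"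
    \<comment> \<open>The partial sums of the expansion of \<open>Y\<close>.\<close>
    define SK where "SK K = Matrix.vec d (\<lambda>i. \<Sum>x\<in>I K. co x * T (snd x) $ i)" for K
    have SKc: "SK K \<in> carrier_vec d" for K by (simp add: SK_def)
    have SK_lim: "(\<lambda>K. SK K $ i) \<longlonglongrightarrow> Y $ i" if i: "i < d" for i
    proof -
      have "SK K $ i = (LINT u|lebesgue. f u $ i * exp (complex_of_real \<alpha> * s u) * (\<Sum>k<K. (- complex_of_real \<alpha> * s u) ^ k / fact k))" for K
      proof -
        have "SK K $ i = (\<Sum>x\<in>I K. LINT u|lebesgue. co x * (f u $ i * cnj (vec_monomial (snd x) (u - c)) * exp (complex_of_real \<alpha> * s u)))"
          using i by (simp add: SK_def T_def)
        also have "\<dots> = (LINT u|lebesgue. (\<Sum>x\<in>I K. co x * (f u $ i * cnj (vec_monomial (snd x) (u - c)) * exp (complex_of_real \<alpha> * s u))))"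
          using T_int[OF i] by (intro Bochner_Integration.integral_sum[symmetric] integrable_mult_right) auto
        also have "\<dots> = (LINT u|lebesgue. f u $ i * exp (complex_of_real \<alpha> * s u) * (\<Sum>k<K. (- complex_of_real \<alpha> * s u) ^ k / fact k))"
        proof (rule Bochner_Integration.integral_cong[OF refl])
          fix u
          have "(\<Sum>k<K. (- complex_of_real \<alpha> * s u) ^ k / fact k) = (\<Sum>k<K. \<Sum>js | length js = k. co (k, js) * cnj (vec_monomial js (u - c)))"
            unfolding s_def power_mult_distrib herm_power co_def
            by (intro sum.cong refl) (simp add: sum_distrib_left sum_divide_distrib mult_ac)
          also have "\<dots> = (\<Sum>x\<in>I K. co x * cnj (vec_monomial (snd x) (u - c)))"
            unfolding I_def using lists_fin by (subst sum.Sigma) (auto intro!: sum.cong)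
          finally show "(\<Sum>x\<in>I K. co x * (f u $ i * cnj (vec_monomial (snd x) (u - c)) * exp (complex_of_real \<alpha> * s u)))
            = f u $ i * exp (complex_of_real \<alpha> * s u) * (\<Sum>k<K. (- complex_of_real \<alpha> * s u) ^ k / fact k)"
            by (simp add: sum_distrib_left mult_ac)
        qed
        finally show ?thesis .
      qed
      moreover have "(\<lambda>K. LINT u|lebesgue. f u $ i * exp (complex_of_real \<alpha> * s u) * (\<Sum>k<K. (- complex_of_real \<alpha> * s u) ^ k / fact k))
         \<longlonglongrightarrow> (LINT u|lebesgue. f u $ i)"
      proof (rule integral_dominated_convergence)
        show "(\<lambda>u. f u $ i) \<in> borel_measurable lebesgue" using i by measurable
        show "(\<lambda>u. f u $ i * exp (complex_of_real \<alpha> * s u) * (\<Sum>k<K. (- complex_of_real \<alpha> * s u) ^ k / fact k)) \<in> borel_measurable lebesgue" for K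
          using i by measurable
        show "integrable lebesgue (\<lambda>u. b * exp (\<alpha> * (n * r\<^sup>2 / 2)) * exp (\<alpha> * (n * r\<^sup>2 / 2)) * indicator Q u)"
          using Qfin by (intro integrable_mult_right integrable_real_indicator) auto
        show "AE u in lebesgue. (\<lambda>K. f u $ i * exp (complex_of_real \<alpha> * s u) * (\<Sum>k<K. (- complex_of_real \<alpha> * s u) ^ k / fact k)) \<longlonglongrightarrow> f u $ i"
        proof (rule AE_I2)
          fix u :: "complex^'n"
          have "(\<lambda>K. f u $ i * exp (complex_of_real \<alpha> * s u) * (\<Sum>k<K. (- complex_of_real \<alpha> * s u) ^ k / fact k))
             \<longlonglongrightarrow> f u $ i * exp (complex_of_real \<alpha> * s u) * exp (- complex_of_real \<alpha> * s u)"
            using exp_sums_divide[of "- complex_of_real \<alpha> * s u"] unfolding sums_def by (intro tendsto_mult_left)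
          also have "f u $ i * exp (complex_of_real \<alpha> * s u) * exp (- complex_of_real \<alpha> * s u) = f u $ i"
            by (simp add: mult.assoc exp_add[symmetric])
          finally show "(\<lambda>K. f u $ i * exp (complex_of_real \<alpha> * s u) * (\<Sum>k<K. (- complex_of_real \<alpha> * s u) ^ k / fact k)) \<longlonglongrightarrow> f u $ i" .
        qed
        show "AE u in lebesgue. norm (f u $ i * exp (complex_of_real \<alpha> * s u) * (\<Sum>k<K. (- complex_of_real \<alpha> * s u) ^ k / fact k))
           \<le> b * exp (\<alpha> * (n * r\<^sup>2 / 2)) * exp (\<alpha> * (n * r\<^sup>2 / 2)) * indicator Q u" for K
        proof (rule AE_I2)
          fix u :: "complex^'n"
          show "norm (f u $ i * exp (complex_of_real \<alpha> * s u) * (\<Sum>k<K. (- complex_of_real \<alpha> * s u) ^ k / fact k))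
           \<le> b * exp (\<alpha> * (n * r\<^sup>2 / 2)) * exp (\<alpha> * (n * r\<^sup>2 / 2)) * indicator Q u"
          proof (cases "u \<in> Q")
            case True
            have su: "cmod (s u) \<le> n * r\<^sup>2 / 2" using herm_le[OF z True] by (simp add: s_def)
            then have "Re (s u) \<le> n * r\<^sup>2 / 2" using complex_Re_le_cmod[of "s u"] by simp
            then have 1: "exp (\<alpha> * Re (s u)) \<le> exp (\<alpha> * (n * r\<^sup>2 / 2))" using \<alpha> by simp
            have "cmod (\<Sum>k<K. (- complex_of_real \<alpha> * s u) ^ k / fact k) \<le> exp (cmod (- complex_of_real \<alpha> * s u))"
              by (rule power_sum_le_exp)
            also have "\<dots> \<le> exp (\<alpha> * (n * r\<^sup>2 / 2))" using su \<alpha> by (simp add: norm_mult)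
            finally have 2: "cmod (\<Sum>k<K. (- complex_of_real \<alpha> * s u) ^ k / fact k) \<le> exp (\<alpha> * (n * r\<^sup>2 / 2))" .
            have "norm (f u $ i) * norm (exp (complex_of_real \<alpha> * s u)) * norm (\<Sum>k<K. (- complex_of_real \<alpha> * s u) ^ k / fact k)
              \<le> b * exp (\<alpha> * (n * r\<^sup>2 / 2)) * exp (\<alpha> * (n * r\<^sup>2 / 2))"
              using 1 2 fib[OF i, of u] b0 by (intro mult_mono) auto
            then show ?thesis using True by (simp add: norm_mult)
          qed (use f0 i in simp)
        qed
      qed
      ultimately show ?thesis using i by (simp add: Y_def)
    qed
    have SK_le: "ennreal (vnorm (W z *\<^sub>v SK K)) \<le> (\<integral>\<^sup>+ k. ennreal (\<Lambda> k) * \<Phi> k z \<partial>count_space UNIV)" for K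
    proof -
      have WSK: "W z *\<^sub>v SK K = Matrix.vec d (\<lambda>i. \<Sum>x\<in>I K. co x * (W z *\<^sub>v T (snd x)) $ i)"
      proof (rule eq_vecI)
        fix i assume "i < dim_vec (Matrix.vec d (\<lambda>i. \<Sum>x\<in>I K. co x * (W z *\<^sub>v T (snd x)) $ i))"
        then have i: "i < d" by simp
        have "(W z *\<^sub>v SK K) $ i = (\<Sum>j<d. W z $$ (i, j) * (\<Sum>x\<in>I K. co x * T (snd x) $ j))"
          unfolding mult_mat_vec_index[OF Wc SKc i] by (simp add: SK_def)
        also have "\<dots> = (\<Sum>x\<in>I K. co x * (\<Sum>j<d. W z $$ (i, j) * T (snd x) $ j))"
          unfolding sum_distrib_left by (subst sum.swap) (simp add: mult_ac)
        finally show "(W z *\<^sub>v SK K) $ i = Matrix.vec d (\<lambda>i. \<Sum>x\<in>I K. co x * (W z *\<^sub>v T (snd x)) $ i) $ i"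
          using i by (simp add: mult_mat_vec_index[OF Wc Tc i] del: index_mult_mat_vec)
      qed (use Wc[of z] in simp)
      have "vnorm (W z *\<^sub>v SK K) \<le> (\<Sum>x\<in>I K. cmod (co x) * vnorm (W z *\<^sub>v T (snd x)))"
        unfolding WSK using Wc[of z] Tc by (intro vnorm_lincomb_le) auto
      also have "\<dots> \<le> (\<Sum>x\<in>I K. \<Lambda> (fst x) * (1 / n ^ fst x * (vnorm (W z *\<^sub>v fock_proj \<alpha> d (G (snd x)) z) * exp (- (\<alpha> / 2) * (norm z)\<^sup>2))))"
      proof (rule sum_mono)
        fix x assume "x \<in> I K"
        then obtain k js where x: "x = (k, js)" "length js = k" by (auto simp: I_def)
        let ?w = "vnorm (W z *\<^sub>v fock_proj \<alpha> d (G js) z) * exp (- (\<alpha> / 2) * (norm z)\<^sup>2)"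
        have co: "cmod (co x) \<le> \<alpha> ^ k / fact k * \<rho> ^ k"
        proof -
          have "cmod (co x) = \<alpha> ^ k / fact k * cmod (vec_monomial js (z - c))"
            using \<alpha> x by (simp add: co_def norm_mult norm_divide norm_power)
          also have "\<dots> \<le> \<alpha> ^ k / fact k * \<rho> ^ k"
            using vec_monomial_le[OF comp[OF z], of js] \<alpha> x by (intro mult_left_mono) auto
          finally show ?thesis .
        qed
        have "cmod (co x) * vnorm (W z *\<^sub>v T js) \<le> (\<alpha> ^ k / fact k * \<rho> ^ k) * (\<rho> ^ k * exp (\<alpha> * n * r\<^sup>2 / 4) * ?w)"
          using co T_le[of js] x \<alpha> \<rho> by (intro mult_mono) auto
        also have "\<dots> = \<Lambda> k * (1 / n ^ k * ?w)"
        proof -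
          define P where "P = (r\<^sup>2 / 2) ^ k"
          have 1: "\<rho> ^ k * \<rho> ^ k = P"
            by (simp only: P_def \<rho>(2)[symmetric] power2_eq_square[of \<rho>] power_mult_distrib)
          have "(\<alpha> * n * r\<^sup>2 / 2) ^ k = (\<alpha> * n * (r\<^sup>2 / 2)) ^ k" by simp
          then have 2: "(\<alpha> * n * r\<^sup>2 / 2) ^ k = \<alpha> ^ k * n ^ k * P"
            unfolding P_def by (simp only: power_mult_distrib)
          have "(\<alpha> ^ k / fact k * \<rho> ^ k) * (\<rho> ^ k * exp (\<alpha> * n * r\<^sup>2 / 4) * ?w)
            = \<alpha> ^ k / fact k * (\<rho> ^ k * \<rho> ^ k) * exp (\<alpha> * n * r\<^sup>2 / 4) * ?w" by (simp only: mult_ac)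
          also have "\<dots> = exp (\<alpha> * n * r\<^sup>2 / 4) * ((\<alpha> ^ k * n ^ k * P) / fact k) * (1 / n ^ k * ?w)"
            unfolding 1 using n by simp
          finally show ?thesis unfolding \<Lambda>_def 2 .
        qed
        finally show "cmod (co x) * vnorm (W z *\<^sub>v T (snd x)) \<le> \<Lambda> (fst x) * (1 / n ^ fst x * (vnorm (W z *\<^sub>v fock_proj \<alpha> d (G (snd x)) z) * exp (- (\<alpha> / 2) * (norm z)\<^sup>2)))"
          by (simp add: x)
      qed
      finally have "ennreal (vnorm (W z *\<^sub>v SK K)) \<le> ennreal (\<Sum>x\<in>I K. \<Lambda> (fst x) * (1 / n ^ fst x * (vnorm (W z *\<^sub>v fock_proj \<alpha> d (G (snd x)) z) * exp (- (\<alpha> / 2) * (norm z)\<^sup>2))))"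
        by (rule ennreal_leI)
      also have "\<dots> = (\<Sum>x\<in>I K. ennreal (\<Lambda> (fst x)) * (ennreal (1 / n ^ fst x) * \<Psi> (snd x) z))"
      proof -
        let ?v = "\<lambda>x :: nat \<times> 'n list. \<Lambda> (fst x) * (1 / n ^ fst x * (vnorm (W z *\<^sub>v fock_proj \<alpha> d (G (snd x)) z) * exp (- (\<alpha> / 2) * (norm z)\<^sup>2)))"
        have "ennreal (\<Sum>x\<in>I K. ?v x) = (\<Sum>x\<in>I K. ennreal (?v x))"
          using n \<Lambda>0 by (intro sum_ennreal[symmetric]) auto
        also have "\<dots> = (\<Sum>x\<in>I K. ennreal (\<Lambda> (fst x)) * (ennreal (1 / n ^ fst x) * \<Psi> (snd x) z))"
          using n \<Lambda>0 by (intro sum.cong refl) (simp add: \<Psi>_def gauss_weighted_def ennreal_mult[symmetric])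
        finally show ?thesis .
      qed
      also have "\<dots> = (\<Sum>k<K. \<Sum>js | length js = k. ennreal (\<Lambda> k) * (ennreal (1 / n ^ k) * \<Psi> js z))"
        unfolding I_def using lists_fin by (subst sum.Sigma) (auto intro!: sum.cong)
      also have "\<dots> = (\<Sum>k<K. ennreal (\<Lambda> k) * \<Phi> k z)"
        by (simp add: \<Phi>_def nn_integral_count_space_finite[OF lists_fin] sum_distrib_left)
      also have "\<dots> \<le> (\<integral>\<^sup>+ k. ennreal (\<Lambda> k) * \<Phi> k z \<partial>count_space UNIV)"
        unfolding nn_integral_count_space_nat by (rule sum_le_suminf) auto
      finally show ?thesis .
    qed
    have "(\<lambda>K. vnorm (W z *\<^sub>v SK K)) \<longlonglongrightarrow> vnorm (W z *\<^sub>v Y)"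
    proof -
      have eq: "vnorm (W z *\<^sub>v v) = sqrt (\<Sum>i<d. (cmod (\<Sum>j<d. W z $$ (i, j) * v $ j))\<^sup>2)" if "v \<in> carrier_vec d" for v
        by (simp add: vnorm_L2_set L2_set_def carrier_matD[OF Wc] mult_mat_vec_index[OF Wc that] del: index_mult_mat_vec cong: sum.cong_simp)
      show ?thesis unfolding eq[OF SKc] eq[OF Yc]
        using SK_lim by (intro tendsto_intros) auto
    qed
    from tendsto_ennrealI[OF this] show ?thesis
      by (rule LIMSEQ_le_const2) (use SK_le in blast)
  qed
  have "local_norm p (cube r a) (\<lambda>z. ennreal (vnorm (W z *\<^sub>v Y))) \<le> Lp_norm p lebesgue (\<lambda>z. \<integral>\<^sup>+ k. ennreal (\<Lambda> k) * \<Phi> k z \<partial>count_space UNIV)"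
    unfolding local_norm_def
  proof (rule Lp_norm_mono)
    show "(\<lambda>z. ennreal (vnorm (W z *\<^sub>v Y)) * indicator (cube r a) z) \<in> borel_measurable lebesgue"
      using weight_vnorm_measurable[OF W Yc] by measurable
    show "ennreal (vnorm (W z *\<^sub>v Y)) * indicator (cube r a) z \<le> (\<integral>\<^sup>+ k. ennreal (\<Lambda> k) * \<Phi> k z \<partial>count_space UNIV)" for z
      using pointwise[of z] by (simp add: indicator_def Q_def)
  qed
  also have "\<dots> \<le> (\<integral>\<^sup>+ k. ennreal (\<Lambda> k) \<partial>count_space UNIV) * B"
    by (rule Lp_norm_weighted_sum_le[OF p _ \<Phi>m \<Phi>B]) (simp_all only: \<Lambda>sum countableI_type ennreal_less_top)
  also have "\<dots> = ennreal (exp (\<alpha> * n * r\<^sup>2 / 4) * exp (\<alpha> * n * r\<^sup>2 / 2) * N * B0) * Lf"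
    unfolding \<Lambda>sum B_def using N B0 by (simp add: ennreal_mult mult_ac)
  also have "exp (\<alpha> * n * r\<^sup>2 / 4) * exp (\<alpha> * n * r\<^sup>2 / 2) * N * B0 = (pi / \<alpha>) ^ CARD('n) * exp (CARD('n) * \<alpha> * r\<^sup>2) * N"
  proof -
    have "exp (\<alpha> * n * r\<^sup>2 / 4) * exp (\<alpha> * n * r\<^sup>2 / 2) * exp (\<alpha> * n * r\<^sup>2 / 4) = exp (CARD('n) * \<alpha> * r\<^sup>2)"
      by (simp add: exp_add[symmetric] n_def)
    then show ?thesis by (simp add: B0_def mult_ac)
  qed
  finally show ?thesis by (simp only: Lf_def)
qed

lemma dual_norm_pairing_le:
  assumes y: "y \<in> carrier_vec d" and R: "\<sigma> y \<le> ennreal R" "0 < R"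
  shows "ennreal (cmod (x \<bullet>c y)) \<le> dual_norm d \<sigma> x * ennreal R"
proof (cases "x \<bullet>c y = 0")
  case False
  have "y \<noteq> 0\<^sub>v d"
  proof
    assume "y = 0\<^sub>v d"
    then have "x \<bullet>c y = 0" using cscalar_sum[OF y, of x] by simp
    with False show False ..
  qed
  have pos: "0 < cmod (x \<bullet>c y)" using False by simp
  have "ennreal (cmod (x \<bullet>c y)) / ennreal R \<le> ennreal (cmod (x \<bullet>c y)) / \<sigma> y"
  proof (cases "\<sigma> y = 0")
    case True
    then show ?thesis using pos by (simp add: ennreal_divide_zero)
  next
    case False
    then obtain s where s: "\<sigma> y = ennreal s" "0 < s" "s \<le> R"
      using R by (cases "\<sigma> y") (auto simp: less_le top_unique)
    then show ?thesis using R by (simp add: divide_ennreal ennreal_leI divide_left_mono)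
  qed
  also have "\<dots> \<le> dual_norm d \<sigma> x"
    unfolding dual_norm_def using y \<open>y \<noteq> 0\<^sub>v d\<close> by (intro SUP_upper) auto
  finally have "ennreal (cmod (x \<bullet>c y)) / ennreal R * ennreal R \<le> dual_norm d \<sigma> x * ennreal R"
    by (rule mult_right_mono) simp
  then show ?thesis using R(2) by (simp add: divide_ennreal ennreal_mult[symmetric])
qed simp

text \<open>Duality reduces the estimate of \<open>\<sigma>\<^sub>Q(x)\<close> to the pairing of \<open>g = \<bar>W\<^sup>-\<^sup>1 x\<bar>\<close> with bounded scalar functions \<open>h\<close>. The
vector function \<open>f = (h / g) W\<^sup>-\<^sup>2 x\<close> satisfies \<open>\<bar>W f\<bar> \<le> h\<close> and \<open>\<langle>f, x\<rangle> = h g\<close>, so the pairing is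
\<open>\<langle>Y, x\<rangle>\<close> for the integral \<open>Y\<close> of \<open>f\<close> over \<open>Q\<close>. This is at most \<open>\<tau>\<^sub>Q(x)\<close> times the norm
\<open>\<rho>\<^sub>p\<^sub>,\<^sub>Q(Y)\<close>, which is controlled by the averaging estimate. The sets \<open>E m\<close> keep \<open>f\<close> bounded.\<close>

lemma A_metric_bound_of_fock_proj_bound:
  fixes W :: "complex^'n \<Rightarrow> complex Matrix.mat" and \<alpha> r N :: real
  assumes p: "1 \<le> p" and \<alpha>: "0 < \<alpha>" and r: "0 < r" and W: "matrix_weight d W"
    and bound: "fock_proj_bound \<alpha> p d W N" and N: "0 < N"
  shows "A_metric_bound p r d (\<lambda>z x. ennreal (vnorm (W z *\<^sub>v x)))
    (N / ((\<alpha> * r\<^sup>2 / pi) ^ CARD('n) * exp (- (real CARD('n) * \<alpha> * r\<^sup>2))))"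
  unfolding A_metric_bound_weight_iff
proof (intro conjI ballI)
  show "0 < N / ((\<alpha> * r\<^sup>2 / pi) ^ CARD('n) * exp (- (real CARD('n) * \<alpha> * r\<^sup>2)))"
    using N \<alpha> r by simp
  fix x :: "complex Matrix.vec" and Q :: "(complex^'n) set" assume x: "x \<in> carrier_vec d" and Q: "Q \<in> cubes r"
  obtain a where Qa: "Q = cube r a" using Q by (auto simp: cubes_def cube_def)
  note [measurable] = sets_cube[OF Q] good_set_measurable[OF W]
  define V where "V = r ^ (2 * CARD('n))"
  have V: "0 < V" using r by (simp add: V_def)
  have VQ: "emeasure lebesgue Q = ennreal V" using emeasure_cube[OF Q r] by (simp add: V_def)
  define k0 where "k0 = (pi / \<alpha>) ^ CARD('n) * exp (CARD('n) * \<alpha> * r\<^sup>2)"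
  have k0: "0 < k0" using \<alpha> by (simp add: k0_def)
  define e where "e = exponent_inv p"
  let ?Wi = "weight_inv d W"
  define g where "g z = vnorm (?Wi z *\<^sub>v x)" for z
  define gQ where "gQ z = g z * indicator Q z" for z
  define M where "M z = (\<Sum>i<d. \<Sum>j<d. cmod (?Wi z $$ (i, j)))" for z
  have Wi_x: "?Wi z *\<^sub>v x \<in> carrier_vec d" for z using mult_mat_vec_carrier[OF weight_inv_carrier x] .
  have Wi_xm: "vec_measurable d lebesgue (\<lambda>z. ?Wi z *\<^sub>v x)"
    by (rule vec_measurable_mult[OF weight_inv_measurable[OF W] vec_measurable_const[OF x]])
  have gm[measurable]: "g \<in> borel_measurable lebesgue"
    unfolding g_def[abs_def] by (rule vec_measurable_vnorm[OF Wi_xm])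
  have g0: "0 \<le> g z" for z by (simp add: g_def)
  have gQm[measurable]: "gQ \<in> borel_measurable lebesgue" unfolding gQ_def[abs_def] by measurable
  have Mm[measurable]: "M \<in> borel_measurable lebesgue"
    unfolding M_def[abs_def] using weight_inv_measurable[OF W]
    by (intro borel_measurable_sum measurable_compose[OF _ borel_measurable_norm]) (auto simp: mat_measurable_def)
  have M0: "0 \<le> M z" for z unfolding M_def by (intro sum_nonneg) auto
  obtain t where t: "dual_norm d (weight_avg p W Q) x = ennreal t" "0 \<le> t"
    using dual_weight_avg_finite[OF p W r Q x] by (cases "dual_norm d (weight_avg p W Q) x") auto
  define K where "K = t * (V powr - e * k0 * N)"
  have K0: "0 \<le> K" using t k0 N by (simp add: K_def)
  define E where "E m = {z \<in> space lebesgue. z \<in> Q \<and> z \<in> {z. good_mat d (W z)} \<and> g z \<le> real m \<and> M z \<le> real m}" for m :: nat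
  have Em[measurable]: "E m \<in> sets lebesgue" for m unfolding E_def by measurable
  have "Lp_norm (conj_exponent p) lebesgue (\<lambda>z. ennreal (gQ z)) \<le> ennreal K"
  proof (rule Lp_norm_le_by_duality[OF p gQm, where E = E])
    show "0 \<le> gQ z" for z by (simp add: gQ_def g0)
    show "E m \<in> sets lebesgue" for m by (rule Em)
    show "incseq E" by (auto simp: incseq_def E_def)
    show "emeasure lebesgue (E m) < top" for m
    proof -
      have "emeasure lebesgue (E m) \<le> emeasure lebesgue Q" by (intro emeasure_mono) (auto simp: E_def sets_cube[OF Q])
      then show ?thesis using VQ by (auto intro: le_less_trans)
    qed
    show "gQ z \<le> real m" if "z \<in> E m" for m z using that by (auto simp: E_def gQ_def)
    show "AE z in lebesgue. gQ z \<noteq> 0 \<longrightarrow> z \<in> (\<Union>m. E m)"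
      using matrix_weight_AE_good[OF W]
    proof eventually_elim
      case (elim z)
      obtain m :: nat where "max (g z) (M z) \<le> real m" using real_arch_simple by blast
      then show ?case using elim by (auto simp: gQ_def E_def indicator_def)
    qed
    show "0 \<le> K" by (rule K0)
    fix m h b
    assume hm[measurable]: "h \<in> borel_measurable lebesgue" and h0: "\<And>z. 0 \<le> h z" and hb: "\<And>z. h z \<le> b"
      and hE: "\<And>z. z \<notin> E m \<Longrightarrow> h z = (0::real)"
    have b0: "0 \<le> b" using h0 hb order_trans by blast
    \<comment> \<open>Where \<open>g u = 0\<close> the quotient is \<open>0\<close> by convention, and so is the pairing \<open>h u * g u\<close>.\<close>
    define f where "f u = complex_of_real (h u / g u) \<cdot>\<^sub>v (?Wi u *\<^sub>v (?Wi u *\<^sub>v x))" for u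
    have WWc: "?Wi u *\<^sub>v (?Wi u *\<^sub>v x) \<in> carrier_vec d" for u
      using mult_mat_vec_carrier[OF weight_inv_carrier Wi_x] .
    have WWm: "vec_measurable d lebesgue (\<lambda>u. ?Wi u *\<^sub>v (?Wi u *\<^sub>v x))"
      by (rule vec_measurable_mult[OF weight_inv_measurable[OF W] Wi_xm])
    have fc: "f u \<in> carrier_vec d" for u using WWc by (simp add: f_def)
    have fm: "vec_measurable d lebesgue f"
      unfolding vec_measurable_def
    proof (intro conjI allI impI fc)
      fix i assume i: "i < d"
      then have "(\<lambda>u. f u $ i) = (\<lambda>u. complex_of_real (h u / g u) * (?Wi u *\<^sub>v (?Wi u *\<^sub>v x)) $ i)"
        by (simp add: f_def carrier_matD[OF weight_inv_carrier] del: index_mult_mat_vec)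
      moreover have "(\<lambda>u. (?Wi u *\<^sub>v (?Wi u *\<^sub>v x)) $ i) \<in> borel_measurable lebesgue"
        using WWm i by (simp add: vec_measurable_def)
      ultimately show "(\<lambda>u. f u $ i) \<in> borel_measurable lebesgue" by simp
    qed
    have hQ: "h u = 0" if "u \<notin> Q" for u using that hE[of u] by (auto simp: E_def)
    have f_off: "f u = 0\<^sub>v d" if "u \<notin> E m" for u
      using hE[OF that] by (intro eq_vecI) (auto simp: f_def carrier_matD[OF weight_inv_carrier] simp del: index_mult_mat_vec)
    have fb: "vnorm (f u) \<le> b * real m" for u
    proof (cases "u \<in> E m \<and> g u \<noteq> 0")
      case True
      then have gu: "0 < g u" using g0[of u] by simp
      have "vnorm (?Wi u *\<^sub>v (?Wi u *\<^sub>v x)) \<le> M u * g u"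
        unfolding M_def g_def by (rule vnorm_mult_mat_le_entries[OF weight_inv_carrier Wi_x])
      then have "h u / g u * vnorm (?Wi u *\<^sub>v (?Wi u *\<^sub>v x)) \<le> h u / g u * (M u * g u)"
        using h0 g0 by (intro mult_left_mono) auto
      also have "\<dots> = h u * M u" using gu by simp
      also have "\<dots> \<le> b * real m" using True h0[of u] hb[of u] b0 M0[of u] by (intro mult_mono) (auto simp: E_def)
      finally show ?thesis using h0[of u] g0[of u] by (simp add: f_def vnorm_smult norm_divide)
    next
      case False
      then have "h u / g u = 0" using hE[of u] by auto
      then show ?thesis using b0 by (auto simp: f_def vnorm_smult norm_divide)
    qed
    have Wi_good: "?Wi u = inv_mat (W u)" "good_mat d (W u)" if "u \<in> E m" for u
      using that by (auto simp: E_def weight_inv_def)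
    have Wf: "vnorm (W u *\<^sub>v f u) \<le> h u" for u
    proof (cases "u \<in> E m")
      case True
      note inv = good_mat_inverse[OF Wi_good(2)[OF True]]
      have "W u *\<^sub>v f u = complex_of_real (h u / g u) \<cdot>\<^sub>v (?Wi u *\<^sub>v x)"
        unfolding f_def mult_mat_vec[OF inv(1) WWc] using inv(3)[OF Wi_x] Wi_good(1)[OF True] by metis
      then have "vnorm (W u *\<^sub>v f u) = h u / g u * g u"
        using h0[of u] g0[of u] by (simp add: vnorm_smult norm_divide g_def)
      then show ?thesis using h0[of u] by (cases "g u = 0") auto
    next
      case False
      have "W u \<in> carrier_mat d d" using W by (simp add: matrix_weight_def)
      then show ?thesis using f_off[OF False] mult_mat_zero_vec[of "W u" d d] vnorm_eq_0_iff[of "0\<^sub>v d" d] h0[of u] by simp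
    qed
    have fx: "f u \<bullet>c x = complex_of_real (h u * gQ u)" for u
    proof (cases "u \<in> E m")
      case True
      note inv = good_mat_inverse[OF Wi_good(2)[OF True]]
      have "(?Wi u *\<^sub>v (?Wi u *\<^sub>v x)) \<bullet>c x = (?Wi u *\<^sub>v x) \<bullet>c (?Wi u *\<^sub>v x)"
        using inv(5)[OF Wi_x x, of u] Wi_good(1)[OF True] by simp
      then have "(?Wi u *\<^sub>v (?Wi u *\<^sub>v x)) \<bullet>c x = complex_of_real ((g u)\<^sup>2)" by (simp add: cscalar_self g_def)
      moreover have "f u \<bullet>c x = complex_of_real (h u / g u) * ((?Wi u *\<^sub>v (?Wi u *\<^sub>v x)) \<bullet>c x)"
        using smult_scalar_prod_distrib[OF WWc, of "conjugate x"] x by (simp add: f_def)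
      ultimately have "f u \<bullet>c x = complex_of_real (h u / g u * (g u)\<^sup>2)" by simp
      also have "h u / g u * (g u)\<^sup>2 = h u * gQ u"
        using True by (simp add: power2_eq_square gQ_def E_def)
      finally show ?thesis .
    next
      case False
      then show ?thesis using f_off[OF False] hE[OF False] x by simp
    qed
    define H where "H = Lp_norm p lebesgue (\<lambda>z. ennreal (h z))"
    have Htop: "H < top"
    proof -
      have "H \<le> Lp_norm p lebesgue (\<lambda>z. ennreal b * indicator Q z)"
        unfolding H_def using hb hQ by (intro Lp_norm_mono) (auto simp: indicator_def ennreal_leI)
      also have "\<dots> \<le> ennreal b * Lp_norm p lebesgue (indicator Q)"
        by (intro Lp_norm_cmult_le[OF p]) measurable
      also have "\<dots> < top"
        using Lp_norm_indicator_finite[OF p sets_cube[OF Q]] VQ by (simp add: ennreal_mult_less_top)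
      finally show ?thesis .
    qed
    define F where "F = Lp_norm p lebesgue (\<lambda>u. ennreal (vnorm (W u *\<^sub>v f u)))"
    note [measurable] = vec_measurable_vnorm[OF vec_measurable_mult[OF matrix_weight_measurable[OF W] fm]]
    have FH: "F \<le> H" unfolding F_def H_def using Wf by (intro Lp_norm_mono) (auto intro: ennreal_leI)
    define Y where "Y = Matrix.vec d (\<lambda>i. LINT u|lebesgue. f u $ i)"
    have Y: "Y \<in> carrier_vec d" by (simp add: Y_def)
    have int: "integrable lebesgue (\<lambda>u. f u $ i)" if i: "i < d" for i
    proof (rule Bochner_Integration.integrable_bound)
      show "integrable lebesgue (\<lambda>u. b * real m * indicator Q u)"
        using VQ by (intro integrable_mult_right integrable_real_indicator) (auto simp: sets_cube[OF Q])
      show "(\<lambda>u. f u $ i) \<in> borel_measurable lebesgue" using fm i by (simp add: vec_measurable_def)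
      show "AE u in lebesgue. norm (f u $ i) \<le> norm (b * real m * indicator Q u)"
      proof (rule AE_I2)
        fix u :: "complex^'n"
        show "norm (f u $ i) \<le> norm (b * real m * indicator Q u)"
        proof (cases "u \<in> Q")
          case True
          then show ?thesis using cmod_index_le_vnorm[of i "f u"] fb[of u] fc[of u] i b0 by (simp add: abs_mult)
        next
          case False
          then have "u \<notin> E m" by (auto simp: E_def)
          then show ?thesis using f_off[of u] i by simp
        qed
      qed
    qed
    have pairing: "(\<integral>\<^sup>+ u. ennreal (h u * gQ u) \<partial>lebesgue) = ennreal (cmod (x \<bullet>c Y))"
    proof -
      have fxi: "(\<Sum>i<d. f u $ i * cnj (x $ i)) = complex_of_real (h u * gQ u)" for u
        using fx[of u] by (simp only: cscalar_sum[OF x])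
      have int_c: "integrable lebesgue (\<lambda>u. complex_of_real (h u * gQ u))"
        unfolding fxi[symmetric] using int by (intro Bochner_Integration.integrable_sum integrable_mult_left) auto
      from integrable_Re[OF int_c] have int_r: "integrable lebesgue (\<lambda>u. h u * gQ u)" by simp
      have "Y \<bullet>c x = (\<Sum>i<d. LINT u|lebesgue. f u $ i * cnj (x $ i))"
        unfolding cscalar_sum[OF x] by (simp add: Y_def)
      also have "\<dots> = (LINT u|lebesgue. complex_of_real (h u * gQ u))"
        unfolding fxi[symmetric] using int by (intro Bochner_Integration.integral_sum[symmetric] integrable_mult_left) auto
      also have "\<dots> = complex_of_real (LINT u|lebesgue. h u * gQ u)" by (simp only: integral_complex_of_real)
      finally have "cmod (Y \<bullet>c x) = \<bar>LINT u|lebesgue. h u * gQ u\<bar>" by simp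
      moreover have "0 \<le> (LINT u|lebesgue. h u * gQ u)" using h0 g0 by (intro integral_nonneg_AE) (auto simp: gQ_def)
      moreover have "cmod (Y \<bullet>c x) = cmod (x \<bullet>c Y)" using cscalar_commute[OF x Y] by (metis complex_mod_cnj)
      ultimately show ?thesis
        using h0 g0 int_r by (subst nn_integral_eq_integral) (auto simp: gQ_def)
    qed
    show "(\<integral>\<^sup>+ u. ennreal (h u * gQ u) \<partial>lebesgue) \<le> ennreal K * Lp_norm p lebesgue (\<lambda>z. ennreal (h z))"
    proof (cases "H = 0")
      case True
      have "(\<integral>\<^sup>+ u. ennreal (h u * gQ u) \<partial>lebesgue) = (\<integral>\<^sup>+ u. ennreal (h u) * ennreal (gQ u) \<partial>lebesgue)"
        using h0 g0 by (intro nn_integral_cong) (simp add: ennreal_mult gQ_def)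
      also have "\<dots> \<le> Lp_norm p lebesgue (\<lambda>u. ennreal (h u)) * Lp_norm (conj_exponent p) lebesgue (\<lambda>u. ennreal (gQ u))"
        by (intro Hoelder_inequality[OF p]) measurable
      also have "\<dots> = 0" using True by (simp add: H_def)
      finally show ?thesis by simp
    next
      case False
      then obtain H' where H': "H = ennreal H'" "0 < H'" using Htop by (cases H) (auto simp: less_le)
      define R where "R = V powr - e * (k0 * N * H')"
      have R: "0 < R" using V k0 N H' by (simp add: R_def)
      have "local_norm p Q (\<lambda>z. ennreal (vnorm (W z *\<^sub>v Y))) \<le> ennreal (k0 * N) * F"
        unfolding Qa Y_def F_def k0_def
      proof (rule fock_proj_dominates_averaging[OF p \<alpha> r W bound fm])
        show "f u = 0\<^sub>v d" if "u \<notin> cube r a" for u using that f_off[of u] by (auto simp: E_def Qa)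
        show "vnorm (f u) \<le> b * real m" for u by (rule fb)
        show "Lp_norm p lebesgue (\<lambda>u. ennreal (vnorm (W u *\<^sub>v f u))) < top"
          using FH Htop unfolding F_def by (rule le_less_trans)
      qed
      also have "\<dots> \<le> ennreal (k0 * N) * H" using FH by (rule mult_left_mono) simp
      finally have "weight_avg p W Q Y \<le> ennreal (V powr - e) * (ennreal (k0 * N) * ennreal H')"
        unfolding weight_avg_eq[OF p Q r W Y] V_def[symmetric] e_def[symmetric] H' by (rule mult_left_mono) simp
      also have "\<dots> = ennreal R" using k0 N H' by (simp add: R_def ennreal_mult)
      finally have "ennreal (cmod (x \<bullet>c Y)) \<le> dual_norm d (weight_avg p W Q) x * ennreal R"
        using R by (intro dual_norm_pairing_le Y)
      also have "\<dots> = ennreal K * H" using t R H' k0 N K0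
        by (simp add: R_def K_def ennreal_mult[symmetric] mult_ac)
      finally show ?thesis unfolding pairing H_def .
    qed
  qed
  then have "local_norm (conj_exponent p) Q (\<lambda>z. ennreal (vnorm (?Wi z *\<^sub>v x))) \<le> ennreal K"
    using g0 by (simp add: local_norm_def gQ_def g_def ennreal_mult ennreal_indicator)
  then have "dual_avg d p W Q x \<le> ennreal (V powr - exponent_inv (conj_exponent p)) * ennreal K"
    unfolding dual_avg_eq[OF p Q r W x] V_def[symmetric] by (rule mult_left_mono) simp
  also have "\<dots> = ennreal (k0 * N / V) * ennreal t"
  proof -
    have "V powr - exponent_inv (conj_exponent p) * V powr - e = 1 / V"
    proof -
      have "V powr - exponent_inv (conj_exponent p) * V powr - e = V powr (- (exponent_inv p + exponent_inv (conj_exponent p)))"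
        by (simp add: powr_add[symmetric] e_def add.commute)
      then show ?thesis unfolding exponent_inv_conj[OF p] using V by (simp add: powr_minus_divide)
    qed
    then have "V powr - exponent_inv (conj_exponent p) * K = k0 * N / V * t"
      unfolding K_def by (metis (no_types, opaque_lifting) mult.assoc mult.commute mult.left_neutral times_divide_eq_right divide_inverse)
    then show ?thesis using K0 k0 N V t by (simp add: ennreal_mult[symmetric])
  qed
  also have "k0 * N / V = N / ((\<alpha> * r\<^sup>2 / pi) ^ CARD('n) * exp (- (real CARD('n) * \<alpha> * r\<^sup>2)))"
  proof -
    have "V = (r\<^sup>2) ^ CARD('n)" by (simp add: V_def power_mult)
    then show ?thesis using \<alpha> r by (simp add: k0_def power_divide power_mult_distrib exp_minus field_simps)
  qed
  finally show "dual_avg d p W Q x \<le> ennreal (N / ((\<alpha> * r\<^sup>2 / pi) ^ CARD('n) * exp (- (real CARD('n) * \<alpha> * r\<^sup>2)))) * dual_norm d (weight_avg p W Q) x"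
    by (simp only: t)
qed

lemma fock_proj_bound_mono: "fock_proj_bound \<alpha> p d W N \<Longrightarrow> N \<le> N' \<Longrightarrow> fock_proj_bound \<alpha> p d W N'"
  unfolding fock_proj_bound_def
  by (meson ennreal_leI mult_right_mono order_trans zero_le)

lemma A_weight_of_fock_proj_bounded:
  fixes W :: "complex^'n \<Rightarrow> complex Matrix.mat"
  assumes p: "1 \<le> p" and \<alpha>: "0 < \<alpha>" and r: "0 < r" and W: "matrix_weight d W"
    and bdd: "fock_proj_bounded \<alpha> p d W"
  shows "A_weight p r d W"
proof -
  obtain N where "fock_proj_bound \<alpha> p d W N" using bdd by (auto simp: fock_proj_bounded_def)
  then have "fock_proj_bound \<alpha> p d W (max N 1)" by (rule fock_proj_bound_mono) simp
  moreover have "0 < max N 1" by simp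
  ultimately show ?thesis
    using A_metric_bound_of_fock_proj_bound[OF p \<alpha> r W] unfolding A_weight_def A_metric_def by blast
qed

text \<open>\<open>A_metric_bound_of_fock_proj_bound\<close> concerns positive bounds; approaching \<open>N\<close> from above covers also
\<open>N = 0\<close>.\<close>

lemma A_weight_const_le_fock_proj_bound:
  fixes W :: "complex^'n \<Rightarrow> complex Matrix.mat" and \<alpha> r N :: real
  assumes p: "1 \<le> p" and \<alpha>: "0 < \<alpha>" and r: "0 < r" and W: "matrix_weight d W"
    and bound: "fock_proj_bound \<alpha> p d W N"
  shows "(\<alpha> * r\<^sup>2 / pi) ^ CARD('n) * exp (- (real CARD('n) * \<alpha> * r\<^sup>2)) * A_weight_const p r d W \<le> N"
proof (rule dense_ge)
  fix N' assume N': "N < N'"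
  define k where "k = (\<alpha> * r\<^sup>2 / pi) ^ CARD('n) * exp (- (real CARD('n) * \<alpha> * r\<^sup>2))"
  have k: "0 < k" using \<alpha> r by (simp add: k_def)
  have "0 \<le> N" using bound by (simp add: fock_proj_bound_def)
  then have "A_metric_bound p r d (\<lambda>z x. ennreal (vnorm (W z *\<^sub>v x))) (N' / k)"
    unfolding k_def using N' by (intro A_metric_bound_of_fock_proj_bound[OF p \<alpha> r W] fock_proj_bound_mono[OF bound]) auto
  then have "A_weight_const p r d W \<le> N' / k"
    unfolding A_weight_const_def A_metric_const_def
    by (intro cInf_lower bdd_belowI[of _ 0]) (auto simp: A_metric_bound_def)
  then show "(\<alpha> * r\<^sup>2 / pi) ^ CARD('n) * exp (- (real CARD('n) * \<alpha> * r\<^sup>2)) * A_weight_const p r d W \<le> N'"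
    unfolding k_def[symmetric] using k by (simp add: pos_le_divide_eq mult.commute)
qed

section \<open>The characterisation\<close>

theorem theorem3p1:
  fixes \<alpha> :: real and p :: ennreal
  assumes "0 < \<alpha>" and "1 \<le> p"
  shows
    "(\<forall>d\<ge>1. \<forall>W :: complex ^ 'n \<Rightarrow> complex Matrix.mat. matrix_weight d W \<longrightarrow>
        (fock_proj_bounded \<alpha> p d W \<longleftrightarrow> max_fock_proj_bounded \<alpha> p d W) \<and>
        (max_fock_proj_bounded \<alpha> p d W \<longleftrightarrow> (\<forall>r>0. A_weight p r d W)) \<and>
        ((\<forall>r>0. A_weight p r d W) \<longleftrightarrow> (\<exists>r>0. A_weight p r d W))) \<and>
     (\<forall>r>0. \<exists>c>0. \<forall>d\<ge>1. \<forall>W :: complex ^ 'n \<Rightarrow> complex Matrix.mat.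
        matrix_weight d W \<and> fock_proj_bounded \<alpha> p d W \<longrightarrow>
        (\<alpha> * r\<^sup>2 / pi) ^ CARD('n) * exp (- (real CARD('n) * \<alpha> * r\<^sup>2))
            * A_weight_const p r d W powr (1 / 2)
          \<le> fock_proj_norm \<alpha> p d W \<and>
        fock_proj_norm \<alpha> p d W \<le> max_fock_proj_norm \<alpha> p d W \<and>
        max_fock_proj_norm \<alpha> p d W
          \<le> c * real d powr (if p = 1 \<or> p = \<infinity> then 9 / 2 else 7 / 2)
              * A_weight_const p r d W powr (c * (1 + ln (A_weight_const p r d W))))"
proof -
  note \<alpha> = assms(1) and p = assms(2)
  define s :: real where "s = (if p = 1 \<or> p = \<infinity> then 9 / 2 else 7 / 2)"
  have s: "1 \<le> s" by (simp add: s_def)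
  have ab: "fock_proj_bound \<alpha> p d W C" if "matrix_weight d W" "max_fock_proj_bound \<alpha> p d W C" for d C and W :: "complex ^ 'n \<Rightarrow> complex Matrix.mat"
    by (rule fock_proj_bound_of_max_fock_proj_bound[OF p \<alpha> that])
  have ba: "fock_proj_bounded \<alpha> p d W" if "matrix_weight d W" "max_fock_proj_bounded \<alpha> p d W" for d and W :: "complex ^ 'n \<Rightarrow> complex Matrix.mat"
    using ab that by (auto simp: fock_proj_bounded_def max_fock_proj_bounded_def)
  have ac: "A_weight p r d W" if "matrix_weight d W" "fock_proj_bounded \<alpha> p d W" "0 < r" for d r and W :: "complex ^ 'n \<Rightarrow> complex Matrix.mat"
    by (rule A_weight_of_fock_proj_bounded[OF p \<alpha> that(3,1,2)])
  have main: "\<exists>c>0. \<forall>d\<ge>1. \<forall>W :: complex ^ 'n \<Rightarrow> complex Matrix.mat.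
      matrix_weight d W \<longrightarrow> A_weight p r d W \<longrightarrow>
      max_fock_proj_bound \<alpha> p d W (c * real d powr s * A_weight_const p r d W powr (c * (1 + ln (A_weight_const p r d W))))"
    if r: "0 < r" for r
  proof -
    obtain c where "0 < c" and c: "\<And>d C s. \<And>W :: complex^'n \<Rightarrow> complex Matrix.mat. 1 \<le> d \<Longrightarrow> 1 \<le> C \<Longrightarrow> 1 \<le> s \<Longrightarrow>
      matrix_weight d W \<Longrightarrow> A_metric_bound p r d (\<lambda>z x. ennreal (vnorm (W z *\<^sub>v x))) C \<Longrightarrow>
      max_fock_proj_bound \<alpha> p d W (c * real d powr s * C powr (c * (1 + ln C)))"
      using max_fock_proj_bound_of_A_metric_bound[OF p \<alpha> r, where 'n = 'n] by blast
    show ?thesis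
      using \<open>0 < c\<close> c[OF _ _ s] A_weight_const_bound[OF p _ _ r, where 'n = 'n]
      by (intro exI[of _ c]) auto
  qed
  have db: "max_fock_proj_bounded \<alpha> p d W" if "1 \<le> d" "matrix_weight d W" "A_weight p r d W" "0 < r" for d r and W :: "complex ^ 'n \<Rightarrow> complex Matrix.mat"
    using main[OF that(4)] that by (auto simp: max_fock_proj_bounded_def)
  have part1: "(fock_proj_bounded \<alpha> p d W \<longleftrightarrow> max_fock_proj_bounded \<alpha> p d W) \<and>
        (max_fock_proj_bounded \<alpha> p d W \<longleftrightarrow> (\<forall>r>0. A_weight p r d W)) \<and>
        ((\<forall>r>0. A_weight p r d W) \<longleftrightarrow> (\<exists>r>0. A_weight p r d W))"
    if d: "1 \<le> d" and W: "matrix_weight d W" for d and W :: "complex ^ 'n \<Rightarrow> complex Matrix.mat"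
  proof -
    have "(0::real) < 1" by simp
    then show ?thesis using ba[OF W] ac[OF W] db[OF d W] by blast
  qed
  have part2: "\<exists>c>0. \<forall>d\<ge>1. \<forall>W :: complex ^ 'n \<Rightarrow> complex Matrix.mat.
        matrix_weight d W \<and> fock_proj_bounded \<alpha> p d W \<longrightarrow>
        (\<alpha> * r\<^sup>2 / pi) ^ CARD('n) * exp (- (real CARD('n) * \<alpha> * r\<^sup>2))
            * A_weight_const p r d W powr (1 / 2)
          \<le> fock_proj_norm \<alpha> p d W \<and>
        fock_proj_norm \<alpha> p d W \<le> max_fock_proj_norm \<alpha> p d W \<and>
        max_fock_proj_norm \<alpha> p d W
          \<le> c * real d powr s
              * A_weight_const p r d W powr (c * (1 + ln (A_weight_const p r d W)))"
    if r: "0 < r" for r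
  proof -
    obtain c where "0 < c" and c: "\<And>d. \<And>W :: complex^'n \<Rightarrow> complex Matrix.mat. 1 \<le> d \<Longrightarrow>
      matrix_weight d W \<Longrightarrow> A_weight p r d W \<Longrightarrow>
      max_fock_proj_bound \<alpha> p d W (c * real d powr s * A_weight_const p r d W powr (c * (1 + ln (A_weight_const p r d W))))"
      using main[OF r] by blast
    show ?thesis
    proof (intro exI[of _ c] conjI \<open>0 < c\<close> allI impI; elim conjE)
      fix d :: nat and W :: "complex ^ 'n \<Rightarrow> complex Matrix.mat"
      assume d: "1 \<le> d" and W: "matrix_weight d W" and a: "fock_proj_bounded \<alpha> p d W"
      have A: "A_weight p r d W" by (rule ac[OF W a r])
      define w where "w = A_weight_const p r d W"
      have w: "1 \<le> w" unfolding w_def by (rule A_weight_const_bound(2)[OF p d W r A])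
      have "w powr (1 / 2) \<le> w powr 1" using w by (intro powr_mono) auto
      then have w2: "w powr (1 / 2) \<le> w" using w by simp
      have bdd: "bdd_below {C. fock_proj_bound \<alpha> p d W C}" "bdd_below {C. max_fock_proj_bound \<alpha> p d W C}"
        by (auto intro!: bdd_belowI[of _ 0] simp: fock_proj_bound_def max_fock_proj_bound_def)
      have ne: "{C. max_fock_proj_bound \<alpha> p d W C} \<noteq> {}" using c[OF d W A] by auto
      show "(\<alpha> * r\<^sup>2 / pi) ^ CARD('n) * exp (- (real CARD('n) * \<alpha> * r\<^sup>2))
            * A_weight_const p r d W powr (1 / 2) \<le> fock_proj_norm \<alpha> p d W"
        unfolding fock_proj_norm_def
      proof (rule cInf_greatest)
        show "{C. fock_proj_bound \<alpha> p d W C} \<noteq> {}" using a by (auto simp: fock_proj_bounded_def)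
        fix N assume "N \<in> {C. fock_proj_bound \<alpha> p d W C}"
        then have N: "fock_proj_bound \<alpha> p d W N" by simp
        have "(\<alpha> * r\<^sup>2 / pi) ^ CARD('n) * exp (- (real CARD('n) * \<alpha> * r\<^sup>2)) * A_weight_const p r d W powr (1 / 2)
          \<le> (\<alpha> * r\<^sup>2 / pi) ^ CARD('n) * exp (- (real CARD('n) * \<alpha> * r\<^sup>2)) * A_weight_const p r d W"
          using w2 \<alpha> unfolding w_def by (intro mult_left_mono) auto
        also have "\<dots> \<le> N" by (rule A_weight_const_le_fock_proj_bound[OF p \<alpha> r W N])
        finally show "(\<alpha> * r\<^sup>2 / pi) ^ CARD('n) * exp (- (real CARD('n) * \<alpha> * r\<^sup>2)) * A_weight_const p r d W powr (1 / 2) \<le> N" .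
      qed
      show "fock_proj_norm \<alpha> p d W \<le> max_fock_proj_norm \<alpha> p d W"
        unfolding fock_proj_norm_def max_fock_proj_norm_def
        using ab[OF W] by (intro cInf_superset_mono ne bdd) auto
      show "max_fock_proj_norm \<alpha> p d W
          \<le> c * real d powr s * A_weight_const p r d W powr (c * (1 + ln (A_weight_const p r d W)))"
        unfolding max_fock_proj_norm_def using c[OF d W A] by (intro cInf_lower bdd) auto
    qed
  qed
  show ?thesis using part1 part2 unfolding s_def by blast
qed

end
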